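(* Let $L\supset\mathbb F_q$ be a finite field. For pure Anderson motives over $L$ (of a fixed characteristic $c^*:A\to L$), being isogenous via a separable isogeny is an equivalence relation.
   Context: Notation: $\mathbb F_q$ is a finite field with $q$ elements, $C$ a smooth projective geometrically irreducible curve over $\mathbb F_q$, $\infty\in C(\mathbb F_q)$ a fixed rational point, $A=\Gamma(C\setminus\{\infty\},\mathcal O_C)$. For a field $L\supset\mathbb F_q$ put $C_L=C\times_{\mathbb F_q}\operatorname{Spec}L$, $A_L=A\otimes_{\mathbb F_q}L$; $\sigma$ is the endomorphism of $C_L$ which is the identity on $C$ and the $q$-Frobenius on $L$, and $\sigma^*$ is pullback along $\sigma$; on $A_L$, $\sigma^*(a\otimes b)=a\otimes b^q$, and $\sigma^*M=M\otimes_{A_L,\sigma^*}A_L$. $\mathcal G(k\cdot\infty)=\mathcal G\otimes\mathcal O_{C_L}(k\cdot\infty)$. Pure Anderson motives: fix an $\mathbb F_q$-homomorphism $c^*:A\to L$ and let $J\subset A_L$ be the ideal generated by all $a\otimes1-1\otimes c^*(a)$, $a\in A$. A pure Anderson motive $\underline M=(M,\tau)$ of rank $r$, dimension $d$ (non-negative integers) and characteristic $c^*$ over $L$ is a locally free $A_L$-module $M$ of rank $r$ with an injective $A_L$-homomorphism $\tau:\sigma^*M\to M$ such that (1) $\operatorname{coker}\tau$ is an $L$-vector space of dimension $d$ annihilated by $J^d$; (2) $M$ extends to a locally free sheaf $\mathcal M$ of rank $r$ on $C_L$ such that for some positive integers $k,l$ the map $\tau^l:=\tau\circ\sigma^*\tau\circ\dots\circ(\sigma^*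 )^{l-1}\tau:(\sigma^* )^lM\to M$ induces an isomorphism $(\sigma^* )^l\mathcal M_\infty\to\mathcal M(k\cdot\infty)_\infty$ of stalks at $\infty$. A morphism $(M,\tau)\to(M',\tau')$ is an $A_L$-homomorphism $f:M\to M'$ with $f\circ\tau=\tau'\circ\sigma^*f$. A morphism is an isogeny if it is injective with torsion cokernel. An isogeny $f:(M,\tau)\to(M',\tau')$ is separable if the homomorphism $\sigma^*\operatorname{coker}f\to\operatorname{coker}f$ induced by $\tau'$ is an isomorphism. *)

theory Defs
  imports
    "HOL-Algebra.Algebraic_Closure_Type"
    "HOL-Algebra.Free_Abelian_Groups"
    "HOL-Algebra.Ideal_Product"
    "HOL-Algebra.Generated_Fields"
    "HOL-Algebra.Finite_Extensions"
    "HOL-Algebra.Module"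
begin

section \<open>Module-theoretic preliminaries\<close>

abbreviation full_ring :: "'a::field ring" where
  "full_ring \<equiv> ring_of_type_algebra"

abbreviation ring_on :: "'a::field set \<Rightarrow> 'a ring" where
  "ring_on S \<equiv> ring_of_type_algebra \<lparr>carrier := S\<rparr>"

text \<open>HOL-Algebra stores modules in a record that extends the ring record; the multiplicative
  fields of a module are never used and are left unspecified below.\<close>

definition mod_homs ::
    "('r, 'z) ring_scheme \<Rightarrow> ('r, 'm) module \<Rightarrow> ('r, 'n) module \<Rightarrow> ('m \<Rightarrow> 'n) set" where
  "mod_homs R M N = {f. f \<in> carrier M \<rightarrow> carrier N \<and>
     (\<forall>x\<in>carrier M. \<forall>y\<in>carrier M. f (x \<oplus>\<^bsub>M\<^esub> y) = f x \<oplus>\<^bsub>N\<^esub> f y) \<and>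
     (\<forall>a\<in>carrier R. \<forall>x\<in>carrier M. f (a \<odot>\<^bsub>M\<^esub> x) = a \<odot>\<^bsub>N\<^esub> f x)}"

definition quotient_module :: "('r, 'm) module \<Rightarrow> 'm set \<Rightarrow> ('r, 'm set) module" where
  "quotient_module M H =
     \<lparr>carrier = a_rcosets\<^bsub>M\<^esub> H, monoid.mult = undefined, one = undefined,
      ring.zero = H, add = (<+>\<^bsub>M\<^esub>),
      module.smult = (\<lambda>a Z. \<Union>x\<in>Z. H +>\<^bsub>M\<^esub> (a \<odot>\<^bsub>M\<^esub> x))\<rparr>"

definition is_basis :: "('r, 'z) ring_scheme \<Rightarrow> ('r, 'm) module \<Rightarrow> 'm list \<Rightarrow> bool" where
  "is_basis R M es \<longleftrightarrow> module R M \<and> set es \<subseteq> carrier M \<and>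
     (\<forall>x\<in>carrier M. \<exists>!c. c \<in> {..<length es} \<rightarrow>\<^sub>E carrier R \<and>
        x = (\<Oplus>\<^bsub>M\<^esub> i\<in>{..<length es}. c i \<odot>\<^bsub>M\<^esub> (es ! i)))"

definition free_of_rank :: "('r, 'z) ring_scheme \<Rightarrow> ('r, 'm) module \<Rightarrow> nat \<Rightarrow> bool" where
  "free_of_rank R M r \<longleftrightarrow> (\<exists>es. length es = r \<and> is_basis R M es)"


subsection \<open>Extension of scalars\<close>

text \<open>For a ring homomorphism \<open>\<phi> : R \<rightarrow> S\<close> and an \<open>R\<close>-module \<open>M\<close>, the \<open>S\<close>-module
  \<open>M \<otimes>\<^sub>R S\<close> is the free abelian group on \<open>M \<times> S\<close> modulo bilinearity and
  \<open>a m \<otimes> s = m \<otimes> \<phi>(a) s\<close>.\<close>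

definition tensor_relations ::
    "('r, 'y) ring_scheme \<Rightarrow> ('s, 'z) ring_scheme \<Rightarrow> ('r \<Rightarrow> 's) \<Rightarrow> ('r, 'm) module
      \<Rightarrow> ('m \<times> 's \<Rightarrow>\<^sub>0 int) set" where
  "tensor_relations R S \<phi> M =
     {frag_of (x \<oplus>\<^bsub>M\<^esub> y, s) - frag_of (x, s) - frag_of (y, s) | x y s.
        x \<in> carrier M \<and> y \<in> carrier M \<and> s \<in> carrier S} \<union>
     {frag_of (x, s \<oplus>\<^bsub>S\<^esub> t) - frag_of (x, s) - frag_of (x, t) | x s t.
        x \<in> carrier M \<and> s \<in> carrier S \<and> t \<in> carrier S} \<union>
     {frag_of (a \<odot>\<^bsub>M\<^esub> x, s) - frag_of (x, \<phi> a \<otimes>\<^bsub>S\<^esub> s) | a x s.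
        a \<in> carrier R \<and> x \<in> carrier M \<and> s \<in> carrier S}"

definition tensor_null ::
    "('r, 'y) ring_scheme \<Rightarrow> ('s, 'z) ring_scheme \<Rightarrow> ('r \<Rightarrow> 's) \<Rightarrow> ('r, 'm) module
      \<Rightarrow> ('m \<times> 's \<Rightarrow>\<^sub>0 int) set" where
  "tensor_null R S \<phi> M =
     generate (free_Abelian_group (carrier M \<times> carrier S)) (tensor_relations R S \<phi> M)"

definition base_change ::
    "('r, 'y) ring_scheme \<Rightarrow> ('s, 'z) ring_scheme \<Rightarrow> ('r \<Rightarrow> 's) \<Rightarrow> ('r, 'm) module
      \<Rightarrow> ('s, ('m \<times> 's \<Rightarrow>\<^sub>0 int) set) module" where
  "base_change R S \<phi> M =
     (let G = free_Abelian_group (carrier M \<times> carrier S); N = tensor_null R S \<phi> M in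
      \<lparr>carrier = rcosets\<^bsub>G\<^esub> N, monoid.mult = undefined, one = undefined,
       ring.zero = N, add = (<#>\<^bsub>G\<^esub>),
       module.smult = (\<lambda>a Z. \<Union>u\<in>Z. N #>\<^bsub>G\<^esub>
                  frag_extend (\<lambda>(x, s). frag_of (x, a \<otimes>\<^bsub>S\<^esub> s)) u)\<rparr>)"

definition pure_tensor ::
    "('r, 'y) ring_scheme \<Rightarrow> ('s, 'z) ring_scheme \<Rightarrow> ('r \<Rightarrow> 's) \<Rightarrow> ('r, 'm) module
      \<Rightarrow> 'm \<Rightarrow> 's \<Rightarrow> ('m \<times> 's \<Rightarrow>\<^sub>0 int) set" where
  "pure_tensor R S \<phi> M x s =
     tensor_null R S \<phi> M #>\<^bsub>free_Abelian_group (carrier M \<times> carrier S)\<^esub> frag_of (x, s)"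

text \<open>The additive map with \<open>x \<otimes> s \<mapsto> h (x, s)\<close>, evaluated on a representative. It is used
  only for \<open>h\<close> respecting the tensor relations, where the representative is immaterial.\<close>

definition tensor_lift ::
    "('p, 'z) ring_scheme \<Rightarrow> ('m \<times> 's \<Rightarrow> 'p) \<Rightarrow> ('m \<times> 's \<Rightarrow>\<^sub>0 int) set \<Rightarrow> 'p" where
  "tensor_lift P h Z = (let u = (SOME u. u \<in> Z) in
     \<Oplus>\<^bsub>P\<^esub> p\<in>Poly_Mapping.keys u. add_pow P (Poly_Mapping.lookup u p) (h p))"


subsection \<open>Locally free modules over a domain\<close>

text \<open>\<open>localized R s\<close> is \<open>R[1/s]\<close> for a subring \<open>R\<close> of a field. A module is locally free of rank
  \<open>r\<close> if every point of \<open>Spec R\<close> has a basic open neighbourhood \<open>D(s)\<close> over which it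
  is free of rank \<open>r\<close>.\<close>

definition localized :: "'a::field set \<Rightarrow> 'a \<Rightarrow> 'a set" where
  "localized R s = {x / s ^ n | x n. x \<in> R}"

definition locally_free :: "'a::field set \<Rightarrow> ('a, 'm) module \<Rightarrow> nat \<Rightarrow> bool" where
  "locally_free R M r \<longleftrightarrow> module (ring_on R) M \<and>
     (\<forall>\<pp>. primeideal \<pp> (ring_on R) \<longrightarrow>
        (\<exists>s\<in>R - \<pp>. free_of_rank (ring_on (localized R s))
           (base_change (ring_on R) (ring_on (localized R s)) id M) r))"


section \<open>Curves\<close>

text \<open>
  A smooth projective geometrically irreducible curve over a perfect field \<open>k\<close> is represented as
  the abstract nonsingular curve of its function field \<open>K\<close>: its closed points are the normalized
  discrete valuations of \<open>K\<close> that are trivial on \<open>k\<close> (all of them, by projectivity), the proper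
  closed sets are the finite sets of closed points, and \<open>\<O>(U)\<close> is the
  intersection of the valuation rings of the points of \<open>U\<close>. The embedding \<open>\<iota>\<close> of \<open>k\<close> in
  \<open>K\<close> is kept explicit. Over a perfect field, geometric irreducibility means that \<open>k\<close> is
  algebraically closed in \<open>K\<close>.

  The generic point belongs to every nonempty open set and is suppressed: a nonempty open set is
  given by the closed points in it, and sheaves are only evaluated on nonempty open sets.
\<close>

definition function_field :: "('f::field \<Rightarrow> 'k::field) \<Rightarrow> bool" where
  "function_field \<iota> \<longleftrightarrow> \<iota> \<in> ring_hom full_ring full_ring \<and>
     (\<exists>x. ring.transcendental full_ring (range \<iota>) x \<and>
          ring.finite_dimension full_ring (generate_field full_ring (insert x (range \<iota>))) UNIV) \<and>
     (\<forall>x. ring.algebraic full_ring (range \<iota>) x \<longrightarrow> x \<in> range \<iota>)"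

text \<open>The value at \<open>0\<close>, conventionally \<open>\<infinity>\<close>, is set to \<open>0\<close> to make the function determined by
  its restriction to nonzero elements.\<close>

definition discrete_valuation :: "('k::field \<Rightarrow> int) \<Rightarrow> bool" where
  "discrete_valuation v \<longleftrightarrow> v 0 = 0 \<and> (\<exists>t. t \<noteq> 0 \<and> v t = 1) \<and>
     (\<forall>x y. x \<noteq> 0 \<longrightarrow> y \<noteq> 0 \<longrightarrow> v (x * y) = v x + v y) \<and>
     (\<forall>x y. x \<noteq> 0 \<longrightarrow> y \<noteq> 0 \<longrightarrow> x + y \<noteq> 0 \<longrightarrow> min (v x) (v y) \<le> v (x + y))"

definition closed_points :: "('f::field \<Rightarrow> 'k::field) \<Rightarrow> ('k \<Rightarrow> int) set" where
  "closed_points \<iota> = {v. discrete_valuation v \<and> (\<forall>a. a \<noteq> 0 \<longrightarrow> v (\<iota> a) = 0)}"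

text \<open>The elements of order at least \<open>n\<close>: the local ring for \<open>n = 0\<close>, its maximal ideal for
  \<open>n = 1\<close>, and the stalk of \<open>\<O>(k v)\<close> at \<open>v\<close> for \<open>n = -k\<close>.\<close>

definition order_ge :: "('k::field \<Rightarrow> int) \<Rightarrow> int \<Rightarrow> 'k set" where
  "order_ge v n = {x. x = 0 \<or> n \<le> v x}"

abbreviation local_ring :: "('k::field \<Rightarrow> int) \<Rightarrow> 'k set" where
  "local_ring v \<equiv> order_ge v 0"

definition rational_point :: "('f::field \<Rightarrow> 'k::field) \<Rightarrow> ('k \<Rightarrow> int) \<Rightarrow> bool" where
  "rational_point \<iota> v \<longleftrightarrow> v \<in> closed_points \<iota> \<and>
     (\<forall>x\<in>local_ring v. \<exists>a. x - \<iota> a \<in> order_ge v 1)"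

definition opens :: "('f::field \<Rightarrow> 'k::field) \<Rightarrow> ('k \<Rightarrow> int) set set" where
  "opens \<iota> = {U. U \<subseteq> closed_points \<iota> \<and> finite (closed_points \<iota> - U)}"

definition regular_functions :: "('k::field \<Rightarrow> int) set \<Rightarrow> 'k set" where
  "regular_functions U = {x. \<forall>v\<in>U. x \<in> local_ring v}"


subsection \<open>Locally free sheaves\<close>

text \<open>A torsion-free sheaf of \<open>\<O>\<close>-modules on an integral curve is a subsheaf of the constant sheaf
  given by its generic stalk \<open>V\<close>, a vector space over the function field.\<close>

definition subsheaf ::
    "('f::field \<Rightarrow> 'k::field) \<Rightarrow> ('k, 'v) module \<Rightarrow> (('k \<Rightarrow> int) set \<Rightarrow> 'v set) \<Rightarrow> bool" where
  "subsheaf \<iota> V \<M> \<longleftrightarrow>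
     (\<forall>U\<in>opens \<iota>. \<M> U \<subseteq> carrier V \<and>
        module (ring_on (regular_functions U)) (V \<lparr>carrier := \<M> U\<rparr>)) \<and>
     (\<forall>\<U>. \<U> \<noteq> {} \<longrightarrow> \<U> \<subseteq> opens \<iota> \<longrightarrow> \<M> (\<Union>\<U>) = (\<Inter>U\<in>\<U>. \<M> U))"

definition locally_free_sheaf ::
    "('f::field \<Rightarrow> 'k::field) \<Rightarrow> ('k, 'v) module \<Rightarrow> nat \<Rightarrow> (('k \<Rightarrow> int) set \<Rightarrow> 'v set) \<Rightarrow> bool" where
  "locally_free_sheaf \<iota> V r \<M> \<longleftrightarrow> subsheaf \<iota> V \<M> \<and>
     (\<forall>v\<in>closed_points \<iota>. \<exists>U\<in>opens \<iota>. v \<in> U \<and>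
        (\<exists>es. length es = r \<and>
           (\<forall>W\<in>opens \<iota>. W \<subseteq> U \<longrightarrow>
              is_basis (ring_on (regular_functions W)) (V \<lparr>carrier := \<M> W\<rparr>) es)))"

definition stalk ::
    "('f::field \<Rightarrow> 'k::field) \<Rightarrow> (('k \<Rightarrow> int) set \<Rightarrow> 'v set) \<Rightarrow> ('k \<Rightarrow> int) \<Rightarrow> 'v set" where
  "stalk \<iota> \<M> v = \<Union>{\<M> U | U. U \<in> opens \<iota> \<and> v \<in> U}"

text \<open>The stalk at \<open>v\<close> of \<open>\<M>(k v) = \<M> \<otimes> \<O>(k v)\<close> inside \<open>V\<close>. As the stalk of \<open>\<O>(k v)\<close> at \<open>v\<close>
  is generated by one element, products suffice and no sums are needed.\<close>

definition twisted_stalk ::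
    "('f::field \<Rightarrow> 'k::field) \<Rightarrow> ('k, 'v) module \<Rightarrow> (('k \<Rightarrow> int) set \<Rightarrow> 'v set) \<Rightarrow> ('k \<Rightarrow> int)
      \<Rightarrow> nat \<Rightarrow> 'v set" where
  "twisted_stalk \<iota> V \<M> v k =
     {f \<odot>\<^bsub>V\<^esub> y | f y. f \<in> order_ge v (- int k) \<and> y \<in> stalk \<iota> \<M> v}"


section \<open>The base ring\<close>

text \<open>
  \<open>'f\<close> is \<open>\<F>\<^sub>q\<close>, \<open>'k\<close> the function field \<open>K\<close> of \<open>C\<close>, \<open>'l\<close> is \<open>L\<close>, and \<open>'e\<close> is the function
  field \<open>K \<otimes> L\<close> of \<open>C\<^sub>L\<close> (a field since \<open>C\<close> is geometrically irreducible and \<open>L/\<F>\<^sub>q\<close> finite), with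
  its two embeddings. Only the restriction of \<open>chr\<close> to \<open>A\<close> is relevant.
\<close>

record ('f, 'k, 'l, 'e) base_data =
  constK :: "'f \<Rightarrow> 'k"
  constL :: "'f \<Rightarrow> 'l"
  fromK :: "'k \<Rightarrow> 'e"
  fromL :: "'l \<Rightarrow> 'e"
  infty :: "'k \<Rightarrow> int"
  chr :: "'k \<Rightarrow> 'l"

definition coord_ring :: "('f::field, 'k::field, 'l::field, 'e::field) base_data \<Rightarrow> 'k set" where
  "coord_ring B = regular_functions (closed_points (constK B) - {infty B})"

text \<open>An \<open>\<F>\<^sub>q\<close>-subspace \<open>S\<close> of \<open>K\<close> as a module, \<open>S \<otimes> L\<close>, and the canonical map to \<open>'e\<close>.\<close>

definition const_module ::
    "('f::field, 'k::field, 'l::field, 'e::field) base_data \<Rightarrow> 'k set \<Rightarrow> ('f, 'k) module" where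
  "const_module B S =
     \<lparr>carrier = S, monoid.mult = (*), one = 1, ring.zero = 0, add = (+), module.smult = (\<lambda>a x. constK B a * x)\<rparr>"

definition tensor_L ::
    "('f::field, 'k::field, 'l::field, 'e::field) base_data \<Rightarrow> 'k set
      \<Rightarrow> ('l, ('k \<times> 'l \<Rightarrow>\<^sub>0 int) set) module" where
  "tensor_L B S = base_change full_ring full_ring (constL B) (const_module B S)"

definition canonical_map ::
    "('f::field, 'k::field, 'l::field, 'e::field) base_data \<Rightarrow> ('k \<times> 'l \<Rightarrow>\<^sub>0 int) set \<Rightarrow> 'e" where
  "canonical_map B = tensor_lift full_ring (\<lambda>(x, b). fromK B x * fromL B b)"

definition base_setting :: "('f::field, 'k::field, 'l::field, 'e::field) base_data \<Rightarrow> bool" where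
  "base_setting B \<longleftrightarrow>
     function_field (constK B) \<and> rational_point (constK B) (infty B) \<and>
     constL B \<in> ring_hom full_ring full_ring \<and>
     fromK B \<in> ring_hom full_ring full_ring \<and> fromL B \<in> ring_hom full_ring full_ring \<and>
     (\<forall>a. fromK B (constK B a) = fromL B (constL B a)) \<and>
     bij_betw (canonical_map B) (carrier (tensor_L B UNIV)) UNIV \<and>
     chr B \<in> ring_hom (ring_on (coord_ring B)) full_ring \<and>
     (\<forall>a. chr B (constK B a) = constL B a)"

text \<open>\<open>A\<^sub>L = A \<otimes> L\<close> as a subring of \<open>K \<otimes> L\<close>.\<close>

definition AL :: "('f::field, 'k::field, 'l::field, 'e::field) base_data \<Rightarrow> 'e set" where
  "AL B = canonical_map B ` carrier (tensor_L B (coord_ring B))"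

abbreviation AL_ring :: "('f::field, 'k::field, 'l::field, 'e::field) base_data \<Rightarrow> 'e ring" where
  "AL_ring B \<equiv> ring_on (AL B)"

definition char_ideal :: "('f::field, 'k::field, 'l::field, 'e::field) base_data \<Rightarrow> 'e set" where
  "char_ideal B =
     genideal (AL_ring B) {fromK B a - fromL B (chr B a) | a. a \<in> coord_ring B}"

text \<open>\<open>\<sigma>\<^sup>*\<close> on the function field of \<open>C\<^sub>L\<close>: the identity on \<open>K\<close> and the \<open>q\<close>-Frobenius on \<open>L\<close>.\<close>

definition sigma :: "('f::field, 'k::field, 'l::field, 'e::field) base_data \<Rightarrow> 'e \<Rightarrow> 'e" where
  "sigma B = (THE s. s \<in> ring_hom full_ring full_ring \<and>
     (\<forall>x. s (fromK B x) = fromK B x) \<and>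
     (\<forall>b. s (fromL B b) = fromL B (b ^ card (UNIV :: 'f set))))"

text \<open>The point of \<open>C\<^sub>L\<close> over \<open>\<infinity>\<close>, unique because \<open>\<infinity>\<close> is rational.\<close>

definition inftyL :: "('f::field, 'k::field, 'l::field, 'e::field) base_data \<Rightarrow> 'e \<Rightarrow> int" where
  "inftyL B = (THE w. w \<in> closed_points (fromL B) \<and>
     (\<forall>x. fromK B x \<in> local_ring w \<longleftrightarrow> x \<in> local_ring (infty B)))"


section \<open>Pure Anderson motives\<close>

definition sigma_pullback ::
    "('f::field, 'k::field, 'l::field, 'e::field) base_data \<Rightarrow> ('e, 'm) module
      \<Rightarrow> ('e, ('m \<times> 'e \<Rightarrow>\<^sub>0 int) set) module" where
  "sigma_pullback B M = base_change (AL_ring B) (AL_ring B) (sigma B) M"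

definition sigma_tensor ::
    "('f::field, 'k::field, 'l::field, 'e::field) base_data \<Rightarrow> ('e, 'm) module
      \<Rightarrow> 'm \<Rightarrow> 'e \<Rightarrow> ('m \<times> 'e \<Rightarrow>\<^sub>0 int) set" where
  "sigma_tensor B M = pure_tensor (AL_ring B) (AL_ring B) (sigma B) M"

definition sigma_pullback_map ::
    "('f::field, 'k::field, 'l::field, 'e::field) base_data \<Rightarrow> ('e, 'n) module
      \<Rightarrow> ('m \<Rightarrow> 'n) \<Rightarrow> ('m \<times> 'e \<Rightarrow>\<^sub>0 int) set \<Rightarrow> ('n \<times> 'e \<Rightarrow>\<^sub>0 int) set" where
  "sigma_pullback_map B N f =
     tensor_lift (sigma_pullback B N) (\<lambda>(x, a). sigma_tensor B N (f x) a)"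

text \<open>The \<open>\<sigma>\<^sup>*\<close>-semilinear map \<open>m \<mapsto> \<tau>(m \<otimes> 1)\<close>. Identifying \<open>(\<sigma>\<^sup>*)\<^sup>l M\<close> with
  \<open>M \<otimes> A\<^sub>L\<close> along \<open>(\<sigma>\<^sup>*)\<^sup>l\<close>, the map \<open>\<tau>\<^sup>l\<close> sends \<open>m \<otimes> 1\<close> to the \<open>l\<close>-th iterate of this map
  at \<open>m\<close>.\<close>

definition semilinear_part ::
    "('f::field, 'k::field, 'l::field, 'e::field) base_data \<Rightarrow> ('e, 'm) module
      \<Rightarrow> (('m \<times> 'e \<Rightarrow>\<^sub>0 int) set \<Rightarrow> 'm) \<Rightarrow> 'm \<Rightarrow> 'm" where
  "semilinear_part B M \<tau> x = \<tau> (sigma_tensor B M x 1)"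

definition generic_fibre ::
    "('f::field, 'k::field, 'l::field, 'e::field) base_data \<Rightarrow> ('e, 'm) module
      \<Rightarrow> ('e, ('m \<times> 'e \<Rightarrow>\<^sub>0 int) set) module" where
  "generic_fibre B M = base_change (AL_ring B) full_ring id M"

definition generic_tensor ::
    "('f::field, 'k::field, 'l::field, 'e::field) base_data \<Rightarrow> ('e, 'm) module
      \<Rightarrow> 'm \<Rightarrow> 'e \<Rightarrow> ('m \<times> 'e \<Rightarrow>\<^sub>0 int) set" where
  "generic_tensor B M = pure_tensor (AL_ring B) full_ring id M"

text \<open>The semilinear map underlying \<open>\<tau>\<^sup>l\<close> on the generic fibre,
  \<open>m \<otimes> f \<mapsto> \<tau>\<^sup>l(m \<otimes> 1) \<otimes> (\<sigma>\<^sup>*)\<^sup>l f\<close>.\<close>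

definition generic_power ::
    "('f::field, 'k::field, 'l::field, 'e::field) base_data \<Rightarrow> ('e, 'm) module
      \<Rightarrow> (('m \<times> 'e \<Rightarrow>\<^sub>0 int) set \<Rightarrow> 'm) \<Rightarrow> nat
      \<Rightarrow> ('m \<times> 'e \<Rightarrow>\<^sub>0 int) set \<Rightarrow> ('m \<times> 'e \<Rightarrow>\<^sub>0 int) set" where
  "generic_power B M \<tau> l =
     tensor_lift (generic_fibre B M)
       (\<lambda>(x, f). generic_tensor B M ((semilinear_part B M \<tau> ^^ l) x) ((sigma B ^^ l) f))"

text \<open>As \<open>\<sigma>\<close> fixes \<open>\<infinity>\<close>, the stalk of \<open>(\<sigma>\<^sup>*)\<^sup>l \<M>\<close> at \<open>\<infinity>\<close> is the base change of \<open>\<M>\<^sub>\<infinity>\<close> along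
  \<open>(\<sigma>\<^sup>*)\<^sup>l\<close> on the local ring; \<open>\<tau>\<^sup>l\<close> maps it to the generic fibre of \<open>M\<close> by
  \<open>y \<otimes> g \<mapsto> g \<tau>\<^sup>l(y \<otimes> 1)\<close>. The sheaf \<open>\<M>\<close> extends \<open>M\<close> if its sections on \<open>C\<^sub>L - \<infinity>\<close> are \<open>M\<close>.\<close>

definition purity ::
    "('f::field, 'k::field, 'l::field, 'e::field) base_data \<Rightarrow> nat \<Rightarrow> ('e, 'm) module
      \<Rightarrow> (('m \<times> 'e \<Rightarrow>\<^sub>0 int) set \<Rightarrow> 'm) \<Rightarrow> bool" where
  "purity B r M \<tau> \<longleftrightarrow>
     (let V = generic_fibre B M; w = inftyL B; Oinf = ring_on (local_ring w) in
      \<exists>\<M>. locally_free_sheaf (fromL B) V r \<M> \<and>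
        \<M> (closed_points (fromL B) - {w}) = (\<lambda>x. generic_tensor B M x 1) ` carrier M \<and>
        (\<exists>k l. 0 < k \<and> 0 < l \<and>
           bij_betw (tensor_lift V (\<lambda>(y, g). g \<odot>\<^bsub>V\<^esub> generic_power B M \<tau> l y))
             (carrier (base_change Oinf Oinf (sigma B ^^ l) (V \<lparr>carrier := stalk (fromL B) \<M> w\<rparr>)))
             (twisted_stalk (fromL B) V \<M> w k)))"

definition coker ::
    "('e, 'm) module \<Rightarrow> ('e, 'n) module \<Rightarrow> ('m \<Rightarrow> 'n) \<Rightarrow> ('e, 'n set) module" where
  "coker M N f = quotient_module N (f ` carrier M)"

text \<open>The dimension over \<open>L\<close> is the rank over its image in \<open>A\<^sub>L\<close>.\<close>

definition anderson_motive ::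
    "('f::field, 'k::field, 'l::field, 'e::field) base_data \<Rightarrow> nat \<Rightarrow> nat
      \<Rightarrow> ('e, 'm) module \<Rightarrow> (('m \<times> 'e \<Rightarrow>\<^sub>0 int) set \<Rightarrow> 'm) \<Rightarrow> bool" where
  "anderson_motive B r d M \<tau> \<longleftrightarrow>
     locally_free (AL B) M r \<and>
     \<tau> \<in> mod_homs (AL_ring B) (sigma_pullback B M) M \<and>
     inj_on \<tau> (carrier (sigma_pullback B M)) \<and>
     (let Q = coker (sigma_pullback B M) M \<tau> in
        free_of_rank (ring_on (range (fromL B))) Q d \<and>
        (\<forall>a \<in> char_ideal B [^]\<^bsub>ideals_set (AL_ring B)\<^esub> d. \<forall>Z\<in>carrier Q. a \<odot>\<^bsub>Q\<^esub> Z = \<zero>\<^bsub>Q\<^esub>)) \<and>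
     purity B r M \<tau>"

type_synonym ('e, 'm) motive_data = "('e, 'm) module \<times> (('m \<times> 'e \<Rightarrow>\<^sub>0 int) set \<Rightarrow> 'm)"

definition pure_anderson_motives ::
    "('f::field, 'k::field, 'l::field, 'e::field) base_data \<Rightarrow> ('e, 'm) motive_data set" where
  "pure_anderson_motives B = {(M, \<tau>). \<exists>r d. anderson_motive B r d M \<tau>}"

definition motive_morphism ::
    "('f::field, 'k::field, 'l::field, 'e::field) base_data \<Rightarrow> ('e, 'm) motive_data
      \<Rightarrow> ('e, 'n) motive_data \<Rightarrow> ('m \<Rightarrow> 'n) \<Rightarrow> bool" where
  "motive_morphism B = (\<lambda>(M, \<tau>) (M', \<tau>') f.
     f \<in> mod_homs (AL_ring B) M M' \<and>
     (\<forall>Z\<in>carrier (sigma_pullback B M). f (\<tau> Z) = \<tau>' (sigma_pullback_map B M' f Z)))"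

definition isogeny ::
    "('f::field, 'k::field, 'l::field, 'e::field) base_data \<Rightarrow> ('e, 'm) motive_data
      \<Rightarrow> ('e, 'n) motive_data \<Rightarrow> ('m \<Rightarrow> 'n) \<Rightarrow> bool" where
  "isogeny B = (\<lambda>(M, \<tau>) (M', \<tau>') f.
     motive_morphism B (M, \<tau>) (M', \<tau>') f \<and> inj_on f (carrier M) \<and>
     (let Q = coker M M' f in
        \<forall>Z\<in>carrier Q. \<exists>a\<in>AL B - {0}. a \<odot>\<^bsub>Q\<^esub> Z = \<zero>\<^bsub>Q\<^esub>))"

text \<open>The map \<open>\<sigma>\<^sup>* coker f \<rightarrow> coker f\<close> induced by \<open>\<tau>'\<close>: \<open>[x] \<otimes> a \<mapsto> [\<tau>'(x \<otimes> a)]\<close>.\<close>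

definition induced_on_coker ::
    "('f::field, 'k::field, 'l::field, 'e::field) base_data \<Rightarrow> ('e, 'm) motive_data
      \<Rightarrow> ('e, 'n) motive_data \<Rightarrow> ('m \<Rightarrow> 'n) \<Rightarrow> ('n set \<times> 'e \<Rightarrow>\<^sub>0 int) set \<Rightarrow> 'n set" where
  "induced_on_coker B = (\<lambda>(M, \<tau>) (M', \<tau>') f.
     tensor_lift (coker M M' f)
       (\<lambda>(Z, a). \<Union>x\<in>Z. (f ` carrier M) +>\<^bsub>M'\<^esub> \<tau>' (sigma_tensor B M' x a)))"

definition separable_isogeny ::
    "('f::field, 'k::field, 'l::field, 'e::field) base_data \<Rightarrow> ('e, 'm) motive_data
      \<Rightarrow> ('e, 'n) motive_data \<Rightarrow> ('m \<Rightarrow> 'n) \<Rightarrow> bool" where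
  "separable_isogeny B = (\<lambda>(M, \<tau>) (M', \<tau>') f.
     isogeny B (M, \<tau>) (M', \<tau>') f \<and>
     bij_betw (induced_on_coker B (M, \<tau>) (M', \<tau>') f)
       (carrier (sigma_pullback B (coker M M' f))) (carrier (coker M M' f)))"

end

theory Submission
  imports Defs
begin

text \<open>
  Some power of \<open>\<sigma>\<close> is the identity because \<open>L\<close> is finite. Hence \<open>x \<mapsto> x \<otimes> 1\<close> identifies \<open>M\<close> with
  \<open>\<sigma>\<^sup>*M\<close>, and a motive becomes a module with a semilinear map \<open>t\<close>. An isogeny \<open>f : M \<rightarrow> M'\<close> is
  separable iff \<open>t'\<close> is bijective on the cokernel \<open>M' / f M\<close>, from which reflexivity and
  transitivity follow.

  For symmetry, \<open>M' / f M\<close> is a finite set, as it is finitely generated and torsion and the residue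
  rings of \<open>A\<^sub>L\<close> are finite. Therefore a power \<open>P\<close> of \<open>t'\<close>, which can be taken linear, is the
  identity on \<open>M' / f M\<close>. Choose \<open>c \<in> A\<^sub>L\<close> fixed by \<open>\<sigma>\<close> and congruent to \<open>1\<close> modulo the
  annihilator of \<open>M' / f M\<close>. Then \<open>1 - c P\<close> maps \<open>M'\<close> to \<open>f M\<close>, and \<open>h = f\<^sup>-\<^sup>1 (1 - c P)\<close> is a
  morphism \<open>M' \<rightarrow> M\<close>. Since \<open>c P\<close> is the identity on its cokernel, \<open>t\<close> is bijective there. Finally,
  \<open>h\<close> is an isogeny for a suitable \<open>c\<close>, because \<open>P\<close> has only finitely many eigenvalues.
\<close>


section \<open>Rings of field elements\<close>

text \<open>The obvious reverse map \<open>a f^-1\<close>, with a \<sigma>-invariant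
  \<open>a\<close> annihilating the cokernel, is an isogeny but need not be separable: already for
  \<open>f\<close> the identity, \<open>t\<close> is not surjective on \<open>M / a M\<close> when
  \<open>a\<close> kills a nonzero cokernel of \<tau>. Replacing \<open>a\<close> by
  \<open>1 - c P\<close> removes this obstacle: \<open>h f\<close> is \<open>1 - c t^k\<close> on
  \<open>M\<close>, so modulo the image of \<open>h\<close> the operator \<open>c t^k\<close> is the
  identity, and \<open>t\<close> is invertible there because \<open>k > 0\<close>.

  The parameters are dictated by making \<open>h\<close> a morphism. The exponent \<open>k\<close>
  is a multiple of the order of \<sigma>, so that \<open>P = t'^k\<close> is linear;
  \<open>c\<close> is \<sigma>-invariant, so that \<open>c P\<close> commutes with
  \<open>t'\<close>. Candidates are \<open>c = 1 + b^(j+1)\<close>, where \<open>b\<close> is the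
  norm under \<sigma> of an annihilator of \<open>M' / f M\<close>.

  If \<open>1 - c P\<close> kills some nonzero \<open>x\<close>, then \<open>x\<close> is an
  eigenvector of \<open>P\<close> for \<open>1/c\<close>, and more such \<open>c\<close> than the
  rank would give too many independent vectors. Once \<open>u = 1 - c P\<close> is injective, a
  linear relation among \<open>z, u z, ..., u^r z\<close> shows that its cokernel is torsion, and
  this passes to \<open>h\<close>.\<close>

lemma ring_on_simps [simp]:
  "carrier (ring_on S) = S"
  "monoid.mult (ring_on S) = (*)" "one (ring_on S) = 1"
  "ring.zero (ring_on S) = 0" "add (ring_on S) = (+)"
  by (simp_all add: ring_of_type_algebra_def)

lemma full_ring_simps [simp]:
  "carrier full_ring = UNIV"
  "monoid.mult full_ring = (*)" "one full_ring = 1"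
  "ring.zero full_ring = 0" "add full_ring = (+)"
  by (simp_all add: ring_of_type_algebra_def)

lemma ring_on_closed:
  assumes "cring (ring_on S)"
  shows "0 \<in> S" "1 \<in> S" "\<And>x y. x \<in> S \<Longrightarrow> y \<in> S \<Longrightarrow> x + y \<in> S"
    "\<And>x y. x \<in> S \<Longrightarrow> y \<in> S \<Longrightarrow> x * y \<in> S" "\<And>x. x \<in> S \<Longrightarrow> - x \<in> S"
    "\<And>x y. x \<in> S \<Longrightarrow> y \<in> S \<Longrightarrow> x - y \<in> S" "\<And>x n. x \<in> S \<Longrightarrow> x ^ n \<in> S"
proof -
  interpret cring "ring_on S" by fact
  show 1: "0 \<in> S" "1 \<in> S" "\<And>x y. x \<in> S \<Longrightarrow> y \<in> S \<Longrightarrow> x + y \<in> S"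
    "\<And>x y. x \<in> S \<Longrightarrow> y \<in> S \<Longrightarrow> x * y \<in> S"
    using zero_closed one_closed a_closed m_closed by auto
  show 2: "- x \<in> S" if "x \<in> S" for x
  proof -
    have "\<ominus>\<^bsub>ring_on S\<^esub> x \<in> S" "x + \<ominus>\<^bsub>ring_on S\<^esub> x = 0"
      using that a_inv_closed[of x] r_neg[of x] by simp_all
    then show ?thesis by (metis neg_eq_iff_add_eq_0)
  qed
  show "x - y \<in> S" if "x \<in> S" "y \<in> S" for x y
    using 1(3)[OF that(1) 2[OF that(2)]] by simp
  show "x ^ n \<in> S" if "x \<in> S" for x n
    using that by (induction n) (auto simp: 1)
qed

lemma ring_on_a_inv [simp]:
  assumes "cring (ring_on S)" "x \<in> S"
  shows "\<ominus>\<^bsub>ring_on S\<^esub> x = - x"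
proof -
  interpret cring "ring_on S" by fact
  have "x + \<ominus>\<^bsub>ring_on S\<^esub> x = 0" using assms r_neg[of x] by simp
  then show ?thesis by (metis neg_eq_iff_add_eq_0)
qed

lemma cring_ring_onI:
  assumes "1 \<in> S" "\<And>x y. x \<in> S \<Longrightarrow> y \<in> S \<Longrightarrow> x - y \<in> S"
    "\<And>x y. x \<in> S \<Longrightarrow> y \<in> S \<Longrightarrow> x * y \<in> S"
  shows "cring (ring_on S)"
proof -
  have 0: "0 \<in> S" using assms(2)[OF assms(1) assms(1)] by simp
  have n: "- x \<in> S" if "x \<in> S" for x using assms(2)[OF 0 that] by simp
  have a: "x + y \<in> S" if "x \<in> S" "y \<in> S" for x y using assms(2)[OF that(1) n[OF that(2)]] by simp
  show ?thesis
  proof (rule cringI)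
    show "abelian_group (ring_on S)"
      by (rule abelian_groupI) (auto simp: a 0 algebra_simps intro: n bexI[of _ "- x" for x])
    show "comm_monoid (ring_on S)"
      by (rule comm_monoidI) (auto simp: assms algebra_simps)
  qed (simp add: algebra_simps)
qed

lemma cring_full_ring: "cring (full_ring :: 'a::field ring)"
  by (rule cring_from_type_algebra)


section \<open>Extension of scalars\<close>

lemma r_coset_eq_iff:
  assumes "comm_group G" "subgroup N G" "x \<in> carrier G" "y \<in> carrier G"
  shows "N #>\<^bsub>G\<^esub> x = N #>\<^bsub>G\<^esub> y \<longleftrightarrow> x \<otimes>\<^bsub>G\<^esub> inv\<^bsub>G\<^esub> y \<in> N"
proof -
  interpret comm_group G by fact
  show ?thesis
    using assms subgroup.rcos_module[OF assms(2) is_group assms(4,3)]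
      rcos_self[OF assms(3,2)] repr_independence[OF _ assms(4,2), of x] by auto
qed

text \<open>The sum inside \<open>tensor_lift\<close> at an explicit representative: additivity can
  be proved here before the choice made by \<open>SOME\<close> is shown not to matter.\<close>

definition tensor_ext :: "('p, 'z) ring_scheme \<Rightarrow> ('a \<Rightarrow> 'p) \<Rightarrow> ('a \<Rightarrow>\<^sub>0 int) \<Rightarrow> 'p" where
  "tensor_ext P h u =
    (\<Oplus>\<^bsub>P\<^esub> p\<in>Poly_Mapping.keys u. add_pow P (Poly_Mapping.lookup u p) (h p))"

context abelian_group
begin

lemma minus_eq_zero_iff:
  assumes "x \<in> carrier G" "y \<in> carrier G"
  shows "x \<ominus> y = \<zero> \<longleftrightarrow> x = y"
  using assms minus_equality[of x "\<ominus> y"] by (auto simp: minus_eq r_neg)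

lemma add_pow_zero: "add_pow G (0 :: int) x = \<zero>"
  by (simp add: add_pow_def int_pow_def nat_pow_def)

lemma add_minus_minus_cancel:
  assumes "x \<in> carrier G" "y \<in> carrier G"
  shows "x \<oplus> y \<ominus> x \<ominus> y = \<zero>"
  using assms by (simp add: minus_eq a_assoc flip: minus_add) (simp add: r_neg flip: a_assoc)

text \<open>Keys outside \<open>u\<close> carry coefficient 0. A common index set makes the sums for
  different \<open>u\<close> comparable.\<close>

lemma tensor_ext_superset:
  assumes "finite A" "Poly_Mapping.keys u \<subseteq> A" "h \<in> A \<rightarrow> carrier G"
  shows "tensor_ext G h u = (\<Oplus>p\<in>A. add_pow G (Poly_Mapping.lookup u p) (h p))"
  unfolding tensor_ext_def
  using assms by (intro add.finprod_mono_neutral_cong_left) (auto simp: in_keys_iff add_pow_zero)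

lemma tensor_ext_closed:
  assumes "Poly_Mapping.keys u \<subseteq> A" "h \<in> A \<rightarrow> carrier G"
  shows "tensor_ext G h u \<in> carrier G"
  unfolding tensor_ext_def using assms by (intro finsum_closed) auto

lemma tensor_ext_add:
  assumes "Poly_Mapping.keys u \<subseteq> A" "Poly_Mapping.keys v \<subseteq> A" "h \<in> A \<rightarrow> carrier G"
  shows "tensor_ext G h (u + v) = tensor_ext G h u \<oplus> tensor_ext G h v"
proof -
  let ?B = "Poly_Mapping.keys u \<union> Poly_Mapping.keys v"
  have h: "h \<in> ?B \<rightarrow> carrier G" using assms by auto
  have "tensor_ext G h (u + v)
      = (\<Oplus>p\<in>?B. add_pow G (Poly_Mapping.lookup (u + v) p) (h p))"
    using h keys_add[of u v] by (intro tensor_ext_superset) auto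
  also have "\<dots> = (\<Oplus>p\<in>?B. add_pow G (Poly_Mapping.lookup u p) (h p)
                     \<oplus> add_pow G (Poly_Mapping.lookup v p) (h p))"
    using h by (intro finsum_cong') (auto simp: lookup_add intro!: add.int_pow_mult)
  also have "\<dots> = tensor_ext G h u \<oplus> tensor_ext G h v"
    using h by (subst finsum_addf) (auto simp: tensor_ext_superset[of ?B])
  finally show ?thesis .
qed

lemma tensor_ext_frag_of:
  assumes "h p \<in> carrier G"
  shows "tensor_ext G h (frag_of p) = h p"
  using assms by (simp add: tensor_ext_def)

lemma tensor_ext_zero: "tensor_ext G h 0 = \<zero>"
  by (simp add: tensor_ext_def)

lemma tensor_ext_uminus:
  assumes "Poly_Mapping.keys u \<subseteq> A" "h \<in> A \<rightarrow> carrier G"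
  shows "tensor_ext G h (- u) = \<ominus> tensor_ext G h u"
proof -
  have "tensor_ext G h (- u) \<oplus> tensor_ext G h u = \<zero>"
    using tensor_ext_add[of "- u" A u h] assms by (simp add: tensor_ext_zero keys_minus)
  then show ?thesis
    using assms tensor_ext_closed[of u A h] tensor_ext_closed[of "- u" A h]
    by (simp add: minus_equality keys_minus)
qed

lemma tensor_ext_diff:
  assumes "Poly_Mapping.keys u \<subseteq> A" "Poly_Mapping.keys v \<subseteq> A" "h \<in> A \<rightarrow> carrier G"
  shows "tensor_ext G h (u - v) = tensor_ext G h u \<ominus> tensor_ext G h v"
  using tensor_ext_add[of u A "- v" h] tensor_ext_uminus[of v A h] assms
  by (simp add: minus_eq keys_minus)

end

locale scalar_extension = M: module R M + S: cring S
  for R :: "('r, 'y) ring_scheme" and S :: "('s, 'z) ring_scheme" and M :: "('r, 'm) module" +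
  fixes \<phi> :: "'r \<Rightarrow> 's"
  assumes \<phi>_closed: "a \<in> carrier R \<Longrightarrow> \<phi> a \<in> carrier S"
begin

abbreviation "gens \<equiv> carrier M \<times> carrier S"
abbreviation "G \<equiv> free_Abelian_group gens"
abbreviation "N \<equiv> tensor_null R S \<phi> M"
abbreviation "T \<equiv> base_change R S \<phi> M"
abbreviation "pure \<equiv> pure_tensor R S \<phi> M"
abbreviation "cl u \<equiv> N #>\<^bsub>G\<^esub> u"

lemma keys_diff_subset: "Poly_Mapping.keys u \<subseteq> A \<Longrightarrow> Poly_Mapping.keys v \<subseteq> A \<Longrightarrow>
    Poly_Mapping.keys (u - v) \<subseteq> A" for u v :: "'q \<Rightarrow>\<^sub>0 int"
  by (meson keys_diff le_supI order_trans)

lemma keys_add_subset: "Poly_Mapping.keys u \<subseteq> A \<Longrightarrow> Poly_Mapping.keys v \<subseteq> A \<Longrightarrow>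
    Poly_Mapping.keys (u + v) \<subseteq> A" for u v :: "'q \<Rightarrow>\<^sub>0 int"
  by (meson keys_add le_supI order_trans)

lemma relations_closed: "tensor_relations R S \<phi> M \<subseteq> carrier G"
  unfolding tensor_relations_def
  by (intro subsetI, elim UnE CollectE exE conjE) (simp_all add: keys_diff_subset \<phi>_closed)

lemma relation_keys: "u \<in> tensor_relations R S \<phi> M \<Longrightarrow> Poly_Mapping.keys u \<subseteq> gens"
  using subsetD[OF relations_closed] by simp

sublocale G: comm_group G by (rule abelian_free_Abelian_group)

lemma null_subgroup: "subgroup N G"
  unfolding tensor_null_def by (rule G.generate_is_subgroup[OF relations_closed])

sublocale Q: comm_group "G Mod N"
  by (rule G.abelian_FactGroup[OF null_subgroup])

lemma carrier_T: "carrier T = cl ` {u. Poly_Mapping.keys u \<subseteq> gens}"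
  by (auto simp: base_change_def Let_def RCOSETS_def free_Abelian_group_def)

lemma cl_closed: "Poly_Mapping.keys u \<subseteq> gens \<Longrightarrow> cl u \<in> carrier T"
  by (auto simp: carrier_T)

lemma null_closed: "u \<in> N \<Longrightarrow> Poly_Mapping.keys u \<subseteq> gens"
  using subgroup.subset[OF null_subgroup] by (auto simp: free_Abelian_group_def)

lemma cl_eq:
  assumes "Poly_Mapping.keys u \<subseteq> gens" "Poly_Mapping.keys v \<subseteq> gens"
  shows "cl u = cl v \<longleftrightarrow> u - v \<in> N"
  using r_coset_eq_iff[OF G.comm_group_axioms null_subgroup, of u v] assms by simp

lemma cl_add:
  assumes "Poly_Mapping.keys u \<subseteq> gens" "Poly_Mapping.keys v \<subseteq> gens"
  shows "cl u \<oplus>\<^bsub>T\<^esub> cl v = cl (u + v)"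
  using normal.rcos_sum[OF G.subgroup_imp_normal[OF null_subgroup], of u v] assms
  by (simp add: base_change_def Let_def)

lemma cl_zero: "\<zero>\<^bsub>T\<^esub> = cl 0"
  using G.coset_mult_one[OF subgroup.subset[OF null_subgroup]] by (simp add: base_change_def Let_def)

lemma abelian_group_T: "abelian_group T"
proof (rule abelian_groupI)
  show "\<exists>y\<in>carrier T. y \<oplus>\<^bsub>T\<^esub> x = \<zero>\<^bsub>T\<^esub>" if x: "x \<in> carrier T" for x
  proof -
    obtain u where "x = cl u" "Poly_Mapping.keys u \<subseteq> gens" using x by (auto simp: carrier_T)
    then show ?thesis
      by (intro bexI[of _ "cl (- u)"]) (simp_all add: cl_add cl_zero cl_closed keys_minus)
  qed
  have k: "Poly_Mapping.keys (u + v) \<subseteq> gens"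
    if "Poly_Mapping.keys u \<subseteq> gens" "Poly_Mapping.keys v \<subseteq> gens" for u v :: "'m \<times> 's \<Rightarrow>\<^sub>0 int"
    using that keys_add[of u v] by auto
  show "x \<oplus>\<^bsub>T\<^esub> y \<in> carrier T" if "x \<in> carrier T" "y \<in> carrier T" for x y
    using that unfolding carrier_T by (elim imageE) (simp add: cl_add keys_add_subset imageI)
  show "\<zero>\<^bsub>T\<^esub> \<in> carrier T" by (simp add: cl_zero cl_closed)
  show "x \<oplus>\<^bsub>T\<^esub> y \<oplus>\<^bsub>T\<^esub> z = x \<oplus>\<^bsub>T\<^esub> (y \<oplus>\<^bsub>T\<^esub> z)"
    if "x \<in> carrier T" "y \<in> carrier T" "z \<in> carrier T" for x y z
    using that by (auto simp: carrier_T cl_add k add.assoc)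
  show "x \<oplus>\<^bsub>T\<^esub> y = y \<oplus>\<^bsub>T\<^esub> x" if "x \<in> carrier T" "y \<in> carrier T" for x y
    using that by (auto simp: carrier_T cl_add k add.commute)
  show "\<zero>\<^bsub>T\<^esub> \<oplus>\<^bsub>T\<^esub> x = x" if "x \<in> carrier T" for x
    using that by (auto simp: carrier_T cl_zero cl_add)
qed

sublocale T: abelian_group T by (rule abelian_group_T)

lemma cl_uminus:
  assumes "Poly_Mapping.keys u \<subseteq> gens"
  shows "\<ominus>\<^bsub>T\<^esub> cl u = cl (- u)"
  using assms by (intro T.minus_equality) (simp_all add: cl_add cl_zero cl_closed keys_minus)

lemma cl_diff:
  assumes "Poly_Mapping.keys u \<subseteq> gens" "Poly_Mapping.keys v \<subseteq> gens"
  shows "cl u \<ominus>\<^bsub>T\<^esub> cl v = cl (u - v)"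
  using assms by (simp add: T.minus_eq cl_uminus cl_add keys_minus)

lemma pure_closed: "x \<in> carrier M \<Longrightarrow> s \<in> carrier S \<Longrightarrow> pure x s \<in> carrier T"
  unfolding pure_tensor_def by (rule cl_closed) simp

lemma relation_imp_null: "u \<in> tensor_relations R S \<phi> M \<Longrightarrow> u \<in> N"
  unfolding tensor_null_def by (rule generate.incl)

lemma pure_add_left:
  assumes "x \<in> carrier M" "y \<in> carrier M" "s \<in> carrier S"
  shows "pure (x \<oplus>\<^bsub>M\<^esub> y) s = pure x s \<oplus>\<^bsub>T\<^esub> pure y s"
proof -
  have "frag_of (x \<oplus>\<^bsub>M\<^esub> y, s) - (frag_of (x, s) + frag_of (y, s)) \<in> N"
    using assms by (intro relation_imp_null) (auto simp: tensor_relations_def diff_diff_eq)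
  then show ?thesis
    using assms by (simp add: pure_tensor_def cl_add cl_eq keys_add_subset)
qed

lemma pure_add_right:
  assumes "x \<in> carrier M" "s \<in> carrier S" "t \<in> carrier S"
  shows "pure x (s \<oplus>\<^bsub>S\<^esub> t) = pure x s \<oplus>\<^bsub>T\<^esub> pure x t"
proof -
  have "frag_of (x, s \<oplus>\<^bsub>S\<^esub> t) - (frag_of (x, s) + frag_of (x, t)) \<in> N"
    using assms by (intro relation_imp_null) (auto simp: tensor_relations_def diff_diff_eq)
  then show ?thesis
    using assms by (simp add: pure_tensor_def cl_add cl_eq keys_add_subset)
qed

lemma pure_balanced:
  assumes "x \<in> carrier M" "s \<in> carrier S" "a \<in> carrier R"
  shows "pure (a \<odot>\<^bsub>M\<^esub> x) s = pure x (\<phi> a \<otimes>\<^bsub>S\<^esub> s)"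
proof -
  have "frag_of (a \<odot>\<^bsub>M\<^esub> x, s) - frag_of (x, \<phi> a \<otimes>\<^bsub>S\<^esub> s) \<in> N"
    using assms by (intro relation_imp_null) (auto simp: tensor_relations_def)
  then show ?thesis
    using assms by (auto simp: pure_tensor_def cl_eq \<phi>_closed)
qed

text \<open>Pure tensors generate the tensor product as a group; closure under differences covers
  sums and negatives in a single case.\<close>

lemma T_induct [consumes 1, case_names zero pure diff]:
  assumes Z: "Z \<in> carrier T"
    and zero: "P \<zero>\<^bsub>T\<^esub>"
    and pure: "\<And>x s. x \<in> carrier M \<Longrightarrow> s \<in> carrier S \<Longrightarrow> P (pure x s)"
    and diff: "\<And>U V. U \<in> carrier T \<Longrightarrow> V \<in> carrier T \<Longrightarrow> P U \<Longrightarrow> P V \<Longrightarrow> P (U \<ominus>\<^bsub>T\<^esub> V)"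
  shows "P Z"
proof -
  obtain u where u: "Z = cl u" "Poly_Mapping.keys u \<subseteq> gens" using Z by (auto simp: carrier_T)
  have "P (cl u)"
  proof (rule free_Abelian_group_induct[OF u(2)])
    show "P (cl 0)" using zero by (simp add: cl_zero)
    show "P (cl (v - w))" if "Poly_Mapping.keys v \<subseteq> gens" "Poly_Mapping.keys w \<subseteq> gens"
      "P (cl v)" "P (cl w)" for v w
      using diff[OF cl_closed cl_closed] that by (simp add: cl_diff)
    show "P (cl (frag_of p))" if "p \<in> gens" for p
      using pure[of "fst p" "snd p"] that by (auto simp: pure_tensor_def)
  qed
  then show ?thesis by (simp add: u)
qed

lemma null_induct [consumes 1, case_names zero left right balanced uminus add]:
  assumes "u \<in> N"
    and zero: "P 0"
    and left: "\<And>x y s. x \<in> carrier M \<Longrightarrow> y \<in> carrier M \<Longrightarrow> s \<in> carrier S \<Longrightarrow>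
      P (frag_of (x \<oplus>\<^bsub>M\<^esub> y, s) - frag_of (x, s) - frag_of (y, s))"
    and right: "\<And>x s t. x \<in> carrier M \<Longrightarrow> s \<in> carrier S \<Longrightarrow> t \<in> carrier S \<Longrightarrow>
      P (frag_of (x, s \<oplus>\<^bsub>S\<^esub> t) - frag_of (x, s) - frag_of (x, t))"
    and balanced: "\<And>a x s. a \<in> carrier R \<Longrightarrow> x \<in> carrier M \<Longrightarrow> s \<in> carrier S \<Longrightarrow>
      P (frag_of (a \<odot>\<^bsub>M\<^esub> x, s) - frag_of (x, \<phi> a \<otimes>\<^bsub>S\<^esub> s))"
    and uminus: "\<And>u. Poly_Mapping.keys u \<subseteq> gens \<Longrightarrow> P u \<Longrightarrow> P (- u)"
    and add: "\<And>u v. Poly_Mapping.keys u \<subseteq> gens \<Longrightarrow> Poly_Mapping.keys v \<subseteq> gens \<Longrightarrow>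
      P u \<Longrightarrow> P v \<Longrightarrow> P (u + v)"
  shows "P u"
proof -
  have rel: "P u" if "u \<in> tensor_relations R S \<phi> M" for u
    using that unfolding tensor_relations_def
    by (elim UnE CollectE exE conjE) (simp_all only: left right balanced)
  show ?thesis
    using assms(1) unfolding tensor_null_def
  proof (induction rule: generate.induct)
    case (inv u)
    then show ?case using relation_keys[OF inv] uminus[OF relation_keys[OF inv] rel[OF inv]] by simp
  next
    case (eng u v)
    then show ?case using add[of u v] null_closed by (simp add: tensor_null_def)
  qed (use zero rel in auto)
qed

lemma null_relations:
  "x \<in> carrier M \<Longrightarrow> y \<in> carrier M \<Longrightarrow> s \<in> carrier S \<Longrightarrow>
    frag_of (x \<oplus>\<^bsub>M\<^esub> y, s) - frag_of (x, s) - frag_of (y, s) \<in> N"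
  "x \<in> carrier M \<Longrightarrow> s \<in> carrier S \<Longrightarrow> t \<in> carrier S \<Longrightarrow>
    frag_of (x, s \<oplus>\<^bsub>S\<^esub> t) - frag_of (x, s) - frag_of (x, t) \<in> N"
  "a \<in> carrier R \<Longrightarrow> x \<in> carrier M \<Longrightarrow> s \<in> carrier S \<Longrightarrow>
    frag_of (a \<odot>\<^bsub>M\<^esub> x, s) - frag_of (x, \<phi> a \<otimes>\<^bsub>S\<^esub> s) \<in> N"
  by (rule relation_imp_null, force simp: tensor_relations_def)+

text \<open>The scalar action is defined as a union over all representatives of a coset. The union
  is a single coset because replacing \<open>s\<close> by \<open>a s\<close> in the generators sends
  relations to relations, hence \<open>N\<close> into itself.\<close>

lemma smult_pure:
  assumes "a \<in> carrier S" "x \<in> carrier M" "s \<in> carrier S"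
  shows "a \<odot>\<^bsub>T\<^esub> pure x s = pure x (a \<otimes>\<^bsub>S\<^esub> s)"
proof -
  define E where "E = frag_extend (\<lambda>(x, s). frag_of (x, a \<otimes>\<^bsub>S\<^esub> s) :: 'm \<times> 's \<Rightarrow>\<^sub>0 int)"
  have E_null: "E u \<in> N" if "u \<in> N" for u
    using that
  proof (induction rule: null_induct)
    case zero
    then show ?case using subgroup.one_closed[OF null_subgroup] by (simp add: E_def)
  next
    case (left x y s)
    then show ?case using null_relations(1)[of x y "a \<otimes>\<^bsub>S\<^esub> s"] assms(1)
      by (simp add: E_def frag_extend_diff)
  next
    case (right x s t)
    then show ?case using null_relations(2)[of x "a \<otimes>\<^bsub>S\<^esub> s" "a \<otimes>\<^bsub>S\<^esub> t"] assms(1)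
      by (simp add: E_def frag_extend_diff S.r_distr)
  next
    case (balanced b x s)
    then show ?case using null_relations(3)[of b x "a \<otimes>\<^bsub>S\<^esub> s"] assms(1)
      by (simp add: E_def frag_extend_diff S.m_lcomm \<phi>_closed)
  next
    case (uminus u)
    then show ?case
      using subgroup.m_inv_closed[OF null_subgroup, of "E u"] null_closed[of "E u"]
      by (simp add: E_def frag_extend_minus)
  next
    case (add u v)
    then show ?case
      using subgroup.m_closed[OF null_subgroup, of "E u" "E v"] by (simp add: E_def frag_extend_add)
  qed
  have cl: "cl (E u) = pure x (a \<otimes>\<^bsub>S\<^esub> s)" if u: "u \<in> pure x s" for u
  proof -
    obtain n where n: "n \<in> N" "u = n + frag_of (x, s)"
      using u by (auto simp: pure_tensor_def r_coset_def)
    have "cl (E n + frag_of (x, a \<otimes>\<^bsub>S\<^esub> s)) = cl (frag_of (x, a \<otimes>\<^bsub>S\<^esub> s))"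
      using null_closed[OF E_null[OF n(1)]] keys_add[of "E n" "frag_of (x, a \<otimes>\<^bsub>S\<^esub> s)"] assms E_null[OF n(1)]
      by (subst cl_eq) auto
    then show ?thesis unfolding n by (simp add: E_def frag_extend_add pure_tensor_def)
  qed
  have "frag_of (x, s) \<in> pure x s"
    unfolding pure_tensor_def using assms by (intro G.rcos_self[OF _ null_subgroup]) auto
  with cl show ?thesis
    by (auto simp: base_change_def Let_def E_def[symmetric])
qed

definition respects_tensor :: "('p, 'w) ring_scheme \<Rightarrow> ('m \<times> 's \<Rightarrow> 'p) \<Rightarrow> bool" where
  "respects_tensor P h \<longleftrightarrow> abelian_group P \<and> h \<in> gens \<rightarrow> carrier P \<and>
    (\<forall>x\<in>carrier M. \<forall>y\<in>carrier M. \<forall>s\<in>carrier S. h (x \<oplus>\<^bsub>M\<^esub> y, s) = h (x, s) \<oplus>\<^bsub>P\<^esub> h (y, s)) \<and>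
    (\<forall>x\<in>carrier M. \<forall>s\<in>carrier S. \<forall>t\<in>carrier S. h (x, s \<oplus>\<^bsub>S\<^esub> t) = h (x, s) \<oplus>\<^bsub>P\<^esub> h (x, t)) \<and>
    (\<forall>a\<in>carrier R. \<forall>x\<in>carrier M. \<forall>s\<in>carrier S. h (a \<odot>\<^bsub>M\<^esub> x, s) = h (x, \<phi> a \<otimes>\<^bsub>S\<^esub> s))"

lemma tensor_ext_null:
  assumes "respects_tensor P h" "u \<in> N"
  shows "tensor_ext P h u = \<zero>\<^bsub>P\<^esub>"
proof -
  interpret P: abelian_group P using assms by (simp add: respects_tensor_def)
  have h: "h \<in> gens \<rightarrow> carrier P" using assms by (simp add: respects_tensor_def)
  note ext = P.tensor_ext_diff[OF _ _ h] P.tensor_ext_frag_of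
  have hc: "h (x, s) \<in> carrier P" if "x \<in> carrier M" "s \<in> carrier S" for x s
    using h that by auto
  show ?thesis
    using assms(2)
  proof (induction rule: null_induct)
    case zero
    then show ?case by (simp add: P.tensor_ext_zero)
  next
    case (left x y s)
    moreover from this have "h (x \<oplus>\<^bsub>M\<^esub> y, s) = h (x, s) \<oplus>\<^bsub>P\<^esub> h (y, s)"
      using assms(1) by (simp add: respects_tensor_def)
    ultimately show ?case by (simp add: ext hc keys_diff_subset P.add_minus_minus_cancel)
  next
    case (right x s t)
    moreover from this have "h (x, s \<oplus>\<^bsub>S\<^esub> t) = h (x, s) \<oplus>\<^bsub>P\<^esub> h (x, t)"
      using assms(1) by (simp add: respects_tensor_def)
    ultimately show ?case by (simp add: ext hc keys_diff_subset P.add_minus_minus_cancel)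
  next
    case (balanced a x s)
    moreover from this have "h (a \<odot>\<^bsub>M\<^esub> x, s) = h (x, \<phi> a \<otimes>\<^bsub>S\<^esub> s)"
      using assms(1) by (simp add: respects_tensor_def)
    ultimately show ?case by (simp add: ext hc P.minus_eq P.r_neg \<phi>_closed)
  next
    case (uminus u)
    then show ?case using P.tensor_ext_uminus[OF _ h] by simp
  next
    case (add u v)
    then show ?case using P.tensor_ext_add[OF _ _ h] by simp
  qed
qed

text \<open>Two representatives differ by an element of \<open>N\<close>, on which a balanced map
  sums to zero; so the \<open>SOME\<close> in \<open>tensor_lift\<close> may be replaced by any
  representative.\<close>

lemma tensor_lift_cl:
  assumes "respects_tensor P h" "Poly_Mapping.keys u \<subseteq> gens"
  shows "tensor_lift P h (cl u) = tensor_ext P h u"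
proof -
  interpret P: abelian_group P using assms by (simp add: respects_tensor_def)
  have h: "h \<in> gens \<rightarrow> carrier P" using assms by (simp add: respects_tensor_def)
  define v where "v = (SOME v. v \<in> cl u)"
  have "u \<in> cl u" using assms(2) by (intro G.rcos_self[OF _ null_subgroup]) auto
  then have "v \<in> cl u" unfolding v_def by (rule someI)
  then obtain n where n: "n \<in> N" "v = n + u" by (auto simp: r_coset_def)
  have "tensor_ext P h v = tensor_ext P h u"
    using n P.tensor_ext_add[OF null_closed[OF n(1)] assms(2) h] tensor_ext_null[OF assms(1) n(1)]
      P.tensor_ext_closed[OF assms(2) h] by simp
  then show ?thesis by (simp add: tensor_lift_def tensor_ext_def v_def Let_def)
qed

lemma tensor_lift_pure:
  assumes "respects_tensor P h" "x \<in> carrier M" "s \<in> carrier S"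
  shows "tensor_lift P h (pure x s) = h (x, s)"
proof -
  interpret P: abelian_group P using assms by (simp add: respects_tensor_def)
  have "h (x, s) \<in> carrier P" using assms by (auto simp: respects_tensor_def)
  then show ?thesis
    unfolding pure_tensor_def using assms
    by (subst tensor_lift_cl) (auto simp: P.tensor_ext_frag_of)
qed

lemma tensor_lift_diff:
  assumes "respects_tensor P h" "U \<in> carrier T" "V \<in> carrier T"
  shows "tensor_lift P h (U \<ominus>\<^bsub>T\<^esub> V) = tensor_lift P h U \<ominus>\<^bsub>P\<^esub> tensor_lift P h V"
proof -
  interpret P: abelian_group P using assms by (simp add: respects_tensor_def)
  have h: "h \<in> gens \<rightarrow> carrier P" using assms by (simp add: respects_tensor_def)
  show ?thesis
    using assms unfolding carrier_T
    by (elim imageE) (simp add: cl_diff tensor_lift_cl P.tensor_ext_diff[OF _ _ h] keys_diff_subset)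
qed

lemma tensor_lift_zero:
  assumes "respects_tensor P h"
  shows "tensor_lift P h \<zero>\<^bsub>T\<^esub> = \<zero>\<^bsub>P\<^esub>"
  using assms abelian_group.tensor_ext_zero[of P h]
  by (simp add: cl_zero tensor_lift_cl respects_tensor_def)

end

context scalar_extension
begin

lemma pure_zero_left:
  assumes "s \<in> carrier S"
  shows "pure \<zero>\<^bsub>M\<^esub> s = \<zero>\<^bsub>T\<^esub>"
proof -
  have "pure \<zero>\<^bsub>M\<^esub> s \<oplus>\<^bsub>T\<^esub> pure \<zero>\<^bsub>M\<^esub> s = pure \<zero>\<^bsub>M\<^esub> s"
    using assms pure_add_left[of "\<zero>\<^bsub>M\<^esub>" "\<zero>\<^bsub>M\<^esub>"] by simp
  then show ?thesis
    using assms pure_closed[of "\<zero>\<^bsub>M\<^esub>"] by (metis M.zero_closed T.add.l_cancel_one')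
qed

lemma pure_diff_left:
  assumes "x \<in> carrier M" "y \<in> carrier M" "s \<in> carrier S"
  shows "pure (x \<ominus>\<^bsub>M\<^esub> y) s = pure x s \<ominus>\<^bsub>T\<^esub> pure y s"
proof -
  have "pure (x \<ominus>\<^bsub>M\<^esub> y) s \<oplus>\<^bsub>T\<^esub> pure y s = pure x s"
    using assms by (simp add: M.minus_eq M.a_assoc M.l_neg flip: pure_add_left)
  then show ?thesis
    using assms pure_closed by (metis M.minus_closed T.add.inv_solve_right T.minus_eq)
qed

lemma pure_smult:
  assumes "x \<in> carrier M" "a \<in> carrier R"
  shows "pure (a \<odot>\<^bsub>M\<^esub> x) \<one>\<^bsub>S\<^esub> = \<phi> a \<odot>\<^bsub>T\<^esub> pure x \<one>\<^bsub>S\<^esub>"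
  using assms by (simp add: pure_balanced smult_pure \<phi>_closed)

text \<open>A section \<psi> of \<phi> moves the second factor into the first: x \<otimes> s =
  \<psi>(s) x \<otimes> 1.\<close>

lemma pure_one_surj:
  assumes \<psi>: "\<And>s. s \<in> carrier S \<Longrightarrow> \<psi> s \<in> carrier R \<and> \<phi> (\<psi> s) = s"
    and Z: "Z \<in> carrier T"
  shows "\<exists>x\<in>carrier M. Z = pure x \<one>\<^bsub>S\<^esub>"
  using Z
proof (induction rule: T_induct)
  case zero
  then show ?case by (intro bexI[of _ "\<zero>\<^bsub>M\<^esub>"]) (simp_all add: pure_zero_left)
next
  case (pure x s)
  then show ?case using \<psi>[OF pure(2)] 
    by (intro bexI[of _ "\<psi> s \<odot>\<^bsub>M\<^esub> x"]) (simp_all add: pure_balanced)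
next
  case (diff U V)
  then obtain x y where "x \<in> carrier M" "y \<in> carrier M" "U = pure x \<one>\<^bsub>S\<^esub>" "V = pure y \<one>\<^bsub>S\<^esub>"
    by blast
  then show ?case by (intro bexI[of _ "x \<ominus>\<^bsub>M\<^esub> y"]) (simp_all add: pure_diff_left)
qed

text \<open>The map sending x \<otimes> s to \<psi>(s) x is balanced and is a left inverse of the
  map sending x to x \<otimes> 1.\<close>

lemma pure_one_inj:
  assumes \<psi>: "\<And>s. s \<in> carrier S \<Longrightarrow> \<psi> s \<in> carrier R"
    and add: "\<And>s t. s \<in> carrier S \<Longrightarrow> t \<in> carrier S \<Longrightarrow> \<psi> (s \<oplus>\<^bsub>S\<^esub> t) = \<psi> s \<oplus>\<^bsub>R\<^esub> \<psi> t"
    and mult: "\<And>a s. a \<in> carrier R \<Longrightarrow> s \<in> carrier S \<Longrightarrow> \<psi> (\<phi> a \<otimes>\<^bsub>S\<^esub> s) = \<psi> s \<otimes>\<^bsub>R\<^esub> a"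
    and one: "\<psi> \<one>\<^bsub>S\<^esub> = \<one>\<^bsub>R\<^esub>"
    and x: "x \<in> carrier M" and y: "y \<in> carrier M" and eq: "pure x \<one>\<^bsub>S\<^esub> = pure y \<one>\<^bsub>S\<^esub>"
  shows "x = y"
proof -
  have r: "respects_tensor M (\<lambda>(x, s). \<psi> s \<odot>\<^bsub>M\<^esub> x)"
    unfolding respects_tensor_def
    using M.abelian_group_axioms
    by (auto simp: \<psi> add mult M.smult_r_distr M.smult_l_distr M.smult_assoc1)
  have "tensor_lift M (\<lambda>(x, s). \<psi> s \<odot>\<^bsub>M\<^esub> x) (pure z \<one>\<^bsub>S\<^esub>) = z" if "z \<in> carrier M" for z
    using that by (simp add: tensor_lift_pure[OF r] one)
  then show ?thesis using x y eq by metis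
qed

end


section \<open>Locally free modules\<close>

text \<open>Recursion on the list of generators turns statements on finitely generated modules into
  inductions that treat one generator at a time.\<close>

fun list_span :: "('r, 'z) ring_scheme \<Rightarrow> ('r, 'm, 'w) module_scheme \<Rightarrow> 'm list \<Rightarrow> 'm set" where
  "list_span R M [] = {\<zero>\<^bsub>M\<^esub>}"
| "list_span R M (y # ys) = {a \<odot>\<^bsub>M\<^esub> y \<oplus>\<^bsub>M\<^esub> z | a z. a \<in> carrier R \<and> z \<in> list_span R M ys}"

context module
begin

lemma list_span_closed: "set ys \<subseteq> carrier M \<Longrightarrow> list_span R M ys \<subseteq> carrier M"
  by (induction ys) auto

lemma list_span_zero: "set ys \<subseteq> carrier M \<Longrightarrow> \<zero>\<^bsub>M\<^esub> \<in> list_span R M ys"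
  by (induction ys) (auto intro!: exI[of _ "\<zero>\<^bsub>M\<^esub>"] exI[of _ "\<zero>"])

lemma list_span_add:
  assumes "set ys \<subseteq> carrier M" "x \<in> list_span R M ys" "y \<in> list_span R M ys"
  shows "x \<oplus>\<^bsub>M\<^esub> y \<in> list_span R M ys"
  using assms
proof (induction ys arbitrary: x y)
  case (Cons w ys)
  then obtain a z b z' where 1: "a \<in> carrier R" "z \<in> list_span R M ys" "x = a \<odot>\<^bsub>M\<^esub> w \<oplus>\<^bsub>M\<^esub> z"
    "b \<in> carrier R" "z' \<in> list_span R M ys" "y = b \<odot>\<^bsub>M\<^esub> w \<oplus>\<^bsub>M\<^esub> z'"
    by auto
  then have "z \<in> carrier M" "z' \<in> carrier M" "w \<in> carrier M"
    using list_span_closed Cons.prems by auto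
  then have "x \<oplus>\<^bsub>M\<^esub> y = (a \<oplus> b) \<odot>\<^bsub>M\<^esub> w \<oplus>\<^bsub>M\<^esub> (z \<oplus>\<^bsub>M\<^esub> z')"
    using 1 by (simp add: smult_l_distr M.a_ac)
  then show ?case using 1 Cons by auto
qed auto

lemma list_span_smult:
  assumes "set ys \<subseteq> carrier M" "c \<in> carrier R" "x \<in> list_span R M ys"
  shows "c \<odot>\<^bsub>M\<^esub> x \<in> list_span R M ys"
  using assms
proof (induction ys arbitrary: x)
  case (Cons w ys)
  then obtain a z where 1: "a \<in> carrier R" "z \<in> list_span R M ys" "x = a \<odot>\<^bsub>M\<^esub> w \<oplus>\<^bsub>M\<^esub> z"
    by auto
  then have "z \<in> carrier M" "w \<in> carrier M"
    using list_span_closed Cons.prems by auto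
  then have "c \<odot>\<^bsub>M\<^esub> x = (c \<otimes> a) \<odot>\<^bsub>M\<^esub> w \<oplus>\<^bsub>M\<^esub> c \<odot>\<^bsub>M\<^esub> z"
    using 1 Cons by (simp add: smult_r_distr smult_assoc1)
  then show ?case using 1 Cons by auto
qed auto

lemma list_span_superset: "set ys \<subseteq> carrier M \<Longrightarrow> set ys \<subseteq> list_span R M ys"
proof (induction ys)
  case (Cons w ys)
  have "w = \<one> \<odot>\<^bsub>M\<^esub> w \<oplus>\<^bsub>M\<^esub> \<zero>\<^bsub>M\<^esub>" using Cons by simp
  moreover have "x = \<zero> \<odot>\<^bsub>M\<^esub> w \<oplus>\<^bsub>M\<^esub> x" if "x \<in> set ys" for x using Cons that by auto
  ultimately show ?case using Cons list_span_zero[of ys] by fastforce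
qed auto

lemma list_span_min:
  assumes "set ys \<subseteq> H" "\<zero>\<^bsub>M\<^esub> \<in> H" "\<And>x y. x \<in> H \<Longrightarrow> y \<in> H \<Longrightarrow> x \<oplus>\<^bsub>M\<^esub> y \<in> H"
    "\<And>a x. a \<in> carrier R \<Longrightarrow> x \<in> H \<Longrightarrow> a \<odot>\<^bsub>M\<^esub> x \<in> H"
  shows "list_span R M ys \<subseteq> H"
  using assms(1) by (induction ys) (auto simp: assms)

lemma list_span_mono:
  assumes "set ys \<subseteq> set zs" "set zs \<subseteq> carrier M"
  shows "list_span R M ys \<subseteq> list_span R M zs"
  using assms list_span_superset[of zs]
  by (intro list_span_min) (auto simp: list_span_zero list_span_add list_span_smult)

lemma smult_diff:
  assumes "a \<in> carrier R" "x \<in> carrier M" "y \<in> carrier M"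
  shows "a \<odot>\<^bsub>M\<^esub> (x \<ominus>\<^bsub>M\<^esub> y) = a \<odot>\<^bsub>M\<^esub> x \<ominus>\<^bsub>M\<^esub> a \<odot>\<^bsub>M\<^esub> y"
  using assms by (simp add: M.minus_eq smult_r_distr smult_r_minus)

end

lemma (in abelian_monoid) finsum_mem:
  assumes "finite A" "f \<in> A \<rightarrow> H" "H \<subseteq> carrier G" "\<zero> \<in> H"
    "\<And>x y. x \<in> H \<Longrightarrow> y \<in> H \<Longrightarrow> x \<oplus> y \<in> H"
  shows "finsum G f A \<in> H"
  using assms(1,2)
proof (induction A rule: finite_induct)
  case (insert a A)
  then have "f \<in> A \<rightarrow> carrier G" "f a \<in> carrier G" "f a \<in> H" using assms(3) by auto
  then show ?case using insert assms by simp
qed (use assms in simp)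

text \<open>Adding or scaling coefficient families represents the sum or the multiple; uniqueness of
  the coefficients turns this into linearity of the coordinate functions.\<close>

lemma basis_coordinates:
  assumes "is_basis R N es"
  obtains \<kappa> where
    "\<And>z i. z \<in> carrier N \<Longrightarrow> i < length es \<Longrightarrow> \<kappa> z i \<in> carrier R"
    "\<And>z. z \<in> carrier N \<Longrightarrow> z = (\<Oplus>\<^bsub>N\<^esub> i\<in>{..<length es}. \<kappa> z i \<odot>\<^bsub>N\<^esub> (es ! i))"
    "\<And>z w i. z \<in> carrier N \<Longrightarrow> w \<in> carrier N \<Longrightarrow> i < length es \<Longrightarrow>
       \<kappa> (z \<oplus>\<^bsub>N\<^esub> w) i = \<kappa> z i \<oplus>\<^bsub>R\<^esub> \<kappa> w i"
    "\<And>a z i. a \<in> carrier R \<Longrightarrow> z \<in> carrier N \<Longrightarrow> i < length es \<Longrightarrow>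
       \<kappa> (a \<odot>\<^bsub>N\<^esub> z) i = a \<otimes>\<^bsub>R\<^esub> \<kappa> z i"
proof -
  interpret N: module R N using assms by (simp add: is_basis_def)
  let ?I = "{..<length es}"
  have es: "es ! i \<in> carrier N" if "i < length es" for i
    using assms that by (auto simp: is_basis_def)
  define \<kappa> where "\<kappa> z = (THE c. c \<in> ?I \<rightarrow>\<^sub>E carrier R \<and>
      z = (\<Oplus>\<^bsub>N\<^esub> i\<in>?I. c i \<odot>\<^bsub>N\<^esub> (es ! i)))" for z
  have ex1: "\<exists>!c. c \<in> ?I \<rightarrow>\<^sub>E carrier R \<and> z = (\<Oplus>\<^bsub>N\<^esub> i\<in>?I. c i \<odot>\<^bsub>N\<^esub> (es ! i))"
    if "z \<in> carrier N" for z using assms that by (simp add: is_basis_def)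
  have \<kappa>: "\<kappa> z \<in> ?I \<rightarrow>\<^sub>E carrier R" "z = (\<Oplus>\<^bsub>N\<^esub> i\<in>?I. \<kappa> z i \<odot>\<^bsub>N\<^esub> (es ! i))"
    if "z \<in> carrier N" for z
    using theI'[OF ex1[OF that]] by (simp_all only: \<kappa>_def)
  have c: "\<kappa> z i \<in> carrier R" if "z \<in> carrier N" "i < length es" for z i
    using \<kappa>(1)[OF that(1)] that(2) by (auto simp: PiE_iff)
  have uniq: "\<kappa> z i = c i" if "z \<in> carrier N" "i < length es" "\<And>i. i < length es \<Longrightarrow> c i \<in> carrier R"
    "z = (\<Oplus>\<^bsub>N\<^esub> i\<in>?I. c i \<odot>\<^bsub>N\<^esub> (es ! i))" for z i c
  proof -
    \<comment> \<open>\<open>is_basis\<close> asserts uniqueness only among extensional functions,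
      so \<open>c\<close> has to be cut off outside the index set.\<close>
    have "restrict c ?I \<in> ?I \<rightarrow>\<^sub>E carrier R" using that(3) by auto
    moreover have "z = (\<Oplus>\<^bsub>N\<^esub> i\<in>?I. restrict c ?I i \<odot>\<^bsub>N\<^esub> (es ! i))"
      unfolding that(4) using that(3) es by (intro N.finsum_cong') auto
    ultimately have "\<kappa> z = restrict c ?I" using ex1[OF that(1)] \<kappa>[OF that(1)] by blast
    then show ?thesis using that(2) by simp
  qed
  show ?thesis
  proof (rule that[OF c \<kappa>(2)])
    fix z w i assume *: "z \<in> carrier N" "w \<in> carrier N" "i < length es"
    have "(\<Oplus>\<^bsub>N\<^esub> i\<in>?I. (\<kappa> z i \<oplus>\<^bsub>R\<^esub> \<kappa> w i) \<odot>\<^bsub>N\<^esub> (es ! i))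
        = (\<Oplus>\<^bsub>N\<^esub> i\<in>?I. \<kappa> z i \<odot>\<^bsub>N\<^esub> (es ! i) \<oplus>\<^bsub>N\<^esub> \<kappa> w i \<odot>\<^bsub>N\<^esub> (es ! i))"
      using * es c by (intro N.finsum_cong') (auto simp: N.smult_l_distr)
    also have "\<dots> = z \<oplus>\<^bsub>N\<^esub> w"
      using * es c by (subst N.finsum_addf) (auto simp flip: \<kappa>(2))
    finally show "\<kappa> (z \<oplus>\<^bsub>N\<^esub> w) i = \<kappa> z i \<oplus>\<^bsub>R\<^esub> \<kappa> w i"
      using * c by (intro uniq) auto
  next
    fix a z i assume *: "a \<in> carrier R" "z \<in> carrier N" "i < length es"
    have "(\<Oplus>\<^bsub>N\<^esub> i\<in>?I. (a \<otimes>\<^bsub>R\<^esub> \<kappa> z i) \<odot>\<^bsub>N\<^esub> (es ! i))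
        = (\<Oplus>\<^bsub>N\<^esub> i\<in>?I. a \<odot>\<^bsub>N\<^esub> (\<kappa> z i \<odot>\<^bsub>N\<^esub> (es ! i)))"
      using * es c by (intro N.finsum_cong') (auto simp: N.smult_assoc1)
    also have "\<dots> = a \<odot>\<^bsub>N\<^esub> z"
      using * es c by (subst N.finsum_smult_ldistr[symmetric]) (auto simp flip: \<kappa>(2))
    finally show "\<kappa> (a \<odot>\<^bsub>N\<^esub> z) i = a \<otimes>\<^bsub>R\<^esub> \<kappa> z i"
      using * c by (intro uniq) auto
  qed
qed

text \<open>All exponents from \<open>k\<close> on work, so that finitely many denominators can be
  cleared by one power of \<open>s\<close>.\<close>

lemma localized_denominator:
  assumes "cring (ring_on R)" "s \<in> R" "s \<noteq> 0" "t \<in> localized R s"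
  obtains k where "\<And>n. k \<le> n \<Longrightarrow> s ^ n * t \<in> R"
proof -
  obtain r k where r: "r \<in> R" "t = r / s ^ k" using assms by (auto simp: localized_def)
  show ?thesis
  proof (rule that)
    fix n assume "k \<le> n"
    then have "s ^ n * t = s ^ (n - k) * r" using r assms(3) by (simp add: power_diff)
    then show "s ^ n * t \<in> R" using ring_on_closed[OF assms(1)] r assms(2) by simp
  qed
qed

text \<open>An element of the null group vanishes after clearing denominators with a high power of \<open>s\<close>
  and summing up in \<open>M\<close>; this detects the kernel without constructing fractions.\<close>

lemma localization_kernel:
  assumes M: "module (ring_on R) M" and L: "cring (ring_on (localized R s))"
    and s: "s \<in> R" "s \<noteq> 0" and x: "x \<in> carrier M"
    and eq: "pure_tensor (ring_on R) (ring_on (localized R s)) id M x 1 =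
      \<zero>\<^bsub>base_change (ring_on R) (ring_on (localized R s)) id M\<^esub>"
  shows "\<exists>n. s ^ n \<odot>\<^bsub>M\<^esub> x = \<zero>\<^bsub>M\<^esub>"
proof -
  interpret M: module "ring_on R" M by fact
  have R: "cring (ring_on R)" by (rule M.is_cring)
  note Rc = ring_on_closed[OF R]
  have sub: "a \<in> R \<Longrightarrow> a \<in> localized R s" for a
    unfolding localized_def by (intro CollectI exI[of _ a] exI[of _ 0]) simp
  interpret scalar_extension "ring_on R" "ring_on (localized R s)" M id
    by (intro scalar_extension.intro scalar_extension_axioms.intro M L) (simp add: sub)
  \<comment> \<open>\<open>ev n\<close> is the map sending x \<otimes> t to t x, multiplied by
    \<open>s ^ n\<close>. The default zero occurs only while \<open>s ^ n * t\<close> is still a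
    proper fraction. A relation involves finitely many \<open>t\<close>, so for large
    \<open>n\<close> it is evaluated without the default; hence the word "eventually" in
    \<open>small\<close>.\<close>
  define ev where "ev n = (\<lambda>(x, t). if s ^ n * t \<in> R then (s ^ n * t) \<odot>\<^bsub>M\<^esub> x else \<zero>\<^bsub>M\<^esub>)" for n
  have ev: "ev n \<in> gens \<rightarrow> carrier M" for n by (auto simp: ev_def)
  note ext = M.tensor_ext_diff[OF _ _ ev] M.tensor_ext_frag_of
  define small where "small u \<longleftrightarrow> (\<forall>\<^sub>F n in sequentially. tensor_ext M (ev n) u = \<zero>\<^bsub>M\<^esub>)" for u
  have inR: "\<forall>\<^sub>F n in sequentially. s ^ n * t \<in> R" if "t \<in> localized R s" for t
    using localized_denominator[OF R s that] unfolding eventually_sequentially by metis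
  have evc: "ev n (x, t) \<in> carrier M" if "x \<in> carrier M" for n x t
    using that by (auto simp: ev_def)
  have null: "small u" if "u \<in> N" for u
    using that
  proof (induction rule: null_induct)
    case zero
    then show ?case by (simp add: small_def M.tensor_ext_zero)
  next
    case (left x y t)
    have "tensor_ext M (ev n) (frag_of (x \<oplus>\<^bsub>M\<^esub> y, t) - frag_of (x, t) - frag_of (y, t)) = \<zero>\<^bsub>M\<^esub>"
      if "s ^ n * t \<in> R" for n
    proof -
      have "ev n (x \<oplus>\<^bsub>M\<^esub> y, t) = ev n (x, t) \<oplus>\<^bsub>M\<^esub> ev n (y, t)"
        using left that by (simp add: ev_def M.smult_r_distr)
      then show ?thesis
        using left evc by (simp add: ext keys_diff_subset M.add_minus_minus_cancel)
    qed
    then show ?case unfolding small_def using inR[of t] left by (auto elim: eventually_mono)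
  next
    case (right x t t')
    have t: "t + t' \<in> localized R s" using right S.a_closed by simp
    have "tensor_ext M (ev n) (frag_of (x, t + t') - frag_of (x, t) - frag_of (x, t')) = \<zero>\<^bsub>M\<^esub>"
      if "s ^ n * t \<in> R" "s ^ n * t' \<in> R" for n
    proof -
      have "s ^ n * (t + t') \<in> R" using Rc(3)[OF that] by (simp add: algebra_simps)
      then have "ev n (x, t + t') = ev n (x, t) \<oplus>\<^bsub>M\<^esub> ev n (x, t')"
        using right that M.smult_l_distr[of "s ^ n * t" "s ^ n * t'" x] by (simp add: ev_def distrib_left)
      then show ?thesis
        using right evc t by (simp add: ext keys_diff_subset M.add_minus_minus_cancel)
    qed
    then show ?case unfolding small_def using inR[of t] inR[of t'] right
      by (auto elim: eventually_elim2)
  next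
    case (balanced a x t)
    have t: "a * t \<in> localized R s" using balanced S.m_closed[of a t] sub by simp
    have "tensor_ext M (ev n) (frag_of (a \<odot>\<^bsub>M\<^esub> x, t) - frag_of (x, a * t)) = \<zero>\<^bsub>M\<^esub>"
      if "s ^ n * t \<in> R" for n
    proof -
      have "s ^ n * (a * t) \<in> R" using Rc(4)[OF _ that, of a] balanced by (simp add: mult.left_commute)
      then have "ev n (a \<odot>\<^bsub>M\<^esub> x, t) = ev n (x, a * t)"
        using balanced that M.smult_assoc1[of "s ^ n * t" a x] by (simp add: ev_def mult_ac)
      then show ?thesis
        using balanced evc t by (simp add: ext M.minus_eq M.r_neg)
    qed
    then show ?case unfolding small_def using inR[of t] balanced by (auto elim: eventually_mono)
  next
    case (uminus u)
    then have "tensor_ext M (ev n) (- u) = \<ominus>\<^bsub>M\<^esub> tensor_ext M (ev n) u" for n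
      using M.tensor_ext_uminus[OF _ ev] by auto
    then show ?case using uminus unfolding small_def by (auto elim: eventually_mono)
  next
    case (add u v)
    then have "tensor_ext M (ev n) (u + v) = tensor_ext M (ev n) u \<oplus>\<^bsub>M\<^esub> tensor_ext M (ev n) v" for n
      using M.tensor_ext_add[OF _ _ ev] by auto
    then show ?case using add unfolding small_def by (auto elim: eventually_elim2)
  qed
  have 1: "1 \<in> localized R s" using sub[OF Rc(2)] .
  have "frag_of (x, 1) - 0 \<in> N"
    using cl_eq[of "frag_of (x, 1)" 0] eq x 1 by (simp add: pure_tensor_def cl_zero)
  then have "small (frag_of (x, 1))" using null by simp
  then obtain n where "tensor_ext M (ev n) (frag_of (x, 1)) = \<zero>\<^bsub>M\<^esub>"
    unfolding small_def eventually_sequentially by blast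
  then have "s ^ n \<odot>\<^bsub>M\<^esub> x = \<zero>\<^bsub>M\<^esub>"
    using x Rc(7)[OF s(1), of n] by (simp add: M.tensor_ext_frag_of evc) (simp add: ev_def)
  then show ?thesis by blast
qed

section \<open>Ideals and primes in a subring of a field\<close>

lemma ideal_ring_on_iff:
  assumes "cring (ring_on R)"
  shows "ideal J (ring_on R) \<longleftrightarrow> J \<subseteq> R \<and> 0 \<in> J \<and> (\<forall>x\<in>J. \<forall>y\<in>J. x + y \<in> J) \<and>
    (\<forall>a\<in>R. \<forall>x\<in>J. a * x \<in> J)"
proof
  assume "ideal J (ring_on R)"
  then interpret ideal J "ring_on R" .
  show "J \<subseteq> R \<and> 0 \<in> J \<and> (\<forall>x\<in>J. \<forall>y\<in>J. x + y \<in> J) \<and> (\<forall>a\<in>R. \<forall>x\<in>J. a * x \<in> J)"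
    using a_subset additive_subgroup.zero_closed[OF is_additive_subgroup]
      additive_subgroup.a_closed[OF is_additive_subgroup] I_l_closed by auto
next
  interpret cring "ring_on R" by fact
  assume J: "J \<subseteq> R \<and> 0 \<in> J \<and> (\<forall>x\<in>J. \<forall>y\<in>J. x + y \<in> J) \<and> (\<forall>a\<in>R. \<forall>x\<in>J. a * x \<in> J)"
  then have neg: "- x \<in> J" if "x \<in> J" for x
    using that ring_on_closed(2,5)[OF assms] by (metis mult_minus1)
  show "ideal J (ring_on R)"
  proof (rule idealI)
    show "subgroup J (add_monoid (ring_on R))"
    proof (rule add.subgroupI)
      show "\<ominus>\<^bsub>ring_on R\<^esub> x \<in> J" if "x \<in> J" for x
      proof -
        have "x \<in> R" using that J by blast
        then show ?thesis using neg[OF that] assms by simp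
      qed
    qed (use J in auto)
    show "x \<otimes>\<^bsub>ring_on R\<^esub> a \<in> J" "a \<otimes>\<^bsub>ring_on R\<^esub> x \<in> J"
      if "a \<in> J" "x \<in> carrier (ring_on R)" for a x
      using J that by (auto simp: mult.commute[of a x])
  qed (rule ring_axioms)
qed

text \<open>Zorn's lemma gives a maximal ideal above \<open>I\<close>, and maximal ideals are prime.
  Local freeness speaks about primes only, so global statements are reached by showing that a
  suitable ideal lies in none of them.\<close>

lemma proper_ideal_subset_prime:
  assumes R: "cring (ring_on R)" and I: "ideal I (ring_on R)" "1 \<notin> I"
  obtains P where "primeideal P (ring_on R)" "I \<subseteq> P"
proof -
  interpret cring "ring_on R" by fact
  note idl = ideal_ring_on_iff[OF R]
  define A where "A = {J. ideal J (ring_on R) \<and> I \<subseteq> J \<and> 1 \<notin> J}"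
  have "\<exists>P\<in>A. \<forall>Y\<in>A. P \<subseteq> Y \<longrightarrow> Y = P"
  proof (rule subset_Zorn_nonempty)
    show "A \<noteq> {}" using I by (auto simp: A_def)
  next
    fix \<C> assume C: "\<C> \<noteq> {}" "subset.chain A \<C>"
    then have CA: "\<And>J. J \<in> \<C> \<Longrightarrow> J \<in> A" and lin: "\<And>J J'. J \<in> \<C> \<Longrightarrow> J' \<in> \<C> \<Longrightarrow> J \<subseteq> J' \<or> J' \<subseteq> J"
      by (auto simp: subset.chain_def)
    have "ideal (\<Union>\<C>) (ring_on R)"
      unfolding idl
    proof (intro conjI ballI)
      show "\<Union>\<C> \<subseteq> R" using CA unfolding A_def idl by blast
      show "0 \<in> \<Union>\<C>" using CA C(1) unfolding A_def idl by blast
      show "a * x \<in> \<Union>\<C>" if "a \<in> R" "x \<in> \<Union>\<C>" for a x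
        using that CA unfolding A_def idl by blast
      show "x + y \<in> \<Union>\<C>" if xy: "x \<in> \<Union>\<C>" "y \<in> \<Union>\<C>" for x y
      proof -
        obtain J where "J \<in> \<C>" "x \<in> J" "y \<in> J" using xy lin by blast
        then show ?thesis using CA[of J] unfolding A_def idl by blast
      qed
    qed
    then show "\<Union>\<C> \<in> A" using CA C(1) by (auto simp: A_def)
  qed
  then obtain P where P: "P \<in> A" "\<And>Y. Y \<in> A \<Longrightarrow> P \<subseteq> Y \<Longrightarrow> Y = P" by blast
  have "maximalideal P (ring_on R)"
  proof (rule maximalidealI)
    show "ideal P (ring_on R)" using P by (simp add: A_def)
    show "carrier (ring_on R) \<noteq> P" using P(1) one_closed by (auto simp: A_def)
    fix J assume J: "ideal J (ring_on R)" "P \<subseteq> J" "J \<subseteq> carrier (ring_on R)"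
    show "J = P \<or> J = carrier (ring_on R)"
    proof (cases "1 \<in> J")
      case True
      then have "a \<in> J" if "a \<in> R" for a using J(1) that unfolding idl by (metis mult.right_neutral)
      then show ?thesis using J(3) by auto
    next
      case False
      then show ?thesis using P J by (auto simp: A_def)
    qed
  qed
  then show ?thesis using that maximalideal_prime P(1) by (auto simp: A_def)
qed

lemma prime_power_notin:
  assumes R: "cring (ring_on R)" and P: "primeideal P (ring_on R)" and s: "s \<in> R" "s \<notin> P"
  shows "s ^ n \<notin> P"
proof (induction n)
  interpret primeideal P "ring_on R" by fact
  case 0
  show ?case using I_notcarr one_imp_carrier by auto
next
  interpret primeideal P "ring_on R" by fact
  case (Suc n)
  then show ?case using I_prime[of s "s ^ n"] s ring_on_closed(7)[OF R s(1)] by auto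
qed

text \<open>Local freeness at a prime, expressed inside \<open>M\<close>: \<kappa> gives the
  coordinates of x \<otimes> 1 in a basis over \<open>R[1/s]\<close>, and \<open>ys\<close> are
  numerators of that basis. Identities in the localized module turn into identities in
  \<open>M\<close> up to a power of \<open>s\<close>.\<close>

locale local_coordinates =
  fixes R :: "'e::field set" and M :: "('e, 'm) module" and r :: nat and s :: 'e and ys :: "'m list"
    and \<kappa> :: "'m \<Rightarrow> nat \<Rightarrow> 'e"
  assumes module_M: "module (ring_on R) M" and cring_localized: "cring (ring_on (localized R s))"
    and ys_closed: "set ys \<subseteq> carrier M"
    and \<kappa>_closed: "x \<in> carrier M \<Longrightarrow> i < r \<Longrightarrow> \<kappa> x i \<in> localized R s"
    and \<kappa>_add: "x \<in> carrier M \<Longrightarrow> y \<in> carrier M \<Longrightarrow> i < r \<Longrightarrow> \<kappa> (x \<oplus>\<^bsub>M\<^esub> y) i = \<kappa> x i + \<kappa> y i"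
    and \<kappa>_smult: "a \<in> R \<Longrightarrow> x \<in> carrier M \<Longrightarrow> i < r \<Longrightarrow> \<kappa> (a \<odot>\<^bsub>M\<^esub> x) i = a * \<kappa> x i"
    and \<kappa>_kernel: "x \<in> carrier M \<Longrightarrow> (\<And>i. i < r \<Longrightarrow> \<kappa> x i = 0) \<Longrightarrow> \<exists>n. s ^ n \<odot>\<^bsub>M\<^esub> x = \<zero>\<^bsub>M\<^esub>"
    and generators: "x \<in> carrier M \<Longrightarrow> \<exists>n. s ^ n \<odot>\<^bsub>M\<^esub> x \<in> list_span (ring_on R) M ys"
begin

sublocale M: module "ring_on R" M
  by (rule module_M)

lemma \<kappa>_zero: "i < r \<Longrightarrow> \<kappa> \<zero>\<^bsub>M\<^esub> i = 0"
  using \<kappa>_add[OF M.zero_closed M.zero_closed] by (metis M.zero_closed M.l_zero add_cancel_right_left)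

lemma \<kappa>_finsum:
  assumes "i < r" "finite A" "z \<in> A \<rightarrow> carrier M"
  shows "\<kappa> (\<Oplus>\<^bsub>M\<^esub> j\<in>A. z j) i = (\<Sum>j\<in>A. \<kappa> (z j) i)"
  using assms(2,3)
proof (induction A rule: finite_induct)
  case (insert a A)
  then have "z \<in> A \<rightarrow> carrier M" "z a \<in> carrier M" by auto
  then show ?case using insert \<kappa>_add[of "z a" "\<Oplus>\<^bsub>M\<^esub> j\<in>A. z j" i] assms(1) by simp
qed (simp add: \<kappa>_zero assms)

end

lemma locally_free_coordinates:
  assumes lf: "locally_free R M r" and P: "primeideal P (ring_on R)"
  obtains s ys \<kappa> where "s \<in> R" "s \<notin> P" "local_coordinates R M r s ys \<kappa>"
proof -
  have M: "module (ring_on R) M" using lf by (simp add: locally_free_def)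
  interpret M: module "ring_on R" M by fact
  have R: "cring (ring_on R)" by (rule M.is_cring)
  note Rc = ring_on_closed[OF R]
  obtain s es where s: "s \<in> R" "s \<notin> P" and es: "length es = r"
    and bas: "is_basis (ring_on (localized R s)) (base_change (ring_on R) (ring_on (localized R s)) id M) es"
    using lf P unfolding locally_free_def free_of_rank_def by blast
  have s0: "s \<noteq> 0"
  proof -
    interpret primeideal P "ring_on R" by fact
    show ?thesis using s(2) additive_subgroup.zero_closed[OF is_additive_subgroup] by auto
  qed
  have sub: "a \<in> R \<Longrightarrow> a \<in> localized R s" for a
    unfolding localized_def by (intro CollectI exI[of _ a] exI[of _ 0]) simp
  have T: "module (ring_on (localized R s)) (base_change (ring_on R) (ring_on (localized R s)) id M)"
    using bas by (simp add: is_basis_def)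
  then have L: "cring (ring_on (localized R s))" unfolding module_def by blast
  interpret scalar_extension "ring_on R" "ring_on (localized R s)" M id
    by (intro scalar_extension.intro scalar_extension_axioms.intro M L) (simp add: sub)
  interpret TM: module "ring_on (localized R s)" T by (rule T)
  obtain \<mu> where \<mu>: "\<And>z i. z \<in> carrier T \<Longrightarrow> i < length es \<Longrightarrow> \<mu> z i \<in> localized R s"
    "\<And>z. z \<in> carrier T \<Longrightarrow> z = (\<Oplus>\<^bsub>T\<^esub> i\<in>{..<length es}. \<mu> z i \<odot>\<^bsub>T\<^esub> (es ! i))"
    "\<And>z w i. z \<in> carrier T \<Longrightarrow> w \<in> carrier T \<Longrightarrow> i < length es \<Longrightarrow> \<mu> (z \<oplus>\<^bsub>T\<^esub> w) i = \<mu> z i + \<mu> w i"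
    "\<And>a z i. a \<in> localized R s \<Longrightarrow> z \<in> carrier T \<Longrightarrow> i < length es \<Longrightarrow> \<mu> (a \<odot>\<^bsub>T\<^esub> z) i = a * \<mu> z i"
    using basis_coordinates[OF bas] by (auto simp only: ring_on_simps)
  have p1: "pure x 1 \<in> carrier T" if "x \<in> carrier M" for x
    using pure_closed[of x 1] that S.one_closed by simp
  have psm: "pure (a \<odot>\<^bsub>M\<^esub> x) 1 = a \<odot>\<^bsub>T\<^esub> pure x 1" if "a \<in> R" "x \<in> carrier M" for a x
    using pure_smult[of x a] that by simp
  have sn: "s ^ n \<in> R" "s ^ n \<in> localized R s" for n using Rc(7)[OF s(1)] sub by auto
  have es_in: "es ! i \<in> carrier T" if "i < length es" for i
    using bas that by (auto simp: is_basis_def)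
  have psums: "pure (x \<oplus>\<^bsub>M\<^esub> y) 1 = pure x 1 \<oplus>\<^bsub>T\<^esub> pure y 1" if "x \<in> carrier M" "y \<in> carrier M" for x y
    using pure_add_left[of x y 1] that S.one_closed by simp
  have sm2: "a \<odot>\<^bsub>T\<^esub> (b \<odot>\<^bsub>T\<^esub> z) = (a * b) \<odot>\<^bsub>T\<^esub> z"
    if "a \<in> localized R s" "b \<in> localized R s" "z \<in> carrier T" for a b z
    using TM.smult_assoc1[of a b z] that by simp
  have pow_add: "s ^ (m + n) \<odot>\<^bsub>T\<^esub> z = s ^ m \<odot>\<^bsub>T\<^esub> (s ^ n \<odot>\<^bsub>T\<^esub> z)"
    "s ^ (m + n) \<odot>\<^bsub>T\<^esub> z = s ^ n \<odot>\<^bsub>T\<^esub> (s ^ m \<odot>\<^bsub>T\<^esub> z)" if "z \<in> carrier T" for z m n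
    using sm2[OF sn(2) sn(2) that] by (simp_all add: power_add mult.commute)
  have ker: "\<exists>n. s ^ n \<odot>\<^bsub>M\<^esub> x = \<zero>\<^bsub>M\<^esub>" if "x \<in> carrier M" "pure x 1 = \<zero>\<^bsub>T\<^esub>" for x
    using localization_kernel[OF M L s(1) s0] that by blast
  \<comment> \<open>Elements of the localized module come from \<open>M\<close> after multiplication
    by a power of \<open>s\<close>. Applied to the basis vectors, this produces the numerators
    \<open>y i\<close>.\<close>
  have lift: "\<exists>n. \<exists>x\<in>carrier M. s ^ n \<odot>\<^bsub>T\<^esub> z = pure x 1" if "z \<in> carrier T" for z
    using that
  proof (induction rule: T_induct)
    case zero
    have "s ^ 0 \<odot>\<^bsub>T\<^esub> \<zero>\<^bsub>T\<^esub> = pure \<zero>\<^bsub>M\<^esub> 1"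
      using pure_zero_left[of 1] S.one_closed TM.smult_r_null[of 1] by simp
    then show ?case by blast
  next
    case (pure x t)
    then obtain n where n: "s ^ n * t \<in> R"
      using localized_denominator[OF R s(1) s0, of t] by auto
    have "s ^ n \<odot>\<^bsub>T\<^esub> pure x t = pure x ((s ^ n * t) * 1)"
      using pure smult_pure[of "s ^ n" x t] sn by simp
    also have "\<dots> = pure ((s ^ n * t) \<odot>\<^bsub>M\<^esub> x) 1"
      using pure_balanced[of x 1 "s ^ n * t"] pure n S.one_closed by simp
    finally have e: "s ^ n \<odot>\<^bsub>T\<^esub> pure x t = pure ((s ^ n * t) \<odot>\<^bsub>M\<^esub> x) 1" .
    show ?case by (rule exI[of _ n], rule bexI[of _ "(s ^ n * t) \<odot>\<^bsub>M\<^esub> x"], rule e) (use pure n in simp)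
  next
    case (diff U V)
    then obtain n x m y where 1: "x \<in> carrier M" "y \<in> carrier M" "s ^ n \<odot>\<^bsub>T\<^esub> U = pure x 1"
      "s ^ m \<odot>\<^bsub>T\<^esub> V = pure y 1" by blast
    have "s ^ (m + n) \<odot>\<^bsub>T\<^esub> (U \<ominus>\<^bsub>T\<^esub> V) = pure (s ^ m \<odot>\<^bsub>M\<^esub> x \<ominus>\<^bsub>M\<^esub> s ^ n \<odot>\<^bsub>M\<^esub> y) 1"
      using 1 diff.hyps sn S.one_closed TM.smult_diff[of "s ^ (m + n)" U V] pow_add(1)[of U m n] pow_add(2)[of V m n]
        pure_diff_left[of "s ^ m \<odot>\<^bsub>M\<^esub> x" "s ^ n \<odot>\<^bsub>M\<^esub> y" 1] by (simp add: psm)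
    moreover have "s ^ m \<odot>\<^bsub>M\<^esub> x \<ominus>\<^bsub>M\<^esub> s ^ n \<odot>\<^bsub>M\<^esub> y \<in> carrier M" using 1 sn by simp
    ultimately show ?case by blast
  qed
  have "\<forall>i. \<exists>n y. i < length es \<longrightarrow> y \<in> carrier M \<and> s ^ n \<odot>\<^bsub>T\<^esub> (es ! i) = pure y 1"
    using lift es_in by blast
  then obtain n y where y: "\<And>i. i < length es \<Longrightarrow> y i \<in> carrier M"
    "\<And>i. i < length es \<Longrightarrow> s ^ n i \<odot>\<^bsub>T\<^esub> (es ! i) = pure (y i) 1" by metis
  define ys where "ys = map y [0..<length es]"
  have ys: "set ys \<subseteq> carrier M" using y by (auto simp: ys_def)
  \<comment> \<open>\<open>H\<close> collects what lies in the span of the numerators up to a power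
    of \<open>s\<close>. It contains all multiples of the basis vectors and is closed under sums,
    hence contains every x \<otimes> 1.\<close>
  define H where "H = {z \<in> carrier T. \<exists>n. \<exists>x\<in>list_span (ring_on R) M ys. s ^ n \<odot>\<^bsub>T\<^esub> z = pure x 1}"
  note lsc = subsetD[OF M.list_span_closed[OF ys]]
  have Hadd: "U \<oplus>\<^bsub>T\<^esub> V \<in> H" if UV: "U \<in> H" "V \<in> H" for U V
  proof -
    obtain n x m y where 1: "x \<in> list_span (ring_on R) M ys" "y \<in> list_span (ring_on R) M ys"
      "s ^ n \<odot>\<^bsub>T\<^esub> U = pure x 1" "s ^ m \<odot>\<^bsub>T\<^esub> V = pure y 1" and c: "U \<in> carrier T" "V \<in> carrier T"
      using UV unfolding H_def by blast
    have "s ^ (m + n) \<odot>\<^bsub>T\<^esub> (U \<oplus>\<^bsub>T\<^esub> V) = pure (s ^ m \<odot>\<^bsub>M\<^esub> x \<oplus>\<^bsub>M\<^esub> s ^ n \<odot>\<^bsub>M\<^esub> y) 1"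
      using 1 c lsc sn TM.smult_r_distr[of "s ^ (m + n)" U V] pow_add(1)[of U m n] pow_add(2)[of V m n]
      by (simp add: psm psums)
    moreover have "s ^ m \<odot>\<^bsub>M\<^esub> x \<oplus>\<^bsub>M\<^esub> s ^ n \<odot>\<^bsub>M\<^esub> y \<in> list_span (ring_on R) M ys"
      using 1 sn ys by (simp add: M.list_span_add M.list_span_smult)
    ultimately show ?thesis using c unfolding H_def by blast
  qed
  have Hsm: "c \<odot>\<^bsub>T\<^esub> es ! i \<in> H" if c: "c \<in> localized R s" and i: "i < length es" for c i
  proof -
    obtain k where k: "s ^ k * c \<in> R" using localized_denominator[OF R s(1) s0 c] by auto
    have "s ^ (k + n i) \<odot>\<^bsub>T\<^esub> (c \<odot>\<^bsub>T\<^esub> es ! i) = (s ^ k * c) \<odot>\<^bsub>T\<^esub> (s ^ n i \<odot>\<^bsub>T\<^esub> es ! i)"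
      using sm2[OF sn(2) c es_in[OF i], of "k + n i"] sm2[OF sub[OF k] sn(2) es_in[OF i], of "n i"]
      by (simp add: power_add mult_ac)
    also have "\<dots> = pure ((s ^ k * c) \<odot>\<^bsub>M\<^esub> y i) 1" using k y[OF i] by (simp add: psm)
    finally have "s ^ (k + n i) \<odot>\<^bsub>T\<^esub> (c \<odot>\<^bsub>T\<^esub> es ! i) = pure ((s ^ k * c) \<odot>\<^bsub>M\<^esub> y i) 1" .
    moreover have "y i \<in> set ys" using i by (auto simp: ys_def)
    then have "(s ^ k * c) \<odot>\<^bsub>M\<^esub> y i \<in> list_span (ring_on R) M ys"
      using k ys M.list_span_superset[OF ys] by (intro M.list_span_smult) auto
    ultimately show ?thesis using c es_in[OF i] unfolding H_def by auto
  qed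
  have fg: "\<exists>n. s ^ n \<odot>\<^bsub>M\<^esub> x \<in> list_span (ring_on R) M ys" if x: "x \<in> carrier M" for x
  proof -
    have "(\<Oplus>\<^bsub>T\<^esub> i\<in>{..<length es}. \<mu> (pure x 1) i \<odot>\<^bsub>T\<^esub> (es ! i)) \<in> H"
    proof (rule T.finsum_mem)
      show "(\<lambda>i. \<mu> (pure x 1) i \<odot>\<^bsub>T\<^esub> (es ! i)) \<in> {..<length es} \<rightarrow> H"
        using Hsm \<mu>(1)[OF p1[OF x]] by auto
      show "H \<subseteq> carrier T" by (auto simp: H_def)
      have "s ^ 0 \<odot>\<^bsub>T\<^esub> \<zero>\<^bsub>T\<^esub> = pure \<zero>\<^bsub>M\<^esub> 1"
        using pure_zero_left[of 1] S.one_closed TM.smult_r_null[of 1] by simp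
      then show "\<zero>\<^bsub>T\<^esub> \<in> H" using M.list_span_zero[OF ys] unfolding H_def by blast
    qed (simp_all add: Hadd)
    then have "pure x 1 \<in> H" using \<mu>(2)[OF p1[OF x]] by simp
    then obtain n a where a: "a \<in> list_span (ring_on R) M ys" "s ^ n \<odot>\<^bsub>T\<^esub> pure x 1 = pure a 1"
      by (auto simp: H_def)
    \<comment> \<open>The equality of \<open>s ^ n\<close> x and \<open>a\<close> holds only after
      localizing. The difference is killed by a power of \<open>s\<close>, which costs the further
      factor \<open>s ^ m\<close>.\<close>
    have "pure (s ^ n \<odot>\<^bsub>M\<^esub> x \<ominus>\<^bsub>M\<^esub> a) 1 = pure a 1 \<ominus>\<^bsub>T\<^esub> pure a 1"
      using pure_diff_left[of "s ^ n \<odot>\<^bsub>M\<^esub> x" a 1] a lsc x sn S.one_closed by (simp add: psm)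
    also have "\<dots> = \<zero>\<^bsub>T\<^esub>" using p1[OF lsc[OF a(1)]] by (simp add: T.minus_eq T.r_neg)
    finally obtain m where m: "s ^ m \<odot>\<^bsub>M\<^esub> (s ^ n \<odot>\<^bsub>M\<^esub> x \<ominus>\<^bsub>M\<^esub> a) = \<zero>\<^bsub>M\<^esub>"
      using ker[of "s ^ n \<odot>\<^bsub>M\<^esub> x \<ominus>\<^bsub>M\<^esub> a"] x sn lsc[OF a(1)] by auto
    have "s ^ (m + n) \<odot>\<^bsub>M\<^esub> x = s ^ m \<odot>\<^bsub>M\<^esub> (s ^ n \<odot>\<^bsub>M\<^esub> x)"
      using M.smult_assoc1[of "s ^ m" "s ^ n" x] sn x by (simp add: power_add)
    also have "\<dots> = s ^ m \<odot>\<^bsub>M\<^esub> a"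
      using m M.smult_diff[of "s ^ m" "s ^ n \<odot>\<^bsub>M\<^esub> x" a] x sn lsc[OF a(1)]
      by (simp add: M.minus_eq_zero_iff)
    also have "\<dots> \<in> list_span (ring_on R) M ys" using a sn ys by (simp add: M.list_span_smult)
    finally show ?thesis by blast
  qed
  have inj: "\<exists>n. s ^ n \<odot>\<^bsub>M\<^esub> x = \<zero>\<^bsub>M\<^esub>" if x: "x \<in> carrier M" and 0: "\<And>i. i < r \<Longrightarrow> \<mu> (pure x 1) i = 0" for x
  proof -
    have "(\<Oplus>\<^bsub>T\<^esub> i\<in>{..<length es}. \<mu> (pure x 1) i \<odot>\<^bsub>T\<^esub> (es ! i)) = (\<Oplus>\<^bsub>T\<^esub> i\<in>{..<length es}. \<zero>\<^bsub>T\<^esub>)"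
      using 0 es es_in TM.smult_l_null by (intro T.finsum_cong') auto
    then have "pure x 1 = \<zero>\<^bsub>T\<^esub>" using \<mu>(2)[OF p1[OF x]] by simp
    then show ?thesis using ker x by blast
  qed
  show ?thesis
    by (rule that[OF s], rule local_coordinates.intro[OF M L ys, of r "\<lambda>x. \<mu> (pure x 1)"])
      (use \<mu> p1 es inj fg in \<open>auto simp: psums psm sub\<close>)
qed

text \<open>Gaussian elimination without division: coordinate \<open>r\<close> is removed by
  cross-multiplying with a nonzero pivot \<open>v k r\<close>, so that all coefficients stay in
  \<open>S\<close>.\<close>

lemma linear_dependence:
  fixes v :: "'j \<Rightarrow> nat \<Rightarrow> 'e::field"
  assumes S: "cring (ring_on S)" and "finite J" "r < card J" "\<And>j i. j \<in> J \<Longrightarrow> i < r \<Longrightarrow> v j i \<in> S"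
  shows "\<exists>y. (\<forall>j\<in>J. y j \<in> S) \<and> (\<exists>j\<in>J. y j \<noteq> 0) \<and> (\<forall>i<r. (\<Sum>j\<in>J. y j * v j i) = 0)"
  using assms(2-)
proof (induction r arbitrary: J v)
  case 0
  then show ?case using ring_on_closed(2)[OF S] by (intro exI[of _ "\<lambda>_. 1"]) (auto simp: card_gt_0_iff)
next
  case (Suc r)
  note Sc = ring_on_closed[OF S]
  show ?case
  proof (cases "\<forall>j\<in>J. v j r = 0")
    case True
    obtain y where "\<forall>j\<in>J. y j \<in> S" "\<exists>j\<in>J. y j \<noteq> 0" "\<forall>i<r. (\<Sum>j\<in>J. y j * v j i) = 0"
      using Suc.IH[of J v] Suc.prems by auto
    then show ?thesis using True by (intro exI[of _ y]) (auto simp: less_Suc_eq)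
  next
    case False
    then obtain k where k: "k \<in> J" "v k r \<noteq> 0" by blast
    define J' where "J' = J - {k}"
    have J: "J = insert k J'" "k \<notin> J'" "finite J'" using k Suc.prems by (auto simp: J'_def)
    define w where "w j i = v k r * v j i - v j r * v k i" for j i
    have "r < card J'" using Suc.prems(2) J by simp
    moreover have "w j i \<in> S" if "j \<in> J'" "i < r" for j i
      unfolding w_def using Suc.prems(3) that J k by (intro Sc) auto
    ultimately obtain y where y: "\<forall>j\<in>J'. y j \<in> S" "\<exists>j\<in>J'. y j \<noteq> 0" "\<forall>i<r. (\<Sum>j\<in>J'. y j * w j i) = 0"
      using Suc.IH[of J' w] J(3) by auto
    \<comment> \<open>A relation among the \<open>w j\<close> becomes one among the
      \<open>v j\<close>. The coefficient at \<open>k\<close> is chosen to cancel coordinate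
      \<open>r\<close>, and the relation stays nontrivial because \<open>v k r\<close> is
      nonzero.\<close>
    define y' where "y' j = (if j = k then - (\<Sum>j\<in>J'. y j * v j r) else v k r * y j)" for j
    have y'J: "y' j = v k r * y j" if "j \<in> J'" for j using that J by (auto simp: y'_def)
    have sum_in: "(\<Sum>j\<in>A. g j) \<in> S" if "\<And>j. j \<in> A \<Longrightarrow> g j \<in> S" for A and g :: "'j \<Rightarrow> 'e"
      using that by (induction A rule: infinite_finite_induct) (auto simp: Sc)
    have sum: "(\<Sum>j\<in>J. y' j * v j i) = (\<Sum>j\<in>J'. y j * w j i)" for i
    proof -
      have "(\<Sum>j\<in>J. y' j * v j i) = y' k * v k i + (\<Sum>j\<in>J'. v k r * y j * v j i)"
        using J y'J by simp
      also have "\<dots> = (\<Sum>j\<in>J'. v k r * y j * v j i - y j * v j r * v k i)"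
        by (simp add: y'_def sum_subtractf sum_distrib_right)
      also have "\<dots> = (\<Sum>j\<in>J'. y j * w j i)"
        by (simp add: w_def algebra_simps)
      finally show ?thesis .
    qed
    show ?thesis
    proof (intro exI[of _ y'] conjI ballI allI impI)
      fix j assume "j \<in> J"
      moreover have "(\<Sum>j\<in>J'. y j * v j r) \<in> S" using y(1) Suc.prems(3) J by (intro sum_in Sc) auto
      ultimately show "y' j \<in> S" using y(1) Suc.prems(3)[OF k(1)] J by (auto simp: y'_def Sc)
    next
      show "\<exists>j\<in>J. y' j \<noteq> 0" using y(2) y'J k(2) J by auto
    next
      fix i assume "i < Suc r"
      moreover have "(\<Sum>j\<in>J'. y j * w j r) = 0" by (simp add: w_def mult.commute)
      ultimately show "(\<Sum>j\<in>J. y' j * v j i) = 0" using y(3) by (auto simp: sum less_Suc_eq)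
    qed
  qed
qed

section \<open>Torsion-freeness, finite generation and rank of locally free modules\<close>

definition torsion_free_module :: "'e::field set \<Rightarrow> ('e, 'm) module \<Rightarrow> bool" where
  "torsion_free_module R M \<longleftrightarrow>
    (\<forall>a\<in>R. \<forall>x\<in>carrier M. a \<odot>\<^bsub>M\<^esub> x = \<zero>\<^bsub>M\<^esub> \<longrightarrow> a = 0 \<or> x = \<zero>\<^bsub>M\<^esub>)"

text \<open>Families indexed by naturals are used rather than sets of vectors, so that repetitions
  count: the iterates \<open>(u ^^ j) z\<close> of an endomorphism may coincide.\<close>

definition rank_le :: "'e::field set \<Rightarrow> ('e, 'm) module \<Rightarrow> nat \<Rightarrow> bool" where
  "rank_le R M r \<longleftrightarrow>
    (\<forall>J x. finite (J :: nat set) \<longrightarrow> r < card J \<longrightarrow> x \<in> J \<rightarrow> carrier M \<longrightarrow>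
      (\<exists>y. y \<in> J \<rightarrow> R \<and> (\<exists>j\<in>J. y j \<noteq> 0) \<and> (\<Oplus>\<^bsub>M\<^esub> j\<in>J. y j \<odot>\<^bsub>M\<^esub> x j) = \<zero>\<^bsub>M\<^esub>))"

text \<open>The annihilator of a nonzero \<open>x\<close> lies in a prime \<open>P\<close>. Near
  \<open>P\<close>, the relation forces \<open>a = 0\<close> or all coordinates of \<open>x\<close>
  to vanish, and the latter would put a power of \<open>s\<close>, which is outside
  \<open>P\<close>, into the annihilator.\<close>

lemma locally_free_torsion_free:
  assumes lf: "locally_free R M r"
  shows "torsion_free_module R M"
  unfolding torsion_free_module_def
proof (intro ballI impI)
  fix a x assume a: "a \<in> R" and x: "x \<in> carrier M" and ax: "a \<odot>\<^bsub>M\<^esub> x = \<zero>\<^bsub>M\<^esub>"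
  interpret M: module "ring_on R" M using lf by (simp add: locally_free_def)
  have R: "cring (ring_on R)" by (rule M.is_cring)
  note Rc = ring_on_closed[OF R]
  define I where "I = {c \<in> R. c \<odot>\<^bsub>M\<^esub> x = \<zero>\<^bsub>M\<^esub>}"
  have I: "ideal I (ring_on R)"
    unfolding ideal_ring_on_iff[OF R]
  proof (intro conjI ballI)
    show "I \<subseteq> R" "0 \<in> I" using Rc(1) M.smult_l_null[OF x] by (auto simp: I_def)
    show "b + c \<in> I" if "b \<in> I" "c \<in> I" for b c
      using that Rc(3) M.smult_l_distr[of b c x] x by (auto simp: I_def)
    show "b * c \<in> I" if "b \<in> R" "c \<in> I" for b c
      using that Rc(4) M.smult_assoc1[of b c x] x by (auto simp: I_def)
  qed
  show "a = 0 \<or> x = \<zero>\<^bsub>M\<^esub>"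
  proof (cases "1 \<in> I")
    case True
    then show ?thesis using M.smult_one[of x] x by (auto simp: I_def)
  next
    case False
    then obtain P where P: "primeideal P (ring_on R)" "I \<subseteq> P"
      using proper_ideal_subset_prime[OF R I] by blast
    obtain s ys \<kappa> where s: "s \<in> R" "s \<notin> P" and "local_coordinates R M r s ys \<kappa>"
      using locally_free_coordinates[OF lf P(1)] by blast
    then interpret local_coordinates R M r s ys \<kappa> by blast
    have "a = 0 \<or> (\<forall>i<r. \<kappa> x i = 0)" using \<kappa>_smult[OF a x] \<kappa>_zero ax by auto
    moreover have "\<not> (\<forall>i<r. \<kappa> x i = 0)"
    proof
      assume "\<forall>i<r. \<kappa> x i = 0"
      then obtain n where "s ^ n \<odot>\<^bsub>M\<^esub> x = \<zero>\<^bsub>M\<^esub>" using \<kappa>_kernel[OF x] by blast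
      then have "s ^ n \<in> I" using Rc(7)[OF s(1)] by (simp add: I_def)
      then show False using P prime_power_notin[OF R P(1) s] by blast
    qed
    ultimately show ?thesis by blast
  qed
qed

text \<open>The elements \<open>s\<close> such that \<open>M\<close> is finitely generated up to
  powers of \<open>s\<close> form an ideal. Local coordinates show that it lies in no prime, so it
  contains 1. This takes the place of choosing a finite subcover of the spectrum.\<close>

lemma locally_free_finitely_generated:
  assumes lf: "locally_free R M r"
  obtains ys where "set ys \<subseteq> carrier M" "carrier M = list_span (ring_on R) M ys"
proof -
  interpret M: module "ring_on R" M using lf by (simp add: locally_free_def)
  have R: "cring (ring_on R)" by (rule M.is_cring)
  note Rc = ring_on_closed[OF R]
  define good where "good s ys \<longleftrightarrow> set ys \<subseteq> carrier M \<and>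
    (\<forall>x\<in>carrier M. \<exists>n. s ^ n \<odot>\<^bsub>M\<^esub> x \<in> list_span (ring_on R) M ys)" for s ys
  define I where "I = {s \<in> R. \<exists>ys. good s ys}"
  have "ideal I (ring_on R)"
    unfolding ideal_ring_on_iff[OF R]
  proof (intro conjI ballI)
    show "I \<subseteq> R" by (auto simp: I_def)
    \<comment> \<open>The exponent must be positive here, since \<open>0 ^ 0 = 1\<close>.\<close>
    have "0 ^ 1 \<odot>\<^bsub>M\<^esub> x \<in> list_span (ring_on R) M []" if "x \<in> carrier M" for x
      using M.smult_l_null[of x] that by simp
    then have "good 0 []" unfolding good_def by (metis empty_set empty_subsetI)
    then show "0 \<in> I" using Rc(1) by (auto simp: I_def)
    show "a * s \<in> I" if "a \<in> R" "s \<in> I" for a s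
    proof -
      obtain ys where ys: "good s ys" "s \<in> R" using \<open>s \<in> I\<close> by (auto simp: I_def)
      have "\<exists>n. (a * s) ^ n \<odot>\<^bsub>M\<^esub> x \<in> list_span (ring_on R) M ys" if x: "x \<in> carrier M" for x
      proof -
        obtain n where n: "s ^ n \<odot>\<^bsub>M\<^esub> x \<in> list_span (ring_on R) M ys" using ys x unfolding good_def by blast
        have "(a * s) ^ n \<odot>\<^bsub>M\<^esub> x = a ^ n \<odot>\<^bsub>M\<^esub> (s ^ n \<odot>\<^bsub>M\<^esub> x)"
          using M.smult_assoc1[of "a ^ n" "s ^ n" x] Rc(7) \<open>a \<in> R\<close> ys(2) x by (simp add: power_mult_distrib)
        then show ?thesis
          using M.list_span_smult[OF _ _ n, of "a ^ n"] ys Rc(7) \<open>a \<in> R\<close>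
          by (intro exI[of _ n]) (simp add: good_def)
      qed
      then have "good (a * s) ys" using ys by (auto simp: good_def)
      then show ?thesis using Rc(4) ys(2) \<open>a \<in> R\<close> by (auto simp: I_def)
    qed
    show "s + t \<in> I" if "s \<in> I" "t \<in> I" for s t
    proof -
      obtain ys where ys: "good s ys" "s \<in> R" using \<open>s \<in> I\<close> by (auto simp: I_def)
      obtain zs where zs: "good t zs" "t \<in> R" using \<open>t \<in> I\<close> by (auto simp: I_def)
      have yzs: "set (ys @ zs) \<subseteq> carrier M" using ys zs by (auto simp: good_def)
      have "\<exists>n. (s + t) ^ n \<odot>\<^bsub>M\<^esub> x \<in> list_span (ring_on R) M (ys @ zs)" if x: "x \<in> carrier M" for x
      proof -
        define K where "K = {c \<in> R. c \<odot>\<^bsub>M\<^esub> x \<in> list_span (ring_on R) M (ys @ zs)}"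
        obtain n where "s ^ n \<odot>\<^bsub>M\<^esub> x \<in> list_span (ring_on R) M ys" using ys x unfolding good_def by blast
        then have n: "s ^ n \<in> K"
          using M.list_span_mono[of ys "ys @ zs"] yzs Rc(7) ys by (auto simp: K_def)
        obtain m where "t ^ m \<odot>\<^bsub>M\<^esub> x \<in> list_span (ring_on R) M zs" using zs x unfolding good_def by blast
        then have m: "t ^ m \<in> K"
          using M.list_span_mono[of zs "ys @ zs"] yzs Rc(7) zs by (auto simp: K_def)
        have Kadd: "a + b \<in> K" if "a \<in> K" "b \<in> K" for a b
          using that M.smult_l_distr[of a b x] x M.list_span_add[OF yzs] Rc(3) by (auto simp: K_def)
        have Kmul: "a * b \<in> K" if "a \<in> R" "b \<in> K" for a b
          using that M.smult_assoc1[of a b x] x M.list_span_smult[OF yzs, of a] Rc(4) by (auto simp: K_def)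
        have K0: "0 \<in> K" using Kmul[OF Rc(1) n] by simp
        have ofn: "of_nat k \<in> R" for k using Rc by (induction k) auto
        \<comment> \<open>In each binomial term the exponent of \<open>s\<close> is at least
          \<open>n\<close> or that of \<open>t\<close> is at least \<open>m\<close>, so every term
          lies in \<open>K\<close>.\<close>
        have "(s + t) ^ (n + m) = (\<Sum>k\<le>n + m. of_nat ((n + m) choose k) * s ^ k * t ^ (n + m - k))"
          by (rule binomial_ring)
        also have "\<dots> \<in> K"
        proof -
          have "of_nat ((n + m) choose k) * s ^ k * t ^ (n + m - k) \<in> K" for k
          proof (cases "n \<le> k")
            case True
            then have "of_nat ((n + m) choose k) * s ^ k * t ^ (n + m - k)
                = (of_nat ((n + m) choose k) * s ^ (k - n) * t ^ (n + m - k)) * s ^ n"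
              by (simp flip: power_add)
            then show ?thesis using Kmul[OF _ n] Rc(4,7) ofn ys zs by metis
          next
            case False
            then have "t ^ (n + m - k) = t ^ (n - k) * t ^ m" by (simp flip: power_add)
            then have "of_nat ((n + m) choose k) * s ^ k * t ^ (n + m - k)
                = (of_nat ((n + m) choose k) * s ^ k * t ^ (n - k)) * t ^ m" by simp
            then show ?thesis using Kmul[OF _ m] Rc(4,7) ofn ys zs by metis
          qed
          note term_in = this
          have "sum g A \<in> K" if "\<And>k. g k \<in> K" for g and A :: "nat set"
            using that by (induction A rule: infinite_finite_induct) (auto simp: K0 Kadd)
          from this[OF term_in] show ?thesis .
        qed
        finally show ?thesis by (auto simp: K_def)
      qed
      then have "good (s + t) (ys @ zs)" using yzs by (auto simp: good_def)
      then show ?thesis using Rc(3) ys zs by (auto simp: I_def)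
    qed
  qed
  have "1 \<in> I"
  proof (rule ccontr)
    assume "1 \<notin> I"
    then obtain P where P: "primeideal P (ring_on R)" "I \<subseteq> P"
      using proper_ideal_subset_prime[OF R \<open>ideal I (ring_on R)\<close>] by blast
    obtain s ys \<kappa> where s: "s \<in> R" "s \<notin> P" and "local_coordinates R M r s ys \<kappa>"
      using locally_free_coordinates[OF lf P(1)] by blast
    then interpret local_coordinates R M r s ys \<kappa> by blast
    have "good s ys" using ys_closed generators by (simp add: good_def)
    then show False using P(2) s by (auto simp: I_def)
  qed
  then obtain ys where ys: "good 1 ys" by (auto simp: I_def)
  \<comment> \<open>For \<open>s = 1\<close> the unknown exponent is harmless: every power of 1 acts
    as the identity.\<close>
  then have "x \<in> list_span (ring_on R) M ys" if "x \<in> carrier M" for x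
    using that M.smult_one[of x] by (auto simp: good_def)
  then show ?thesis using that[of ys] ys M.list_span_closed[of ys] by (auto simp: good_def)
qed

text \<open>Local coordinates at a single prime suffice; one above the zero ideal is taken. A
  dependence of the coordinate vectors over \<open>R[1/s]\<close> becomes one in \<open>M\<close>
  after clearing denominators with \<open>s ^ n\<close> and killing the remaining error with
  \<open>s ^ m\<close>.\<close>

lemma locally_free_rank_le:
  assumes lf: "locally_free R M r"
  shows "rank_le R M r"
  unfolding rank_le_def
proof (intro allI impI)
  fix J :: "nat set" and x assume J: "finite J" "r < card J" and x: "x \<in> J \<rightarrow> carrier M"
  interpret M: module "ring_on R" M using lf by (simp add: locally_free_def)
  have R: "cring (ring_on R)" by (rule M.is_cring)
  note Rc = ring_on_closed[OF R]
  have "ideal {0} (ring_on R)" "1 \<notin> {0 :: 'a}" using Rc(1) by (auto simp: ideal_ring_on_iff[OF R])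
  then obtain P where P: "primeideal P (ring_on R)" "{0} \<subseteq> P"
    using proper_ideal_subset_prime[OF R] by blast
  obtain s ys \<kappa> where s: "s \<in> R" "s \<notin> P" and "local_coordinates R M r s ys \<kappa>"
      using locally_free_coordinates[OF lf P(1)] by blast
    then interpret local_coordinates R M r s ys \<kappa> by blast
  have s0: "s \<noteq> 0" using P(2) s(2) by auto
  obtain y where y: "\<forall>j\<in>J. y j \<in> localized R s" "\<exists>j\<in>J. y j \<noteq> 0"
    "\<forall>i<r. (\<Sum>j\<in>J. y j * \<kappa> (x j) i) = 0"
    using linear_dependence[OF cring_localized J, of "\<lambda>j. \<kappa> (x j)"] \<kappa>_closed x by blast
  have "\<forall>j. \<exists>k. j \<in> J \<longrightarrow> (\<forall>n\<ge>k. s ^ n * y j \<in> R)"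
    using localized_denominator[OF R s(1) s0] y(1) by metis
  then obtain k where k: "\<And>j n. j \<in> J \<Longrightarrow> k j \<le> n \<Longrightarrow> s ^ n * y j \<in> R" by metis
  \<comment> \<open>The sum dominates every \<open>k j\<close>, so one exponent clears all
    denominators.\<close>
  define n where "n = (\<Sum>j\<in>J. k j)"
  have n: "s ^ n * y j \<in> R" if "j \<in> J" for j
    using k[OF that] member_le_sum[of j J k] J(1) that by (simp add: n_def)
  define w where "w = (\<Oplus>\<^bsub>M\<^esub> j\<in>J. (s ^ n * y j) \<odot>\<^bsub>M\<^esub> x j)"
  have xc: "x j \<in> carrier M" if "j \<in> J" for j using x that by auto
  have w: "w \<in> carrier M" unfolding w_def using n xc by (intro M.finsum_closed) auto
  have "\<kappa> w i = 0" if "i < r" for i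
  proof -
    have "\<kappa> w i = (\<Sum>j\<in>J. s ^ n * (y j * \<kappa> (x j) i))"
      unfolding w_def using n xc J(1) that by (subst \<kappa>_finsum) (auto simp: \<kappa>_smult mult.assoc)
    also have "\<dots> = 0" using y(3) that by (simp flip: sum_distrib_left)
    finally show ?thesis .
  qed
  then obtain m where m: "s ^ m \<odot>\<^bsub>M\<^esub> w = \<zero>\<^bsub>M\<^esub>" using \<kappa>_kernel[OF w] by blast
  have sm: "s ^ m \<in> R" by (rule Rc(7)[OF s(1)])
  have "(\<Oplus>\<^bsub>M\<^esub> j\<in>J. (s ^ m * (s ^ n * y j)) \<odot>\<^bsub>M\<^esub> x j) = (\<Oplus>\<^bsub>M\<^esub> j\<in>J. s ^ m \<odot>\<^bsub>M\<^esub> ((s ^ n * y j) \<odot>\<^bsub>M\<^esub> x j))"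
  proof (rule M.finsum_cong')
    show "(s ^ m * (s ^ n * y j)) \<odot>\<^bsub>M\<^esub> x j = s ^ m \<odot>\<^bsub>M\<^esub> ((s ^ n * y j) \<odot>\<^bsub>M\<^esub> x j)" if "j \<in> J" for j
      using M.smult_assoc1[of "s ^ m" "s ^ n * y j" "x j"] sm n[OF that] xc[OF that] by simp
    show "(\<lambda>j. s ^ m \<odot>\<^bsub>M\<^esub> ((s ^ n * y j) \<odot>\<^bsub>M\<^esub> x j)) \<in> J \<rightarrow> carrier M"
      using n xc sm by auto
  qed simp
  also have "\<dots> = s ^ m \<odot>\<^bsub>M\<^esub> w"
    unfolding w_def using n xc sm J(1) by (intro M.finsum_smult_ldistr[symmetric]) auto
  finally show "\<exists>y. y \<in> J \<rightarrow> R \<and> (\<exists>j\<in>J. y j \<noteq> 0) \<and> (\<Oplus>\<^bsub>M\<^esub> j\<in>J. y j \<odot>\<^bsub>M\<^esub> x j) = \<zero>\<^bsub>M\<^esub>"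
    using m n sm y(2) s0 Rc(4) by (intro exI[of _ "\<lambda>j. s ^ m * (s ^ n * y j)"]) auto
qed

section \<open>Finite residue rings\<close>

text \<open>Values at \<open>x\<close> of the polynomials over \<open>k\<close> of degree at most
  \<open>D\<close>, in Horner form.\<close>

fun poly_values :: "'e::field set \<Rightarrow> 'e \<Rightarrow> nat \<Rightarrow> 'e set" where
  "poly_values k x 0 = k"
| "poly_values k x (Suc D) = {a + x * w | a w. a \<in> k \<and> w \<in> poly_values k x D}"

text \<open>The layer of degree at most \<open>D\<close> in the \<open>k[x]\<close>-span of
  \<open>es\<close>. Its size is at most exponential in \<open>D\<close>, with a base depending only
  on the sizes of \<open>k\<close> and \<open>es\<close>; this growth rate is what the counting
  argument exploits.\<close>

fun bounded_span :: "'e::field set \<Rightarrow> 'e \<Rightarrow> 'e list \<Rightarrow> nat \<Rightarrow> 'e set" where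
  "bounded_span k x [] D = {0}"
| "bounded_span k x (e # es) D =
    {w * e + z | w z. w \<in> poly_values k x D \<and> z \<in> bounded_span k x es D}"

locale finite_constants =
  fixes k :: "'e::field set" and x :: 'e
  assumes finite_k: "finite k" and cring_k: "cring (ring_on k)"
begin

lemmas k_closed = ring_on_closed[OF cring_k]

abbreviation "W \<equiv> poly_values k x"
abbreviation "V \<equiv> bounded_span k x"

lemma W_SucI: "a \<in> k \<Longrightarrow> w \<in> W D \<Longrightarrow> a + x * w \<in> W (Suc D)"
  by auto

lemma V_ConsI: "w \<in> W D \<Longrightarrow> z \<in> V es D \<Longrightarrow> w * e + z \<in> V (e # es) D"
  by auto

text \<open>\<open>Suc D\<close> is the number of coefficients. Only an upper bound is claimed, as
  distinct polynomials may take the same value at \<open>x\<close>.\<close>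

lemma W_finite: "finite (W D) \<and> card (W D) \<le> card k ^ Suc D"
proof (induction D)
  case (Suc D)
  have "W (Suc D) = (\<lambda>(a, w). a + x * w) ` (k \<times> W D)" by auto
  moreover have "card ((\<lambda>(a, w). a + x * w) ` (k \<times> W D)) \<le> card (k \<times> W D)"
    using Suc finite_k by (intro card_image_le) auto
  moreover have "card (k \<times> W D) \<le> card k ^ Suc (Suc D)"
    using Suc finite_k mult_le_mono2[of "card (W D)" "card k ^ Suc D" "card k"]
    by (simp add: card_cartesian_product)
  moreover have "finite (k \<times> W D)" using Suc finite_k by simp
  ultimately show ?case by (simp only: finite_imageI simp_thms)
qed (simp add: finite_k)

lemma W_zero: "0 \<in> W D"
  using W_SucI[of 0 0] by (induction D) (simp_all add: k_closed)

lemma W_mono: "D \<le> D' \<Longrightarrow> W D \<subseteq> W D'"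
proof (induction rule: dec_induct)
  case (step n)
  have "w \<in> W (Suc n)" if "w \<in> W n" for w n
    using that
  proof (induction n arbitrary: w)
    case 0
    then show ?case using W_SucI[of w 0 0] k_closed(1) by simp
  next
    case (Suc n)
    then obtain a w' where "w = a + x * w'" "a \<in> k" "w' \<in> W n" by auto
    then show ?case using W_SucI[OF _ Suc.IH] by metis
  qed
  then show ?case using step by blast
qed simp

lemma W_add: "u \<in> W D \<Longrightarrow> v \<in> W D \<Longrightarrow> u + v \<in> W D"
proof (induction D arbitrary: u v)
  case (Suc D)
  then obtain a w b w' where "u = a + x * w" "v = b + x * w'" "a \<in> k" "b \<in> k" "w \<in> W D" "w' \<in> W D"
    by auto
  moreover from this have "u + v = (a + b) + x * (w + w')" by (simp add: algebra_simps)
  ultimately show ?case using W_SucI[OF k_closed(3) Suc.IH] by metis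
qed (simp add: k_closed)

lemma W_const_mult: "c \<in> k \<Longrightarrow> w \<in> W D \<Longrightarrow> c * w \<in> W D"
proof (induction D arbitrary: w)
  case (Suc D)
  then obtain a w' where "w = a + x * w'" "a \<in> k" "w' \<in> W D" by auto
  moreover from this have "c * w = c * a + x * (c * w')" by (simp add: algebra_simps)
  ultimately show ?case using W_SucI[OF k_closed(4) Suc.IH] Suc.prems(1) by metis
qed (simp add: k_closed)

lemma W_x_mult: "w \<in> W D \<Longrightarrow> x * w \<in> W (Suc D)"
  using W_SucI[OF k_closed(1), of w] by simp

lemma W_mult: "u \<in> W D \<Longrightarrow> v \<in> W D' \<Longrightarrow> u * v \<in> W (D + D')"
proof (induction D arbitrary: u)
  case (Suc D)
  then obtain a w where 1: "u = a + x * w" "a \<in> k" "w \<in> W D" by auto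
  have "a * v \<in> W (Suc D + D')"
    using W_mono[of D' "Suc D + D'"] W_const_mult[OF 1(2) Suc.prems(2)] by (meson le_add2 subsetD)
  moreover have "x * (w * v) \<in> W (Suc D + D')" using W_x_mult[OF Suc.IH[OF 1(3) Suc.prems(2)]] by simp
  ultimately show ?case using W_add[of "a * v" "Suc D + D'" "x * (w * v)"]
    by (simp only: 1(1) distrib_right mult.assoc)
qed (simp add: W_const_mult)

lemma W_one: "1 \<in> W D"
  using W_mono[of 0 D] k_closed(2) by auto

lemma W_power: "u \<in> W D \<Longrightarrow> u ^ n \<in> W (n * D)"
  using W_mult by (induction n) (simp_all add: k_closed)

lemma W_uminus: "w \<in> W D \<Longrightarrow> - w \<in> W D"
  using W_const_mult[OF k_closed(5)[OF k_closed(2)], of w D] by simp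

lemma V_finite: "finite (V es D) \<and> card (V es D) \<le> (card k ^ Suc D) ^ length es"
proof (induction es)
  case (Cons e es)
  have "V (e # es) D = (\<lambda>(w, z). w * e + z) ` (W D \<times> V es D)" by auto
  moreover have "card ((\<lambda>(w, z). w * e + z) ` (W D \<times> V es D)) \<le> card (W D \<times> V es D)"
    using Cons W_finite[of D] by (intro card_image_le) auto
  moreover have "card (W D \<times> V es D) \<le> (card k ^ Suc D) ^ length (e # es)"
    using Cons W_finite[of D] mult_le_mono[of "card (W D)" "card k ^ Suc D" "card (V es D)"]
    by (simp add: card_cartesian_product)
  moreover have "finite (W D \<times> V es D)" using Cons W_finite[of D] by simp
  ultimately show ?case by (simp only: finite_imageI simp_thms)
qed simp

lemma V_zero: "0 \<in> V es D"
  using V_ConsI[OF W_zero, of 0] by (induction es) auto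

lemma V_add: "y \<in> V es D \<Longrightarrow> z \<in> V es D \<Longrightarrow> y + z \<in> V es D"
proof (induction es arbitrary: y z)
  case (Cons e es)
  then obtain w y' w' z' where "y = w * e + y'" "z = w' * e + z'" "w \<in> W D" "w' \<in> W D"
    "y' \<in> V es D" "z' \<in> V es D" by auto
  moreover from this have "y + z = (w + w') * e + (y' + z')" by (simp add: algebra_simps)
  ultimately show ?case using V_ConsI[OF W_add Cons.IH] by metis
qed simp

lemma V_mult: "u \<in> W D' \<Longrightarrow> z \<in> V es D \<Longrightarrow> u * z \<in> V es (D' + D)"
proof (induction es arbitrary: z)
  case (Cons e es)
  then obtain w z' where "z = w * e + z'" "w \<in> W D" "z' \<in> V es D" by auto
  moreover from this have "u * z = (u * w) * e + u * z'" by (simp add: algebra_simps)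
  ultimately show ?case using V_ConsI[OF W_mult Cons.IH] Cons.prems(1) by metis
qed simp

lemma V_superset: "e \<in> set es \<Longrightarrow> e \<in> V es D"
proof (induction es)
  case (Cons f es)
  show ?case
  proof (cases "e = f")
    case True
    then show ?thesis using V_ConsI[OF W_one V_zero, of e] by simp
  next
    case False
    then show ?thesis using V_ConsI[OF W_zero, of e] Cons by simp
  qed
qed simp

text \<open>Membership in the \<open>k(x)\<close>-span of \<open>es\<close>, with one degree bound
  for the common denominator and all numerators.\<close>

definition den :: "'e list \<Rightarrow> 'e \<Rightarrow> bool" where
  "den es z \<longleftrightarrow> (\<exists>D \<delta>. \<delta> \<in> W D \<and> \<delta> \<noteq> 0 \<and> \<delta> * z \<in> V es D)"

lemma den_add: "den es y \<Longrightarrow> den es z \<Longrightarrow> den es (y + z)"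
  unfolding den_def
proof (elim exE conjE)
  fix D \<delta> D' \<delta>' assume 1: "\<delta> \<in> W D" "\<delta> \<noteq> 0" "\<delta> * y \<in> V es D" "\<delta>' \<in> W D'" "\<delta>' \<noteq> 0" "\<delta>' * z \<in> V es D'"
  have "\<delta>' * (\<delta> * y) \<in> V es (D + D')" using V_mult[OF 1(4,3)] by (simp add: add.commute)
  from V_add[OF this V_mult[OF 1(1,6)]] have "\<delta> * \<delta>' * (y + z) \<in> V es (D + D')" by (simp add: algebra_simps)
  then show "\<exists>D \<delta>. \<delta> \<in> W D \<and> \<delta> \<noteq> 0 \<and> \<delta> * (y + z) \<in> V es D"
    using 1 W_mult[OF 1(1,4)] by (intro exI[of _ "D + D'"] exI[of _ "\<delta> * \<delta>'"]) simp
qed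

text \<open>Here \<open>g\<close> is a fraction with denominator \<open>d\<close>, which gets
  multiplied to the denominator of \<open>z\<close>. Together with \<open>den_add\<close> this makes
  the elements satisfying \<open>den es\<close> a \<open>k(x)\<close>-subspace.\<close>

lemma den_mult:
  assumes "d \<in> W D" "d \<noteq> 0" "d * g \<in> W D" "den es z"
  shows "den es (g * z)"
proof -
  obtain D' \<delta> where 1: "\<delta> \<in> W D'" "\<delta> \<noteq> 0" "\<delta> * z \<in> V es D'" using assms by (auto simp: den_def)
  have "d * \<delta> * (g * z) \<in> V es (D + D')" using V_mult[OF assms(3) 1(3)] by (simp add: mult_ac)
  then show ?thesis unfolding den_def
    using 1 W_mult[OF assms(1) 1(1)] assms by (intro exI[of _ "D + D'"] exI[of _ "d * \<delta>"]) simp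
qed

lemma den_zero: "den es 0"
  unfolding den_def by (intro exI[of _ 0] exI[of _ 1]) (use W_one[of 0] V_zero[of es 0] in simp)

lemma den_basis: "e \<in> set es \<Longrightarrow> den es e"
  unfolding den_def by (intro exI[of _ 0] exI[of _ 1]) (use W_one[of 0] V_superset[of e es 0] in simp)

lemma common_denominator:
  assumes "finite S" "\<And>z. z \<in> S \<Longrightarrow> den es z"
  shows "\<exists>D \<delta>. \<delta> \<in> W D \<and> \<delta> \<noteq> 0 \<and> (\<forall>z\<in>S. \<delta> * z \<in> V es D)"
  using assms
proof (induction S rule: finite_induct)
  case empty
  show ?case by (intro exI[of _ 0] exI[of _ 1]) (use W_one[of 0] in simp)
next
  case (insert y S)
  obtain D \<delta> where 1: "\<delta> \<in> W D" "\<delta> \<noteq> 0" "\<forall>z\<in>S. \<delta> * z \<in> V es D" using insert by blast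
  obtain D' \<delta>' where 2: "\<delta>' \<in> W D'" "\<delta>' \<noteq> 0" "\<delta>' * y \<in> V es D'" using insert.prems[of y] by (auto simp: den_def)
  have "\<delta> * \<delta>' * y \<in> V es (D + D')" using V_mult[OF 1(1) 2(3)] by (simp add: mult_ac)
  moreover have "\<delta> * \<delta>' * z \<in> V es (D + D')" if "z \<in> S" for z
    using V_mult[OF 2(1), of "\<delta> * z" es D] 1(3) that by (simp add: mult_ac add.commute)
  ultimately show ?case
    using 1 2 W_mult[OF 1(1) 2(1)] by (intro exI[of _ "D + D'"] exI[of _ "\<delta> * \<delta>'"]) auto
qed

text \<open>If \<open>S\<close> consists of pairwise incongruent elements modulo \<open>a\<close>, then the \<open>card S ^ J\<close> sums
  \<open>\<Sum>j<J. y\<^sub>j a\<^sup>j\<close> with \<open>y\<^sub>j \<in> S\<close> are distinct, but their number grows at most like \<open>Q ^ J\<close>, where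
  \<open>Q\<close> only depends on \<open>a\<close>.\<close>

fun expansions :: "'e \<Rightarrow> 'e set \<Rightarrow> nat \<Rightarrow> 'e set" where
  "expansions a S 0 = {0}"
| "expansions a S (Suc J) = {y + a * p | y p. y \<in> S \<and> p \<in> expansions a S J}"

definition incongruent :: "'e set \<Rightarrow> 'e \<Rightarrow> 'e set \<Rightarrow> bool" where
  "incongruent R a S \<longleftrightarrow> finite S \<and> S \<subseteq> R \<and>
    (\<forall>y\<in>S. \<forall>z\<in>S. (\<exists>b\<in>R. y - z = a * b) \<longrightarrow> y = z)"

lemma incongruent_bounded:
  assumes all: "\<And>z. den es z" and R: "cring (ring_on R)" and a: "a \<in> R" "a \<noteq> 0"
  shows "\<exists>Q. \<forall>S. incongruent R a S \<longrightarrow> card S \<le> Q"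
proof -
  note Rc = ring_on_closed[OF R]
  \<comment> \<open>Multiplication by \<open>a\<close> maps each generator back into the span up to
    the denominator \<delta>. Hence it raises degrees by a constant \<open>c\<close> that does not
    depend on the element multiplied.\<close>
  obtain c \<delta> where \<delta>: "\<delta> \<in> W c" "\<delta> \<noteq> 0" "\<And>e. e \<in> set es \<Longrightarrow> \<delta> * (a * e) \<in> V es c"
    using common_denominator[of "(*) a ` set es" es] all by auto
  have step: "\<delta> * (a * z) \<in> V es (c + D)" if "z \<in> V us D" "set us \<subseteq> set es" for z us D
    using that
  proof (induction us arbitrary: z)
    case (Cons u us)
    then obtain w z' where 1: "z = w * u + z'" "w \<in> W D" "z' \<in> V us D" by auto
    have "w * (\<delta> * (a * u)) \<in> V es (c + D)"
      using V_mult[OF 1(2) \<delta>(3)[of u]] Cons.prems by (simp add: add.commute)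
    from V_add[OF this Cons.IH[OF 1(3)]] show ?case using Cons.prems by (simp add: 1 algebra_simps)
  qed (simp add: V_zero)
  \<comment> \<open>The factor by which the bound on the size of
    \<open>bounded_span k x es D\<close> grows when \<open>D\<close> is raised by
    \<open>c\<close>.\<close>
  define Q where "Q = (card k ^ c) ^ length es"
  have kpos: "card k > 0" using finite_k k_closed(1) by (auto simp: card_gt_0_iff)
  have main: "card S \<le> Q" if S: "finite S" "S \<subseteq> R"
    and inc: "\<And>y z b. y \<in> S \<Longrightarrow> z \<in> S \<Longrightarrow> b \<in> R \<Longrightarrow> y - z = a * b \<Longrightarrow> y = z" for S
  proof -
    let ?P = "expansions a S"
    have P: "?P J \<subseteq> R \<and> finite (?P J) \<and> card (?P J) = card S ^ J" for J
    proof (induction J)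
      case (Suc J)
      have im: "?P (Suc J) = (\<lambda>(y, p). y + a * p) ` (S \<times> ?P J)" by auto
      have "inj_on (\<lambda>(y, p). y + a * p) (S \<times> ?P J)"
      proof (rule inj_onI, clarsimp)
        fix y p y' p' assume 1: "y \<in> S" "y' \<in> S" "p \<in> ?P J" "p' \<in> ?P J" "y + a * p = y' + a * p'"
        then have "y - y' = a * (p' - p)" by (simp add: algebra_simps)
        moreover have "p' - p \<in> R" using 1 Suc Rc(6) by blast
        ultimately have "y = y'" using inc 1 by blast
        then show "y = y' \<and> p = p'" using 1 a by simp
      qed
      then have "card (?P (Suc J)) = card S ^ Suc J" unfolding im
        using Suc by (simp add: card_image card_cartesian_product)
      moreover have "y + a * p \<in> R" if "y \<in> S" "p \<in> ?P J" for y p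
        using that Suc S(2) by (intro Rc a) auto
      then have "?P (Suc J) \<subseteq> R" by auto
      moreover have "finite (?P (Suc J))" unfolding im using Suc S by simp
      ultimately show ?case by blast
    qed (simp add: Rc)
    obtain c' \<delta>' where \<delta>': "\<delta>' \<in> W c'" "\<delta>' \<noteq> 0" "\<And>y. y \<in> S \<Longrightarrow> \<delta>' * y \<in> V es c'"
      using common_denominator[OF S(1), of es] all by auto
    \<comment> \<open>Each further digit of an expansion costs one factor \<delta> and
      \<open>c\<close> degrees; \<delta>' clears the denominators of the digits themselves.\<close>
    have in_V: "\<delta> ^ J * \<delta>' * p \<in> V es (c' + J * c)" if "p \<in> ?P J" for J p
      using that
    proof (induction J arbitrary: p)
      case 0
      then show ?case by (simp add: V_zero)
    next
      case (Suc J)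
      then obtain y p' where 1: "p = y + a * p'" "y \<in> S" "p' \<in> ?P J" by auto
      have "\<delta> ^ Suc J * (\<delta>' * y) \<in> V es (c' + Suc J * c)"
        using V_mult[OF W_power[OF \<delta>(1)] \<delta>'(3)[OF 1(2)], of "Suc J"] by (simp add: add_ac)
      moreover have "\<delta> * (a * (\<delta> ^ J * \<delta>' * p')) \<in> V es (c' + Suc J * c)"
        using step[OF Suc.IH[OF 1(3)]] by (simp add: add_ac)
      ultimately have "\<delta> ^ Suc J * (\<delta>' * y) + \<delta> * (a * (\<delta> ^ J * \<delta>' * p')) \<in> V es (c' + Suc J * c)"
        by (rule V_add)
      then show ?case by (simp add: 1 algebra_simps)
    qed
    have bound: "card S ^ J \<le> (card k ^ Suc c') ^ length es * Q ^ J" for J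
    proof -
      have "card S ^ J = card ((*) (\<delta> ^ J * \<delta>') ` ?P J)"
        using P[of J] \<delta>(2) \<delta>'(2) by (subst card_image) (auto simp: inj_on_def)
      also have "\<dots> \<le> card (V es (c' + J * c))"
        using V_finite in_V by (intro card_mono) auto
      also have "\<dots> \<le> (card k ^ Suc (c' + J * c)) ^ length es" using V_finite by blast
      also have "\<dots> = (card k ^ Suc c') ^ length es * Q ^ J"
      proof -
        have "card k ^ Suc (c' + J * c) = card k ^ Suc c' * (card k ^ c) ^ J"
          by (simp add: power_add mult.commute[of J c] power_mult)
        moreover have "((card k ^ c) ^ J) ^ length es = Q ^ J"
          by (simp only: Q_def power_mult[symmetric] mult_ac)
        ultimately show ?thesis by (metis power_mult_distrib)
      qed
      finally show ?thesis .
    qed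
    show ?thesis
    proof (rule ccontr)
      assume "\<not> card S \<le> Q"
      have Q: "Q > 0" using kpos by (simp add: Q_def)
      let ?C = "(card k ^ Suc c') ^ length es"
      \<comment> \<open>The powers of a ratio above 1 exceed the constant \<open>?C\<close>, which
        contradicts \<open>bound\<close>.\<close>
      have "real (card S) / real Q > 1" using \<open>\<not> card S \<le> Q\<close> Q by simp
      then obtain J where "real ?C < (real (card S) / real Q) ^ J" using real_arch_pow by blast
      then have "real ?C * real Q ^ J < real (card S) ^ J" using Q by (simp add: power_divide field_simps)
      also have "\<dots> \<le> real (?C * Q ^ J)" using bound[of J] by (metis of_nat_le_iff of_nat_power)
      finally show False by simp
    qed
  qed
  show ?thesis
  proof (intro exI[of _ Q] allI impI)
    fix S assume S: "incongruent R a S"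
    show "card S \<le> Q"
    proof (rule main)
      show "y = z" if "y \<in> S" "z \<in> S" "b \<in> R" "y - z = a * b" for y z b
        using S that unfolding incongruent_def by blast
    qed (use S in \<open>simp_all add: incongruent_def\<close>)
  qed
qed

text \<open>An incongruent set of maximal size meets every residue class, since an element of a
  missed class could be added to it. The maximum exists by the uniform bound.\<close>

lemma finite_residue_ring:
  assumes all: "\<And>z. den es z" and R: "cring (ring_on (R :: 'e set))" and a: "a \<in> R" "a \<noteq> 0"
  obtains S where "finite (S :: 'e set)" "S \<subseteq> R" "\<And>y. y \<in> R \<Longrightarrow> \<exists>z\<in>S. \<exists>b\<in>R. y - z = a * b"
proof -
  note Rc = ring_on_closed[OF R]
  let ?inc = "incongruent R a :: 'e set \<Rightarrow> bool"
  obtain Q where Q: "\<And>S. ?inc S \<Longrightarrow> card S \<le> Q"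
    using incongruent_bounded[OF all R a] by blast
  have "?inc {}" by (simp add: incongruent_def)
  then obtain S where S: "?inc S" "\<And>S'. ?inc S' \<Longrightarrow> card S' \<le> card S"
    using ex_has_greatest_nat[of ?inc "{}" card "Suc Q"] Q by (metis le_imp_less_Suc)
  show ?thesis
  proof (rule that)
    show "finite S" "S \<subseteq> R" using S by (auto simp: incongruent_def)
    fix y assume y: "y \<in> R"
    show "\<exists>z\<in>S. \<exists>b\<in>R. y - z = a * b"
    proof (rule ccontr)
      assume not: "\<not> ?thesis"
      have "y \<notin> S"
      proof
        assume "y \<in> S"
        moreover have "y - y = a * 0" by simp
        ultimately show False using not Rc(1) by blast
      qed
      have "\<nexists>b. b \<in> R \<and> z - y = a * b" if "z \<in> S" for z
      proof
        assume "\<exists>b. b \<in> R \<and> z - y = a * b"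
        then obtain b where "b \<in> R" "z - y = a * b" by blast
        then have "y - z = a * (- b)" "- b \<in> R" using Rc(5) by (simp_all add: algebra_simps)
        then show False using not that by blast
      qed
      then have "?inc (insert y S)" using S(1) not y unfolding incongruent_def by blast
      then show False using S(2)[of "insert y S"] S(1) \<open>y \<notin> S\<close> by (simp add: incongruent_def)
    qed
  qed
qed

end

section \<open>Semilinear endomorphisms\<close>

text \<open>An abstraction of \<open>AL B\<close> with its Frobenius. The finiteness of
  \<open>L\<close> enters the study of semilinear maps through \<open>\<sigma>_order\<close> and
  \<open>residue\<close>.\<close>

locale finite_order_frobenius =
  fixes R :: "'e::field set" and \<sigma> :: "'e \<Rightarrow> 'e" and m :: nat
  assumes R: "cring (ring_on R)"
    and \<sigma>_add: "\<sigma> (a + b) = \<sigma> a + \<sigma> b" and \<sigma>_mult: "\<sigma> (a * b) = \<sigma> a * \<sigma> b"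
    and \<sigma>_closed: "a \<in> R \<Longrightarrow> \<sigma> a \<in> R"
    and \<sigma>_order: "m > 0" "(\<sigma> ^^ m) a = a"
    and residue: "a \<in> R \<Longrightarrow> a \<noteq> 0 \<Longrightarrow>
      \<exists>S. finite S \<and> S \<subseteq> R \<and> (\<forall>y\<in>R. \<exists>z\<in>S. \<exists>b\<in>R. y - z = a * b)"
begin

lemmas R_closed = ring_on_closed[OF R]

lemma \<sigma>_zero: "\<sigma> 0 = 0"
  using \<sigma>_add[of 0 0] by (metis add_0 add_cancel_right_left)

lemma funpow_\<sigma>_zero: "(\<sigma> ^^ n) 0 = 0"
  by (induction n) (simp_all add: \<sigma>_zero)

lemma \<sigma>_eq_0: "\<sigma> a = 0 \<Longrightarrow> a = 0"
  using \<sigma>_order funpow_\<sigma>_zero[of "m - 1"] funpow_swap1[of \<sigma> "m - 1" a]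
  by (metis Suc_pred' funpow.simps(2) comp_apply)

lemma \<sigma>_one: "\<sigma> 1 = 1"
  using \<sigma>_mult[of 1 1] \<sigma>_eq_0[of 1] by (metis mult_cancel_left1 mult_1 zero_neq_one)

lemma \<sigma>_power: "\<sigma> (a ^ n) = \<sigma> a ^ n"
  by (induction n) (simp_all add: \<sigma>_one \<sigma>_mult)

lemma funpow_\<sigma>_closed: "a \<in> R \<Longrightarrow> (\<sigma> ^^ n) a \<in> R"
  by (induction n) (auto simp: \<sigma>_closed)

lemma funpow_\<sigma>_dvd: "m dvd n \<Longrightarrow> (\<sigma> ^^ n) a = a"
proof -
  assume "m dvd n"
  then obtain q where "n = m * q" by blast
  moreover have "(\<sigma> ^^ (m * q)) a = a" by (induction q) (simp_all add: funpow_add \<sigma>_order)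
  ultimately show ?thesis by simp
qed

text \<open>\<open>c\<close> is the norm of \<open>b\<close>, the product of its conjugates under
  \<sigma>.\<close>

lemma invariant_multiple:
  assumes "b \<in> R" "b \<noteq> 0"
  obtains c where "c \<in> R" "c \<noteq> 0" "\<sigma> c = c" "\<exists>r\<in>R. c = r * b"
proof
  let ?N = "\<lambda>n. \<Prod>i<n. (\<sigma> ^^ i) b"
  have pow_ne: "(\<sigma> ^^ i) b \<noteq> 0" for i using assms(2) by (induction i) (auto dest: \<sigma>_eq_0)
  show "?N m \<noteq> 0" using pow_ne by simp
  have prod_in: "(\<Prod>i\<in>A. g i) \<in> R" if "\<And>i. i \<in> A \<Longrightarrow> g i \<in> R" for A and g :: "nat \<Rightarrow> 'e"
    using that by (induction A rule: infinite_finite_induct) (auto simp: R_closed)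
  show "?N m \<in> R" using funpow_\<sigma>_closed assms by (intro prod_in) auto
  have split: "?N m = b * (\<Prod>i<m - 1. (\<sigma> ^^ Suc i) b)"
    using prod.lessThan_Suc_shift[of "\<lambda>i. (\<sigma> ^^ i) b" "m - 1"] \<sigma>_order(1) by simp
  show "\<exists>r\<in>R. ?N m = r * b"
  proof (rule bexI)
    show "?N m = (\<Prod>i<m - 1. (\<sigma> ^^ Suc i) b) * b" unfolding split by (rule mult.commute)
    show "(\<Prod>i<m - 1. (\<sigma> ^^ Suc i) b) \<in> R" by (intro prod_in funpow_\<sigma>_closed assms(1))
  qed
  \<comment> \<open>\<sigma> shifts the factors by one place. For \<open>n = m\<close> the new last
    factor is \<open>(\<sigma> ^^ m) b = b\<close>, so the factors are only permuted.\<close>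
  have "\<sigma> (?N n) = (\<Prod>i<n. (\<sigma> ^^ Suc i) b)" for n
    by (induction n) (simp_all add: \<sigma>_one \<sigma>_mult)
  then have "\<sigma> (?N m) = (\<Prod>i<m - 1. (\<sigma> ^^ Suc i) b) * (\<sigma> ^^ m) b"
    using \<sigma>_order(1) prod.lessThan_Suc[of "\<lambda>i. (\<sigma> ^^ Suc i) b" "m - 1"] by simp
  then show "\<sigma> (?N m) = ?N m" using split \<sigma>_order(2) by (simp add: mult.commute)
qed

definition semilinear :: "('e, 'n) module \<Rightarrow> ('n \<Rightarrow> 'n) \<Rightarrow> bool" where
  "semilinear M t \<longleftrightarrow> module (ring_on R) M \<and> t \<in> carrier M \<rightarrow> carrier M \<and>
    (\<forall>x\<in>carrier M. \<forall>y\<in>carrier M. t (x \<oplus>\<^bsub>M\<^esub> y) = t x \<oplus>\<^bsub>M\<^esub> t y) \<and>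
    (\<forall>a\<in>R. \<forall>x\<in>carrier M. t (a \<odot>\<^bsub>M\<^esub> x) = \<sigma> a \<odot>\<^bsub>M\<^esub> t x)"

definition equivariant :: "('e, 'n) module \<Rightarrow> ('n \<Rightarrow> 'n) \<Rightarrow> ('e, 'p) module \<Rightarrow> ('p \<Rightarrow> 'p) \<Rightarrow>
    ('n \<Rightarrow> 'p) \<Rightarrow> bool" where
  "equivariant M t M' t' f \<longleftrightarrow> f \<in> mod_homs (ring_on R) M M' \<and> (\<forall>x\<in>carrier M. f (t x) = t' (f x))"

text \<open>A form free of quotients and pullbacks: the last two conjuncts express that
  \<open>t'\<close> is injective and surjective on the cokernel of \<open>f\<close>.\<close>

definition separable :: "('e, 'n) module \<Rightarrow> ('n \<Rightarrow> 'n) \<Rightarrow> ('e, 'p) module \<Rightarrow> ('p \<Rightarrow> 'p) \<Rightarrow>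
    ('n \<Rightarrow> 'p) \<Rightarrow> bool" where
  "separable M t M' t' f \<longleftrightarrow> equivariant M t M' t' f \<and> inj_on f (carrier M) \<and>
    (\<forall>y\<in>carrier M'. \<exists>a\<in>R - {0}. a \<odot>\<^bsub>M'\<^esub> y \<in> f ` carrier M) \<and>
    (\<forall>y\<in>carrier M'. t' y \<in> f ` carrier M \<longrightarrow> y \<in> f ` carrier M) \<and>
    (\<forall>y\<in>carrier M'. \<exists>x\<in>carrier M'. y \<ominus>\<^bsub>M'\<^esub> t' x \<in> f ` carrier M)"

end

locale semilinear_module = finite_order_frobenius R \<sigma> m for R :: "'e::field set" and \<sigma> m +
  fixes M :: "('e, 'n) module" (structure) and t :: "'n \<Rightarrow> 'n"
  assumes semilinear: "semilinear M t"
begin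

sublocale M: module "ring_on R" M
  using semilinear by (simp add: semilinear_def)

lemma t_closed: "x \<in> carrier M \<Longrightarrow> t x \<in> carrier M"
  and t_add: "x \<in> carrier M \<Longrightarrow> y \<in> carrier M \<Longrightarrow> t (x \<oplus> y) = t x \<oplus> t y"
  and t_smult: "a \<in> R \<Longrightarrow> x \<in> carrier M \<Longrightarrow> t (a \<odot> x) = \<sigma> a \<odot> t x"
  using semilinear by (auto simp: semilinear_def)

lemma smult_closed: "a \<in> R \<Longrightarrow> x \<in> carrier M \<Longrightarrow> a \<odot> x \<in> carrier M"
  using M.smult_closed[of a x] by simp

lemma smult_mult: "a \<in> R \<Longrightarrow> b \<in> R \<Longrightarrow> x \<in> carrier M \<Longrightarrow> (a * b) \<odot> x = a \<odot> (b \<odot> x)"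
  using M.smult_assoc1[of a b x] by simp

lemma smult_add: "a \<in> R \<Longrightarrow> b \<in> R \<Longrightarrow> x \<in> carrier M \<Longrightarrow>
    (a + b) \<odot> x = a \<odot> x \<oplus> b \<odot> x"
  using M.smult_l_distr[of a b x] by simp

lemma smult_distr: "a \<in> R \<Longrightarrow> x \<in> carrier M \<Longrightarrow> y \<in> carrier M \<Longrightarrow>
    a \<odot> (x \<oplus> y) = a \<odot> x \<oplus> a \<odot> y"
  using M.smult_r_distr[of a x y] by simp

lemma smult_1: "x \<in> carrier M \<Longrightarrow> 1 \<odot> x = x" and smult_0: "x \<in> carrier M \<Longrightarrow> 0 \<odot> x = \<zero>"
  and smult_null: "a \<in> R \<Longrightarrow> a \<odot> \<zero> = \<zero>"
  using M.smult_one[of x] M.smult_l_null[of x] M.smult_r_null[of a] by auto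

lemma smult_sub: "a \<in> R \<Longrightarrow> b \<in> R \<Longrightarrow> x \<in> carrier M \<Longrightarrow>
    (a - b) \<odot> x = a \<odot> x \<ominus> b \<odot> x"
  using smult_add[of a "- b" x] M.smult_l_minus[of b x] R R_closed(5)[of b]
  by (simp add: M.minus_eq)

lemma smult_minus: "a \<in> R \<Longrightarrow> x \<in> carrier M \<Longrightarrow> y \<in> carrier M \<Longrightarrow>
    a \<odot> (x \<ominus> y) = a \<odot> x \<ominus> a \<odot> y"
  using M.smult_diff[of a x y] by simp

lemma minus_closed: "x \<in> carrier M \<Longrightarrow> y \<in> carrier M \<Longrightarrow> x \<ominus> y \<in> carrier M"
  by simp

lemma additive_minus:
  assumes "g \<in> carrier M \<rightarrow> carrier M"
    "\<And>x y. x \<in> carrier M \<Longrightarrow> y \<in> carrier M \<Longrightarrow> g (x \<oplus> y) = g x \<oplus> g y"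
    "x \<in> carrier M" "y \<in> carrier M"
  shows "g (x \<ominus> y) = g x \<ominus> g y"
proof -
  have c: "g x \<in> carrier M" "g y \<in> carrier M" "g (x \<ominus> y) \<in> carrier M" using assms by auto
  have "g (x \<ominus> y) \<oplus> g y = g (x \<ominus> y \<oplus> y)"
    using assms(2)[of "x \<ominus> y" y] assms(3,4) by simp
  also have "x \<ominus> y \<oplus> y = x" using assms(3,4) by (simp add: M.minus_eq M.a_assoc M.l_neg)
  finally show ?thesis using c by (metis M.add.inv_solve_right M.minus_eq)
qed

lemma t_minus: "x \<in> carrier M \<Longrightarrow> y \<in> carrier M \<Longrightarrow> t (x \<ominus> y) = t x \<ominus> t y"
  by (rule additive_minus) (auto simp: t_closed t_add)

lemma power_closed: "x \<in> carrier M \<Longrightarrow> (t ^^ n) x \<in> carrier M"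
  by (induction n) (auto simp: t_closed)

lemma power_add: "x \<in> carrier M \<Longrightarrow> y \<in> carrier M \<Longrightarrow> (t ^^ n) (x \<oplus> y) = (t ^^ n) x \<oplus> (t ^^ n) y"
  by (induction n) (auto simp: t_add power_closed)

lemma power_smult: "a \<in> R \<Longrightarrow> x \<in> carrier M \<Longrightarrow> (t ^^ n) (a \<odot> x) = (\<sigma> ^^ n) a \<odot> (t ^^ n) x"
  by (induction n) (auto simp: t_smult power_closed funpow_\<sigma>_closed)

lemma power_minus: "x \<in> carrier M \<Longrightarrow> y \<in> carrier M \<Longrightarrow> (t ^^ n) (x \<ominus> y) = (t ^^ n) x \<ominus> (t ^^ n) y"
  by (rule additive_minus) (auto simp: power_closed power_add)

lemma additive_finsum:
  assumes g: "g \<in> carrier M \<rightarrow> carrier M"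
    "\<And>x y. x \<in> carrier M \<Longrightarrow> y \<in> carrier M \<Longrightarrow> g (x \<oplus> y) = g x \<oplus> g y"
    and "finite A" "w \<in> A \<rightarrow> carrier M"
  shows "g (\<Oplus> j\<in>A. w j) = (\<Oplus> j\<in>A. g (w j))"
  using assms(3,4)
proof (induction A rule: finite_induct)
  case empty
  have "g (\<zero> \<ominus> \<zero>) = g \<zero> \<ominus> g \<zero>" using g by (intro additive_minus) auto
  moreover have "g \<zero> \<in> carrier M" using g by auto
  ultimately show ?case by (simp add: M.minus_eq M.r_neg)
next
  case (insert a A)
  then have "w \<in> A \<rightarrow> carrier M" "w a \<in> carrier M" "(\<lambda>j. g (w j)) \<in> A \<rightarrow> carrier M" "g (w a) \<in> carrier M"
    using g(1) by auto
  then show ?case using insert g by simp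
qed

text \<open>The power \<open>P = t ^^ k\<close> is linear because \<open>m dvd k\<close>, and
  \<open>x j\<close> is an eigenvector of it for \<open>1 / c j\<close>. Division is avoided by
  passing to \<open>n j = P (x j)\<close>: the sum of the \<open>y j c j n j\<close> is the given
  relation, and the sum of the \<open>y j n j\<close> is its image under \<open>P\<close>, so both
  vanish. Subtracting \<open>c i\<close> times the second from the first removes index
  \<open>i\<close> and leaves the coefficients \<open>(c j - c i) y j\<close>.\<close>

lemma eigenvectors_independent:
  fixes c :: "nat \<Rightarrow> 'e"
  assumes tf: "torsion_free_module R M" and k: "m dvd k"
    and "finite J" "inj_on c J" "c \<in> J \<rightarrow> R" "y \<in> J \<rightarrow> R"
    and "\<And>j. j \<in> J \<Longrightarrow> x j \<in> carrier M" "\<And>j. j \<in> J \<Longrightarrow> x j \<noteq> \<zero>"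
    and "\<And>j. j \<in> J \<Longrightarrow> x j = c j \<odot> (t ^^ k) (x j)"
    and "(\<Oplus> j\<in>J. y j \<odot> x j) = \<zero>"
  shows "\<forall>j\<in>J. y j = 0"
  using assms(3-)
proof (induction J arbitrary: x y rule: finite_induct)
  case (insert i J)
  let ?P = "t ^^ k"
  define n where "n j = ?P (x j)" for j
  define w where "w j = y j \<odot> n j" for j
  have cR: "c j \<in> R" and yR: "y j \<in> R" and xM: "x j \<in> carrier M" and nM: "n j \<in> carrier M"
    and xn: "x j = c j \<odot> n j" and x0: "x j \<noteq> \<zero>" if "j \<in> insert i J" for j
    using insert.prems that by (auto simp: n_def power_closed)
  have wM: "w j \<in> carrier M" if "j \<in> insert i J" for j
    using that yR nM by (auto simp: w_def intro: smult_closed)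
  have lin: "?P (a \<odot> z) = a \<odot> ?P z" if "a \<in> R" "z \<in> carrier M" for a z
    using power_smult[OF that] funpow_\<sigma>_dvd[OF k] by simp
  have n0: "n j \<noteq> \<zero>" if "j \<in> insert i J" for j
    using xn[OF that] x0[OF that] smult_null[OF cR[OF that]] by auto
  \<comment> \<open>The \<open>n j\<close> satisfy the same eigenvector equations, so the induction
    hypothesis can be applied to them instead of the \<open>x j\<close>.\<close>
  have nn: "n j = c j \<odot> ?P (n j)" if "j \<in> insert i J" for j
  proof -
    have "n j = ?P (x j)" by (rule n_def)
    also have "\<dots> = ?P (c j \<odot> n j)" by (rule arg_cong[OF xn[OF that]])
    also have "\<dots> = c j \<odot> ?P (n j)" by (rule lin[OF cR[OF that] nM[OF that]])
    finally show ?thesis .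
  qed
  have "(\<Oplus> j\<in>insert i J. c j \<odot> w j) = (\<Oplus> j\<in>insert i J. y j \<odot> x j)"
  proof (rule M.finsum_cong')
    fix j assume j: "j \<in> insert i J"
    show "c j \<odot> w j = y j \<odot> x j"
      using smult_mult[OF cR yR nM, OF j j j] smult_mult[OF yR cR nM, OF j j j] xn[OF j]
      by (simp add: w_def mult.commute)
  qed (use yR xM smult_closed in auto)
  then have 1: "(\<Oplus> j\<in>insert i J. c j \<odot> w j) = \<zero>" using insert.prems by simp
  have "(\<Oplus> j\<in>insert i J. w j) = (\<Oplus> j\<in>insert i J. ?P (y j \<odot> x j))"
    using lin yR xM wM power_closed smult_closed by (intro M.finsum_cong') (auto simp: w_def n_def)
  also have "\<dots> = ?P (\<Oplus> j\<in>insert i J. y j \<odot> x j)"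
    using insert.hyps yR xM smult_closed
    by (intro additive_finsum[symmetric]) (auto simp: power_closed power_add)
  also have "\<dots> = \<zero>" using insert.prems lin[OF R_closed(1) M.zero_closed] power_closed[OF M.zero_closed]
    by (simp add: smult_0)
  finally have 2: "(\<Oplus> j\<in>insert i J. w j) = \<zero>" .
  have "c i \<odot> (\<Oplus> j\<in>insert i J. w j) = (\<Oplus> j\<in>insert i J. c i \<odot> w j)"
    using insert.hyps cR wM by (intro M.finsum_smult_ldistr) auto
  then have 3: "(\<Oplus> j\<in>insert i J. c i \<odot> w j) = \<zero>" using 2 cR smult_null by simp
  have cw: "(\<lambda>j. c j \<odot> w j) \<in> J \<rightarrow> carrier M" "(\<lambda>j. c i \<odot> w j) \<in> J \<rightarrow> carrier M"
    "c i \<odot> w i \<in> carrier M" "(\<lambda>j. (c j - c i) \<odot> w j) \<in> J \<rightarrow> carrier M"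
    using cR wM R_closed(6) by (auto intro!: smult_closed)
  have sums: "(\<Oplus> j\<in>J. c j \<odot> w j) = (\<Oplus> j\<in>J. c i \<odot> w j)"
  proof -
    have "c i \<odot> w i \<oplus> (\<Oplus> j\<in>J. c j \<odot> w j) = c i \<odot> w i \<oplus> (\<Oplus> j\<in>J. c i \<odot> w j)"
      using 1 3 M.finsum_insert[OF insert.hyps cw(1,3)] M.finsum_insert[OF insert.hyps cw(2,3)] by simp
    from M.add.l_cancel[OF this M.finsum_closed[OF cw(1)] M.finsum_closed[OF cw(2)] cw(3)] show ?thesis .
  qed
  have "(\<Oplus> j\<in>J. (c j - c i) \<odot> w j) \<oplus> (\<Oplus> j\<in>J. c i \<odot> w j)
      = (\<Oplus> j\<in>J. (c j - c i) \<odot> w j \<oplus> c i \<odot> w j)"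
    using cw by (intro M.finsum_addf[symmetric])
  also have "\<dots> = (\<Oplus> j\<in>J. c j \<odot> w j)"
  proof (rule M.finsum_cong')
    fix j assume "j \<in> J"
    then show "(c j - c i) \<odot> w j \<oplus> c i \<odot> w j = c j \<odot> w j"
      using smult_add[of "c j - c i" "c i" "w j"] cR wM R_closed(6) by simp
  qed (use cw in auto)
  finally have "(\<Oplus> j\<in>J. (c j - c i) \<odot> w j) = \<zero>"
    unfolding sums
    using M.add.r_cancel_one[OF M.finsum_closed[OF cw(2)] M.finsum_closed[OF cw(4)]] by blast
  moreover have "(\<Oplus> j\<in>J. (c j - c i) \<odot> w j) = (\<Oplus> j\<in>J. ((c j - c i) * y j) \<odot> n j)"
    using smult_mult cR yR nM R_closed(4,6) smult_closed
    by (intro M.finsum_cong') (auto simp: w_def intro!: smult_closed)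
  ultimately have "\<forall>j\<in>J. (c j - c i) * y j = 0"
    using insert.prems(1,2) cR yR nM n0 nn R_closed(4,6)
    by (intro insert.IH[of "\<lambda>j. (c j - c i) * y j" n]) auto
  moreover have "c j \<noteq> c i" if "j \<in> J" for j
    using insert.prems(1) insert.hyps(2) that by (auto simp: inj_on_def)
  ultimately have yJ: "\<forall>j\<in>J. y j = 0" by auto
  have "(\<Oplus> j\<in>insert i J. w j) = w i \<oplus> (\<Oplus> j\<in>J. w j)"
    using wM insert.hyps by (intro M.finsum_insert) auto
  also have "(\<Oplus> j\<in>J. w j) = (\<Oplus> j\<in>J. \<zero>)"
    using yJ nM by (intro M.finsum_cong') (auto simp: w_def smult_0)
  finally have "w i = \<zero>" using 2 wM by simp
  then have "y i = 0" using tf n0[of i] yR[of i] nM[of i] by (auto simp: torsion_free_module_def w_def)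
  then show ?case using yJ by simp
qed simp

text \<open>The rank bound gives a relation among the \<open>r + 1\<close> elements
  \<open>z, u z, ..., (u ^^ r) z\<close>. Injectivity of \<open>u\<close> cancels leading zero
  coefficients, after which the relation reads \<open>y 0 z = - u v\<close> with \<open>y 0\<close>
  nonzero.\<close>

lemma injective_imp_torsion_coker:
  assumes rk: "rank_le R M r"
    and u: "u \<in> carrier M \<rightarrow> carrier M"
      "\<And>x y. x \<in> carrier M \<Longrightarrow> y \<in> carrier M \<Longrightarrow> u (x \<oplus> y) = u x \<oplus> u y"
      "\<And>a x. a \<in> R \<Longrightarrow> x \<in> carrier M \<Longrightarrow> u (a \<odot> x) = a \<odot> u x"
    and inj: "\<And>x. x \<in> carrier M \<Longrightarrow> u x = \<zero> \<Longrightarrow> x = \<zero>"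
    and z: "z \<in> carrier M"
  shows "\<exists>a\<in>R - {0}. a \<odot> z \<in> u ` carrier M"
proof -
  have uc: "u x \<in> carrier M" if "x \<in> carrier M" for x using u(1) that by auto
  have un: "(u ^^ n) z \<in> carrier M" for n by (induction n) (auto simp: z uc)
  have step: "\<exists>a\<in>R - {0}. a \<odot> z \<in> u ` carrier M"
    if "y \<in> {..n} \<rightarrow> R" "\<exists>j\<le>n. y j \<noteq> 0" "(\<Oplus> j\<in>{..n}. y j \<odot> (u ^^ j) z) = \<zero>" for y n
    using that
  proof (induction n arbitrary: y)
    case 0
    then have "y 0 \<odot> z = u \<zero>" "y 0 \<in> R - {0}"
      using z u(3)[OF R_closed(1) M.zero_closed] uc[OF M.zero_closed] by (auto simp: smult_closed smult_0)
    then show ?case by blast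
  next
    case (Suc n)
    have y: "y j \<in> R" if "j \<le> Suc n" for j using Suc.prems(1) that by auto
    define v where "v = (\<Oplus> j\<in>{..n}. y (Suc j) \<odot> (u ^^ j) z)"
    have vM: "v \<in> carrier M" unfolding v_def using y un by (intro M.finsum_closed) (auto intro!: smult_closed)
    have "(\<Oplus> j\<in>{..Suc n}. y j \<odot> (u ^^ j) z)
        = (\<Oplus> j\<in>{..n}. y (Suc j) \<odot> (u ^^ Suc j) z) \<oplus> y 0 \<odot> z"
      using y un by (subst M.finsum_Suc2) (auto intro!: smult_closed simp del: funpow.simps(2) simp: funpow_0)
    also have "(\<Oplus> j\<in>{..n}. y (Suc j) \<odot> (u ^^ Suc j) z) = u v"
      unfolding v_def using y un u smult_closed
      by (subst additive_finsum[OF u(1,2)]) (auto intro!: M.finsum_cong' simp: uc)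
    finally have eq: "u v \<oplus> y 0 \<odot> z = \<zero>" using Suc.prems(3) by simp
    have yz: "y 0 \<odot> z \<in> carrier M" using y[of 0] z smult_closed by simp
    show ?case
    proof (cases "y 0 = 0")
      case True
      then have "u v = \<zero>" using eq uc[OF vM] z by (simp add: smult_0)
      then have "v = \<zero>" using inj vM by blast
      moreover have "\<exists>j\<le>n. y (Suc j) \<noteq> 0" using Suc.prems(2) True by (metis Suc_le_mono not0_implies_Suc)
      ultimately show ?thesis using Suc.IH[of "\<lambda>j. y (Suc j)"] y by (auto simp: v_def)
    next
      case False
      have neg1: "- 1 \<in> R" using R_closed(2,5) by blast
      have "y 0 \<odot> z = \<ominus> u v"
        using eq uc[OF vM] yz by (metis M.add.inv_equality M.minus_minus M.a_comm)
      also have "\<dots> = u ((- 1) \<odot> v)"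
        using u(3)[OF neg1 vM] M.smult_l_minus[of 1 "u v"] R R_closed(2) uc[OF vM] by (simp add: smult_1)
      finally show ?thesis using False y[of 0] vM smult_closed[OF neg1] by blast
    qed
  qed
  obtain y where y: "y \<in> {..r} \<rightarrow> R" "\<exists>j\<in>{..r}. y j \<noteq> 0"
      "(\<Oplus> j\<in>{..r}. y j \<odot> (u ^^ j) z) = \<zero>"
    using rk[unfolded rank_le_def, rule_format, of "{..r}" "\<lambda>j. (u ^^ j) z"] un by auto
  then show ?thesis using step[of y r] by auto
qed

end

lemma (in abelian_group) minus_add_minus:
  assumes "x \<in> carrier G" "y \<in> carrier G" "z \<in> carrier G"
  shows "(x \<ominus> y) \<oplus> (y \<ominus> z) = x \<ominus> z"
  using assms by (simp add: minus_eq a_assoc r_neg1)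

section \<open>Stable submodules and the action of \<open>t\<close> on a finite quotient\<close>

locale stable_submodule = semilinear_module R \<sigma> m M t
  for R :: "'e::field set" and \<sigma> m and M :: "('e, 'n) module" (structure) and t +
  fixes H :: "'n set"
  assumes H_subset: "H \<subseteq> carrier M" and H_zero: "\<zero> \<in> H"
    and H_add: "x \<in> H \<Longrightarrow> y \<in> H \<Longrightarrow> x \<oplus> y \<in> H"
    and H_smult: "a \<in> R \<Longrightarrow> x \<in> H \<Longrightarrow> a \<odot> x \<in> H"
    and H_stable: "x \<in> H \<Longrightarrow> t x \<in> H"
begin

lemma H_carrier: "x \<in> H \<Longrightarrow> x \<in> carrier M"
  using H_subset by blast

lemma H_uminus: "x \<in> H \<Longrightarrow> \<ominus> x \<in> H"
  using H_smult[OF R_closed(5)[OF R_closed(2)], of x] M.smult_l_minus[of 1 x] R R_closed(2) H_carrier[of x]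
  by (simp add: smult_1)

lemma H_minus: "x \<in> H \<Longrightarrow> y \<in> H \<Longrightarrow> x \<ominus> y \<in> H"
  by (simp add: M.minus_eq H_add H_uminus)

lemma H_power: "x \<in> H \<Longrightarrow> (t ^^ n) x \<in> H"
  by (induction n) (auto simp: H_stable)

lemma H_trans:
  assumes "x \<in> carrier M" "y \<in> carrier M" "z \<in> carrier M" "x \<ominus> y \<in> H" "y \<ominus> z \<in> H"
  shows "x \<ominus> z \<in> H"
  using H_add[OF assms(4,5)] M.minus_add_minus[OF assms(1-3)] by simp

lemma H_sym:
  assumes "x \<in> carrier M" "y \<in> carrier M" "x \<ominus> y \<in> H"
  shows "y \<ominus> x \<in> H"
proof -
  have "\<ominus> (x \<ominus> y) = y \<ominus> x"
    using assms(1,2) by (simp add: M.minus_eq M.minus_add M.a_comm)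
  then show ?thesis using H_uminus[OF assms(3)] by simp
qed

text \<open>Annihilators of single elements are available from torsion; those of the finitely many
  generators are multiplied together.\<close>

lemma uniform_annihilator:
  assumes "set ys \<subseteq> carrier M" "\<And>y. y \<in> carrier M \<Longrightarrow> \<exists>a\<in>R - {0}. a \<odot> y \<in> H"
  shows "\<exists>b\<in>R - {0}. \<forall>y\<in>list_span (ring_on R) M ys. b \<odot> y \<in> H"
  using assms(1)
proof (induction ys)
  case Nil
  then show ?case using R_closed(2) by (intro bexI[of _ 1]) (auto simp: smult_1 H_zero)
next
  case (Cons w ys)
  then obtain b where b: "b \<in> R - {0}" "\<forall>y\<in>list_span (ring_on R) M ys. b \<odot> y \<in> H" by auto
  obtain a where a: "a \<in> R - {0}" "a \<odot> w \<in> H" using assms(2)[of w] Cons.prems by auto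
  have "(a * b) \<odot> (r \<odot> w \<oplus> z) \<in> H" if "r \<in> R" "z \<in> list_span (ring_on R) M ys" for r z
  proof -
    have z: "z \<in> carrier M" using M.list_span_closed[of ys] Cons.prems that by auto
    have w: "w \<in> carrier M" using Cons.prems by simp
    have "(a * b) \<odot> (r \<odot> w \<oplus> z) = (a * b) \<odot> (r \<odot> w) \<oplus> (a * b) \<odot> z"
      using a b z w that R_closed(4) smult_closed by (intro smult_distr) auto
    also have "(a * b) \<odot> (r \<odot> w) = (b * r) \<odot> (a \<odot> w)"
      using a b w that R_closed(4) smult_mult[of "a * b" r w] smult_mult[of "b * r" a w] by (simp add: mult_ac)
    also have "(a * b) \<odot> z = a \<odot> (b \<odot> z)" using a b z smult_mult by auto
    moreover have "(b * r) \<odot> (a \<odot> w) \<in> H" "a \<odot> (b \<odot> z) \<in> H"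
      using a b that R_closed(4) by (simp_all add: H_smult)
    ultimately show ?thesis by (simp add: H_add)
  qed
  moreover have "a * b \<in> R - {0}" using a b R_closed(4) by auto
  ultimately show ?case by (intro bexI[of _ "a * b"]) auto
qed

text \<open>Modulo \<open>H\<close> the coefficient of a generator matters only modulo
  \<open>b\<close>, so representatives of the residues modulo \<open>b\<close> suffice as
  coefficients.\<close>

lemma finite_representatives:
  assumes "set ys \<subseteq> carrier M" and b: "b \<in> R" "b \<noteq> 0" "\<And>y. y \<in> carrier M \<Longrightarrow> b \<odot> y \<in> H"
  shows "\<exists>T. finite T \<and> T \<subseteq> carrier M \<and> (\<forall>y\<in>list_span (ring_on R) M ys. \<exists>z\<in>T. y \<ominus> z \<in> H)"
  using assms(1)
proof (induction ys)
  case Nil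
  then show ?case by (intro exI[of _ "{\<zero>}"]) (simp add: H_minus H_zero)
next
  case (Cons w ys)
  obtain T where T: "finite T" "T \<subseteq> carrier M" "\<forall>y\<in>list_span (ring_on R) M ys. \<exists>z\<in>T. y \<ominus> z \<in> H"
    using Cons by auto
  obtain S where S: "finite S" "S \<subseteq> R" "\<forall>y\<in>R. \<exists>z\<in>S. \<exists>c\<in>R. y - z = b * c" using residue[OF b(1,2)] by auto
  have w: "w \<in> carrier M" using Cons.prems by simp
  define T' where "T' = (\<lambda>(s, z). s \<odot> w \<oplus> z) ` (S \<times> T)"
  have "\<exists>z\<in>T'. r \<odot> w \<oplus> y \<ominus> z \<in> H" if r: "r \<in> R" and yl: "y \<in> list_span (ring_on R) M ys" for r y
  proof -
    have y: "y \<in> carrier M" using M.list_span_closed[of ys] Cons.prems yl by auto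
    obtain z where z: "z \<in> T" "y \<ominus> z \<in> H" using T yl by blast
    obtain s c where s: "s \<in> S" "c \<in> R" "r - s = b * c" using S r by blast
    have zc: "z \<in> carrier M" and sR: "s \<in> R" using z T s S by auto
    have "r \<odot> w \<ominus> s \<odot> w = b \<odot> (c \<odot> w)"
      using smult_sub[OF r sR w] smult_mult[OF b(1) s(2) w] s(3) by simp
    then have "r \<odot> w \<ominus> s \<odot> w \<in> H" using b(3) smult_closed[OF s(2) w] by simp
    then have "(r \<odot> w \<ominus> s \<odot> w) \<oplus> (y \<ominus> z) \<in> H" using z(2) by (rule H_add)
    also have "(r \<odot> w \<ominus> s \<odot> w) \<oplus> (y \<ominus> z) = r \<odot> w \<oplus> y \<ominus> (s \<odot> w \<oplus> z)"
      using smult_closed[OF r w] smult_closed[OF sR w] y zc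
      by (simp add: M.minus_eq M.minus_add M.a_ac)
    finally show ?thesis unfolding T'_def using s(1) z(1) by force
  qed
  then have "\<forall>y\<in>list_span (ring_on R) M (w # ys). \<exists>z\<in>T'. y \<ominus> z \<in> H" by auto
  moreover have "finite T'" using S T by (simp add: T'_def)
  moreover have "T' \<subseteq> carrier M" using T(2) smult_closed[OF subsetD[OF S(2)] w] by (auto simp: T'_def)
  ultimately show ?case by blast
qed

text \<open>By the pigeonhole principle two powers of \<open>t\<close> agree on \<open>y\<close>
  modulo \<open>H\<close>. Injectivity on the quotient cancels the smaller one, so \<open>y\<close>
  has a period of at most \<open>card T\<close>.\<close>

lemma power_acts_trivially:
  assumes T: "finite T" "T \<subseteq> carrier M" "\<And>y. y \<in> carrier M \<Longrightarrow> \<exists>z\<in>T. y \<ominus> z \<in> H"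
    and inj: "\<And>y. y \<in> carrier M \<Longrightarrow> t y \<in> H \<Longrightarrow> y \<in> H"
  shows "\<exists>k>0. m dvd k \<and> (\<forall>y\<in>carrier M. (t ^^ k) y \<ominus> y \<in> H)"
proof -
  have inj_pow: "y \<in> H" if "y \<in> carrier M" "(t ^^ n) y \<in> H" for y n
    using that inj[OF power_closed[OF that(1)]] by (induction n) auto
  have ex: "\<exists>d. 0 < d \<and> d \<le> card T \<and> (t ^^ d) y \<ominus> y \<in> H" if y: "y \<in> carrier M" for y
  proof -
    define \<rho> where "\<rho> n = (SOME z. z \<in> T \<and> (t ^^ n) y \<ominus> z \<in> H)" for n
    have \<rho>: "\<rho> n \<in> T" "(t ^^ n) y \<ominus> \<rho> n \<in> H" for n
      using someI_ex[of "\<lambda>z. z \<in> T \<and> (t ^^ n) y \<ominus> z \<in> H"] T(3)[OF power_closed[OF y]]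
      unfolding \<rho>_def by blast+
    have "\<not> inj_on \<rho> {..card T}"
    proof
      assume "inj_on \<rho> {..card T}"
      then have "card {..card T} \<le> card T" using \<rho>(1) T(1) by (intro card_inj_on_le) auto
      then show False by simp
    qed
    then obtain i j where ij: "i < j" "j \<le> card T" "\<rho> i = \<rho> j"
      unfolding inj_on_def by (metis atMost_iff nat_neq_iff)
    have \<rho>c: "\<rho> n \<in> carrier M" for n using \<rho>(1) T(2) by blast
    have "(t ^^ j) y \<ominus> (t ^^ i) y \<in> H"
      using H_trans[OF power_closed[OF y] \<rho>c power_closed[OF y] \<rho>(2)]
        H_sym[OF power_closed[OF y] \<rho>c \<rho>(2), of i] ij(3) by simp
    moreover have "(t ^^ j) y \<ominus> (t ^^ i) y = (t ^^ i) ((t ^^ (j - i)) y \<ominus> y)"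
      using power_minus[OF power_closed[OF y] y, of i "j - i"] ij(1) funpow_add[of i "j - i" t] by simp
    ultimately have "(t ^^ (j - i)) y \<ominus> y \<in> H"
      using inj_pow minus_closed[OF power_closed[OF y] y] by metis
    then show ?thesis using ij by (intro exI[of _ "j - i"]) auto
  qed
  have mult: "(t ^^ (q * d)) y \<ominus> y \<in> H" if y: "y \<in> carrier M" and d: "(t ^^ d) y \<ominus> y \<in> H" for y d q
  proof (induction q)
    case 0
    then show ?case using y by (simp add: M.minus_eq M.r_neg H_zero)
  next
    case (Suc q)
    have "(t ^^ d) ((t ^^ (q * d)) y \<ominus> y) \<in> H" using Suc by (rule H_power)
    then have "(t ^^ (Suc q * d)) y \<ominus> (t ^^ d) y \<in> H"
      using power_minus[OF power_closed[OF y] y] by (simp add: funpow_add)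
    then show ?case by (rule H_trans[OF power_closed[OF y] power_closed[OF y] y _ d])
  qed
  \<comment> \<open>The factorial is a common multiple of the periods of all \<open>y\<close>, and
    the factor \<open>m\<close> makes the power of \<open>t\<close> linear.\<close>
  show ?thesis
  proof (intro exI[of _ "m * fact (card T)"] conjI ballI)
    show "0 < m * fact (card T)" using \<sigma>_order(1) by simp
    fix y assume y: "y \<in> carrier M"
    obtain d where d: "0 < d" "d \<le> card T" "(t ^^ d) y \<ominus> y \<in> H" using ex[OF y] by blast
    then have "d dvd m * fact (card T)" using dvd_fact[of d "card T"] by simp
    then obtain q where "m * fact (card T) = q * d" by (metis dvd_def mult.commute)
    then show "(t ^^ (m * fact (card T))) y \<ominus> y \<in> H" using mult[OF y d(3)] by simp
  qed simp
qed

text \<open>Since eigenvectors for distinct eigenvalues are independent, only finitely many of the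
  candidates \<open>1 + b ^ j\<close> for \<open>c\<close> fail, unless \<open>b\<close> is a root of unity and \<open>H\<close> is everything.\<close>

lemma injective_deformation:
  assumes tf: "torsion_free_module R M" and rk: "rank_le R M r" and k: "m dvd k"
    and b: "b \<in> R" "b \<noteq> 0" "\<sigma> b = b" "\<And>y. y \<in> carrier M \<Longrightarrow> b \<odot> y \<in> H"
  shows "\<exists>c\<in>R. \<sigma> c = c \<and> (\<forall>y\<in>carrier M. y \<ominus> c \<odot> y \<in> H) \<and>
    (\<forall>y\<in>carrier M. y \<ominus> c \<odot> (t ^^ k) y = \<zero> \<longrightarrow> y = \<zero>)"
proof (cases "\<exists>n>0. b ^ n = 1")
  \<comment> \<open>Here \<open>b\<close> is a unit, so \<open>H\<close> is all of \<open>M\<close>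
    and \<open>c = 0\<close> works.\<close>
  case True
  then obtain n where n: "b ^ Suc n = 1" by (metis gr0_implies_Suc)
  have "y \<in> H" if y: "y \<in> carrier M" for y
  proof -
    have "y = b \<odot> (b ^ n \<odot> y)"
      using smult_mult[OF b(1) R_closed(7)[OF b(1)] y, of n] n smult_1[OF y] by simp
    then show ?thesis using b(4)[OF smult_closed[OF R_closed(7)[OF b(1)] y]] by metis
  qed
  then show ?thesis
    using R_closed(1) by (intro bexI[of _ 0]) (auto simp: \<sigma>_zero smult_0 power_closed M.minus_eq_zero_iff)
next
  case False
  \<comment> \<open>The exponents start at 1 so that \<open>c j - 1\<close> is a multiple of
    \<open>b\<close> and thus maps \<open>M\<close> into \<open>H\<close>. Since \<open>b\<close> is
    not a root of unity, the \<open>c j\<close> are distinct.\<close>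
  define c where "c j = 1 + b ^ Suc j" for j
  have inj_c: "inj c"
  proof (rule injI)
    fix i j :: nat assume "c i = c j"
    then have eq: "b ^ Suc i = b ^ Suc j" by (simp add: c_def)
    have *: False if "i < j" "b ^ Suc i = b ^ Suc j" for i j
    proof -
      have "Suc j = Suc i + (j - i)" using that(1) by simp
      then have "b ^ Suc j = b ^ Suc i * b ^ (j - i)" by (metis Power.power_add)
      then have "b ^ (j - i) = 1" using that(2) b(2) by simp
      then show False using False that(1) by (metis zero_less_diff)
    qed
    show "i = j" using *[of i j] *[of j i] eq by (metis linorder_neqE_nat)
  qed
  have c: "c j \<in> R" "\<sigma> (c j) = c j" for j
    using R_closed(2,3) R_closed(7)[OF b(1), of "Suc j"] b(3) by (simp_all add: c_def \<sigma>_add \<sigma>_one \<sigma>_mult \<sigma>_power)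
  have cH: "y \<ominus> c j \<odot> y \<in> H" if y: "y \<in> carrier M" for j y
  proof -
    have "c j \<odot> y \<ominus> 1 \<odot> y = b \<odot> (b ^ j \<odot> y)"
      using smult_sub[OF c(1) R_closed(2) y, of j] smult_mult[OF b(1) R_closed(7)[OF b(1)] y, of j]
      by (simp add: c_def)
    then have "c j \<odot> y \<ominus> y \<in> H"
      using b(4)[OF smult_closed[OF R_closed(7)[OF b(1)] y]] smult_1[OF y] by metis
    then show ?thesis by (rule H_sym[OF smult_closed[OF c(1) y] y])
  qed
  show ?thesis
  proof (rule ccontr)
    assume neg: "\<not> ?thesis"
    have "\<exists>x\<in>carrier M. x \<ominus> c j \<odot> (t ^^ k) x = \<zero> \<and> x \<noteq> \<zero>" for j
      using neg c[of j] cH[of _ j] by blast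
    then obtain x where x: "\<And>j. x j \<in> carrier M"
      "\<And>j. x j \<ominus> c j \<odot> (t ^^ k) (x j) = \<zero>" "\<And>j. x j \<noteq> \<zero>" by metis
    have eig: "x j = c j \<odot> (t ^^ k) (x j)" for j
      using x(2)[of j] M.minus_eq_zero_iff[OF x(1)[of j] smult_closed[OF c(1) power_closed[OF x(1)]]] by blast
    \<comment> \<open>If every \<open>c j\<close> fails, the rank bound yields a relation among
      \<open>r + 1\<close> of the resulting eigenvectors, against their independence.\<close>
    obtain y where y: "y \<in> {..r} \<rightarrow> R" "\<exists>j\<in>{..r}. y j \<noteq> 0"
      "(\<Oplus> j\<in>{..r}. y j \<odot> x j) = \<zero>"
      using rk[unfolded rank_le_def, rule_format, of "{..r}" x] x(1) by auto
    have "\<forall>j\<in>{..r}. y j = 0"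
      by (rule eigenvectors_independent[OF tf k _ _ _ y(1) x(1) x(3) eig y(3)])
        (use c(1) inj_c in \<open>auto intro: inj_on_subset\<close>)
    then show False using y(2) by blast
  qed
qed

end

section \<open>Separable equivariant maps: identity, composition and reversal\<close>

context finite_order_frobenius
begin

lemma equivariantD:
  assumes "equivariant M t M' t' f"
  shows "x \<in> carrier M \<Longrightarrow> f x \<in> carrier M'"
    "x \<in> carrier M \<Longrightarrow> y \<in> carrier M \<Longrightarrow> f (x \<oplus>\<^bsub>M\<^esub> y) = f x \<oplus>\<^bsub>M'\<^esub> f y"
    "a \<in> R \<Longrightarrow> x \<in> carrier M \<Longrightarrow> f (a \<odot>\<^bsub>M\<^esub> x) = a \<odot>\<^bsub>M'\<^esub> f x"
    "x \<in> carrier M \<Longrightarrow> f (t x) = t' (f x)"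
  using assms by (auto simp: equivariant_def mod_homs_def)

lemma equivariantI:
  assumes "\<And>x. x \<in> carrier M \<Longrightarrow> f x \<in> carrier M'"
    "\<And>x y. x \<in> carrier M \<Longrightarrow> y \<in> carrier M \<Longrightarrow> f (x \<oplus>\<^bsub>M\<^esub> y) = f x \<oplus>\<^bsub>M'\<^esub> f y"
    "\<And>a x. a \<in> R \<Longrightarrow> x \<in> carrier M \<Longrightarrow> f (a \<odot>\<^bsub>M\<^esub> x) = a \<odot>\<^bsub>M'\<^esub> f x"
    "\<And>x. x \<in> carrier M \<Longrightarrow> f (t x) = t' (f x)"
  shows "equivariant M t M' t' f"
  using assms by (auto simp: equivariant_def mod_homs_def)

lemma equivariant_zero:
  assumes "semilinear M t" "semilinear M' t'" "equivariant M t M' t' f"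
  shows "f \<zero>\<^bsub>M\<^esub> = \<zero>\<^bsub>M'\<^esub>"
proof -
  interpret M: semilinear_module R \<sigma> m M t by unfold_locales fact
  interpret M': semilinear_module R \<sigma> m M' t' by unfold_locales fact
  note f = equivariantD[OF assms(3)]
  show ?thesis using f(3)[OF R_closed(1) M.M.zero_closed] f(1)[OF M.M.zero_closed]
    by (simp add: M.smult_0 M'.smult_0)
qed

lemma equivariant_minus:
  assumes "semilinear M t" "semilinear M' t'" "equivariant M t M' t' f" "x \<in> carrier M" "y \<in> carrier M"
  shows "f (x \<ominus>\<^bsub>M\<^esub> y) = f x \<ominus>\<^bsub>M'\<^esub> f y"
proof -
  interpret M: semilinear_module R \<sigma> m M t by unfold_locales fact
  interpret M': semilinear_module R \<sigma> m M' t' by unfold_locales fact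
  note f = equivariantD[OF assms(3)]
  have "f (x \<ominus>\<^bsub>M\<^esub> y) \<oplus>\<^bsub>M'\<^esub> f y = f (x \<ominus>\<^bsub>M\<^esub> y \<oplus>\<^bsub>M\<^esub> y)"
    using f(2)[of "x \<ominus>\<^bsub>M\<^esub> y" y] assms(4,5) by simp
  also have "x \<ominus>\<^bsub>M\<^esub> y \<oplus>\<^bsub>M\<^esub> y = x"
    using assms(4,5) by (simp add: M.M.minus_eq M.M.a_assoc M.M.l_neg)
  finally show ?thesis
    using f(1)[OF assms(4)] f(1)[OF assms(5)] f(1)[OF M.minus_closed[OF assms(4,5)]]
    by (metis M'.M.add.inv_solve_right M'.M.minus_eq)
qed

lemma equivariant_funpow:
  assumes "semilinear M t" "equivariant M t M' t' f" "x \<in> carrier M"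
  shows "f ((t ^^ n) x) = (t' ^^ n) (f x)"
proof -
  interpret M: semilinear_module R \<sigma> m M t by unfold_locales fact
  show ?thesis using equivariantD(4)[OF assms(2) M.power_closed[OF assms(3)]] by (induction n) simp_all
qed

lemma equivariant_image:
  assumes "semilinear M t" "semilinear M' t'" "equivariant M t M' t' f"
  shows "stable_submodule R \<sigma> m M' t' (f ` carrier M)"
proof -
  interpret M: semilinear_module R \<sigma> m M t by unfold_locales fact
  interpret M': semilinear_module R \<sigma> m M' t' by unfold_locales fact
  note f = equivariantD[OF assms(3)]
  show ?thesis
  proof unfold_locales
    show "f ` carrier M \<subseteq> carrier M'" using f(1) by auto
    show "\<zero>\<^bsub>M'\<^esub> \<in> f ` carrier M" using equivariant_zero[OF assms] by (metis M.M.zero_closed imageI)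
    show "x \<oplus>\<^bsub>M'\<^esub> y \<in> f ` carrier M" if "x \<in> f ` carrier M" "y \<in> f ` carrier M" for x y
      using that by (auto simp flip: f(2))
    show "a \<odot>\<^bsub>M'\<^esub> x \<in> f ` carrier M" if "a \<in> R" "x \<in> f ` carrier M" for a x
      using that by (auto simp flip: f(3) intro: M.smult_closed)
    show "t' x \<in> f ` carrier M" if "x \<in> f ` carrier M" for x
      using that by (auto simp flip: f(4) intro: M.t_closed)
  qed
qed

lemma separable_refl:
  assumes "semilinear M t"
  shows "separable M t M t (\<lambda>x. x)"
proof -
  interpret M: semilinear_module R \<sigma> m M t by unfold_locales fact
  show ?thesis
    unfolding separable_def
  proof (intro conjI ballI impI)
    show "equivariant M t M t (\<lambda>x. x)" by (rule equivariantI) auto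
    fix y assume y: "y \<in> carrier M"
    show "\<exists>a\<in>R - {0}. a \<odot>\<^bsub>M\<^esub> y \<in> (\<lambda>x. x) ` carrier M"
      using R_closed(2) y by (intro bexI[of _ 1]) (auto simp: M.smult_1)
    show "\<exists>x\<in>carrier M. y \<ominus>\<^bsub>M\<^esub> t x \<in> (\<lambda>x. x) ` carrier M"
      using y by (intro bexI[of _ y]) (auto simp: M.t_closed)
  qed auto
qed

text \<open>The cokernel of \<open>g \<circ> f\<close> is an extension of the cokernel of
  \<open>g\<close> by that of \<open>f\<close>, embedded via \<open>g\<close>. Bijectivity of the
  semilinear maps on the outer terms passes to the middle one; the proof is this diagram chase on
  elements.\<close>

lemma separable_trans:
  assumes sl: "semilinear M t" "semilinear M' t'" "semilinear M'' t''"
    and f: "separable M t M' t' f" and g: "separable M' t' M'' t'' g"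
  shows "separable M t M'' t'' (g \<circ> f)"
proof -
  interpret M: semilinear_module R \<sigma> m M t by unfold_locales fact
  interpret M': semilinear_module R \<sigma> m M' t' by unfold_locales fact
  interpret M'': semilinear_module R \<sigma> m M'' t'' by unfold_locales fact
  have fe: "equivariant M t M' t' f" and ge: "equivariant M' t' M'' t'' g"
    using f g by (auto simp: separable_def)
  note fD = equivariantD[OF fe] and gD = equivariantD[OF ge]
  have f_inj: "inj_on f (carrier M)" and g_inj: "inj_on g (carrier M')"
    using f g by (auto simp: separable_def)
  have gmem: "g y \<in> (g \<circ> f) ` carrier M \<longleftrightarrow> y \<in> f ` carrier M" if "y \<in> carrier M'" for y
    using that g_inj fD(1) unfolding image_comp[symmetric]
    by (metis (no_types, lifting) image_iff image_subsetI inj_on_image_mem_iff)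
  show ?thesis
    unfolding separable_def
  proof (intro conjI ballI impI)
    show "equivariant M t M'' t'' (g \<circ> f)"
      using fD gD M.t_closed by (intro equivariantI) auto
    show "inj_on (g \<circ> f) (carrier M)"
      using f_inj g_inj fD(1) by (intro comp_inj_on) (auto intro: inj_on_subset)
  next
    fix z assume z: "z \<in> carrier M''"
    obtain a y where a: "a \<in> R - {0}" "a \<odot>\<^bsub>M''\<^esub> z = g y" "y \<in> carrier M'"
      using g z unfolding separable_def by blast
    obtain b x where b: "b \<in> R - {0}" "b \<odot>\<^bsub>M'\<^esub> y = f x" "x \<in> carrier M"
      using f a(3) unfolding separable_def by blast
    have "(b * a) \<odot>\<^bsub>M''\<^esub> z = b \<odot>\<^bsub>M''\<^esub> g y" using M''.smult_mult[of b a z] a b z by simp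
    also have "\<dots> = (g \<circ> f) x" using gD(3)[of b y] a b by simp
    finally show "\<exists>a\<in>R - {0}. a \<odot>\<^bsub>M''\<^esub> z \<in> (g \<circ> f) ` carrier M"
      using a b R_closed(4) by (intro bexI[of _ "b * a"]) auto
  next
    fix z assume z: "z \<in> carrier M''" and tz: "t'' z \<in> (g \<circ> f) ` carrier M"
    then have "t'' z \<in> g ` carrier M'" using fD(1) by auto
    then obtain y where y: "y \<in> carrier M'" "z = g y" using g z unfolding separable_def by blast
    then have "t' y \<in> f ` carrier M" using tz gmem[OF M'.t_closed[OF y(1)]] gD(4)[OF y(1)] by simp
    then have "y \<in> f ` carrier M" using f y unfolding separable_def by blast
    then show "z \<in> (g \<circ> f) ` carrier M" using gmem y by simp
  next
    fix z assume z: "z \<in> carrier M''"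
    obtain v y where v: "v \<in> carrier M''" "z \<ominus>\<^bsub>M''\<^esub> t'' v = g y" "y \<in> carrier M'"
      using g z unfolding separable_def by blast
    obtain w x where w: "w \<in> carrier M'" "y \<ominus>\<^bsub>M'\<^esub> t' w = f x" "x \<in> carrier M"
      using f v(3) unfolding separable_def by blast
    have c: "t'' v \<in> carrier M''" "g w \<in> carrier M''" "t'' (g w) \<in> carrier M''"
      using v w M''.t_closed gD(1) by auto
    \<comment> \<open>\<open>v\<close> is a preimage of \<open>z\<close> modulo the image of
      \<open>g\<close>, with error \<open>g y\<close>. Solving the same problem for \<open>y\<close>
      in \<open>M'\<close> gives the correction \<open>g w\<close>.\<close>
    have "z \<ominus>\<^bsub>M''\<^esub> t'' (v \<oplus>\<^bsub>M''\<^esub> g w) = z \<ominus>\<^bsub>M''\<^esub> t'' v \<ominus>\<^bsub>M''\<^esub> t'' (g w)"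
      using v(1) z c M''.t_add[OF v(1) c(2)] by (simp add: M''.M.minus_eq M''.M.minus_add M''.M.a_assoc)
    also have "\<dots> = g (y \<ominus>\<^bsub>M'\<^esub> t' w)"
      using v(2) gD(4)[OF w(1)] equivariant_minus[OF sl(2,3) ge v(3) M'.t_closed[OF w(1)]] by simp
    finally show "\<exists>v\<in>carrier M''. z \<ominus>\<^bsub>M''\<^esub> t'' v \<in> (g \<circ> f) ` carrier M"
      using v w c by (intro bexI[of _ "v \<oplus>\<^bsub>M''\<^esub> g w"]) auto
  qed
qed

text \<open>The two composites carry the proof. From \<open>f h = 1 - c P\<close> on
  \<open>M'\<close> come injectivity of \<open>h\<close> and torsion of its cokernel; from
  \<open>h f = 1 - c t^k\<close> on \<open>M\<close> comes bijectivity of \<open>t\<close> on that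
  cokernel.\<close>

lemma separable_reverse:
  assumes sl: "semilinear M t" "semilinear M' t'" and sep: "separable M t M' t' f"
    and tf: "torsion_free_module R M'" and rk: "rank_le R M' r"
    and gen: "set ys \<subseteq> carrier M'" "carrier M' = list_span (ring_on R) M' ys"
  shows "\<exists>h. separable M' t' M t h"
proof -
  interpret M: semilinear_module R \<sigma> m M t by unfold_locales fact
  have fe: "equivariant M t M' t' f" using sep by (simp add: separable_def)
  note f = equivariantD[OF fe]
  let ?H = "f ` carrier M"
  interpret M': stable_submodule R \<sigma> m M' t' ?H using sl fe by (rule equivariant_image)
  have f_inj: "inj_on f (carrier M)" using sep by (simp add: separable_def)
  obtain b where b: "b \<in> R" "b \<noteq> 0" "\<And>y. y \<in> carrier M' \<Longrightarrow> b \<odot>\<^bsub>M'\<^esub> y \<in> ?H"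
    using M'.uniform_annihilator[OF gen(1)] sep gen(2) unfolding separable_def by blast
  \<comment> \<open>The norm still annihilates the cokernel, and being \<sigma>-invariant it leads
    to scalars \<open>c\<close> that commute with \<open>t'\<close>.\<close>
  obtain b' where b': "b' \<in> R" "b' \<noteq> 0" "\<sigma> b' = b'" "\<exists>r\<in>R. b' = r * b"
    using invariant_multiple[OF b(1,2)] by blast
  have b'H: "b' \<odot>\<^bsub>M'\<^esub> y \<in> ?H" if "y \<in> carrier M'" for y
    using b'(4) M'.H_smult[OF _ b(3)[OF that]] M'.smult_mult[OF _ b(1) that] by auto
  obtain T where "finite T" "T \<subseteq> carrier M'" "\<And>y. y \<in> carrier M' \<Longrightarrow> \<exists>z\<in>T. y \<ominus>\<^bsub>M'\<^esub> z \<in> ?H"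
    using M'.finite_representatives[OF gen(1) b] gen(2) by auto
  from M'.power_acts_trivially[OF this] sep
  obtain k where k: "k > 0" "m dvd k" "\<And>y. y \<in> carrier M' \<Longrightarrow> (t' ^^ k) y \<ominus>\<^bsub>M'\<^esub> y \<in> ?H"
    unfolding separable_def by blast
  obtain c where c: "c \<in> R" "\<sigma> c = c" "\<And>y. y \<in> carrier M' \<Longrightarrow> y \<ominus>\<^bsub>M'\<^esub> c \<odot>\<^bsub>M'\<^esub> y \<in> ?H"
    and cinj: "\<And>y. y \<in> carrier M' \<Longrightarrow> y \<ominus>\<^bsub>M'\<^esub> c \<odot>\<^bsub>M'\<^esub> (t' ^^ k) y = \<zero>\<^bsub>M'\<^esub> \<Longrightarrow> y = \<zero>\<^bsub>M'\<^esub>"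
    using M'.injective_deformation[OF tf rk k(2) b'(1-3) b'H] by blast
  define w where "w y = c \<odot>\<^bsub>M'\<^esub> (t' ^^ k) y" for y
  define u where "u y = y \<ominus>\<^bsub>M'\<^esub> w y" for y
  have wc: "w y \<in> carrier M'" if "y \<in> carrier M'" for y
    unfolding w_def using that by (intro M'.smult_closed c M'.power_closed)
  have uc: "u y \<in> carrier M'" if "y \<in> carrier M'" for y
    unfolding u_def using that wc by simp
  have wadd: "w (x \<oplus>\<^bsub>M'\<^esub> y) = w x \<oplus>\<^bsub>M'\<^esub> w y" if "x \<in> carrier M'" "y \<in> carrier M'" for x y
    using that unfolding w_def by (simp add: M'.power_add M'.smult_distr c M'.power_closed)
  have wsm: "w (a \<odot>\<^bsub>M'\<^esub> y) = a \<odot>\<^bsub>M'\<^esub> w y" if "a \<in> R" "y \<in> carrier M'" for a y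
    unfolding w_def
    using M'.power_smult[OF that, of k] funpow_\<sigma>_dvd[OF k(2), of a]
      M'.smult_mult[OF c(1) that(1) M'.power_closed[OF that(2)], of k]
      M'.smult_mult[OF that(1) c(1) M'.power_closed[OF that(2)], of k] by (simp add: mult.commute)
  have wt: "w (t' y) = t' (w y)" if "y \<in> carrier M'" for y
    unfolding w_def using M'.t_smult[OF c(1) M'.power_closed[OF that], of k]
    by (simp add: c funpow_swap1)
  have uadd: "u (x \<oplus>\<^bsub>M'\<^esub> y) = u x \<oplus>\<^bsub>M'\<^esub> u y" if "x \<in> carrier M'" "y \<in> carrier M'" for x y
    using that wc wadd[OF that] unfolding u_def
    by (simp add: M'.M.minus_eq M'.M.minus_add M'.M.a_ac)
  have usm: "u (a \<odot>\<^bsub>M'\<^esub> y) = a \<odot>\<^bsub>M'\<^esub> u y" if "a \<in> R" "y \<in> carrier M'" for a y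
    using M'.smult_minus[OF that wc[OF that(2)]] wsm[OF that] by (simp add: u_def)
  have ut: "u (t' y) = t' (u y)" if "y \<in> carrier M'" for y
    using M'.t_minus[OF that wc[OF that]] wt[OF that] by (simp add: u_def)
  have uH: "u y \<in> ?H" if y: "y \<in> carrier M'" for y
  proof -
    have P: "(t' ^^ k) y \<in> carrier M'" by (rule M'.power_closed[OF y])
    \<comment> \<open>With \<open>P\<close> the \<open>k\<close>-th power of \<open>t'\<close>, the
      difference is split at \<open>P y\<close>: both \<open>y - P y\<close> and
      \<open>P y - c P y\<close> lie in the image of \<open>f\<close>.\<close>
    show ?thesis unfolding u_def w_def
      by (rule M'.H_trans[OF y P M'.smult_closed[OF c(1) P] M'.H_sym[OF P y k(3)[OF y]] c(3)[OF P]])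
  qed
  have u0: "y = \<zero>\<^bsub>M'\<^esub>" if "y \<in> carrier M'" "u y = \<zero>\<^bsub>M'\<^esub>" for y
    using cinj that by (simp add: u_def w_def)
  define h where "h y = inv_into (carrier M) f (u y)" for y
  have h: "h y \<in> carrier M" "f (h y) = u y" if "y \<in> carrier M'" for y
    using uH[OF that] by (auto simp: h_def inv_into_into f_inv_into_f)
  have fI: "x = y" if "f x = f y" "x \<in> carrier M" "y \<in> carrier M" for x y
    using f_inj that by (auto simp: inj_on_def)
  have he: "equivariant M' t' M t h"
  proof (rule equivariantI)
    show "h (x \<oplus>\<^bsub>M'\<^esub> y) = h x \<oplus>\<^bsub>M\<^esub> h y" if "x \<in> carrier M'" "y \<in> carrier M'" for x y
      using that h by (intro fI) (simp_all add: f(2) uadd)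
    show "h (a \<odot>\<^bsub>M'\<^esub> x) = a \<odot>\<^bsub>M\<^esub> h x" if "a \<in> R" "x \<in> carrier M'" for a x
      using that h by (intro fI) (simp_all add: f(3) usm M.smult_closed M'.smult_closed)
    show "h (t' x) = t (h x)" if "x \<in> carrier M'" for x
      using that h by (intro fI) (simp_all add: f(4) ut M.t_closed M'.t_closed)
  qed (rule h)
  \<comment> \<open>The counterpart of \<open>w\<close> on \<open>M\<close>. Equivariance gives
    \<open>f v = w f\<close>, and injectivity of \<open>f\<close> then turns
    \<open>f h = 1 - w\<close> into \<open>h f = 1 - v\<close>.\<close>
  define v where "v x = c \<odot>\<^bsub>M\<^esub> (t ^^ k) x" for x
  have vc: "v x \<in> carrier M" if "x \<in> carrier M" for x
    unfolding v_def using that by (intro M.smult_closed c M.power_closed)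
  have fv: "f (v x) = w (f x)" if "x \<in> carrier M" for x
    using that by (simp add: v_def w_def f(3) c M.power_closed equivariant_funpow[OF sl(1) fe])
  have hf: "h (f x) = x \<ominus>\<^bsub>M\<^esub> v x" if "x \<in> carrier M" for x
    using that h[OF f(1)[OF that]] vc[OF that] equivariant_minus[OF sl fe that vc[OF that]]
    by (intro fI) (simp_all add: u_def fv)
  \<comment> \<open>Since \<open>k > 0\<close>, a factor \<open>t\<close> splits off on either side
    of \<open>v\<close>. On the outside it yields surjectivity of \<open>t\<close> on the cokernel
    of \<open>h\<close>, on the inside injectivity.\<close>
  have vt: "v x = t (c \<odot>\<^bsub>M\<^esub> (t ^^ (k - 1)) x)" "v x = c \<odot>\<^bsub>M\<^esub> (t ^^ (k - 1)) (t x)"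
    if "x \<in> carrier M" for x
  proof -
    have k': "k = Suc (k - 1)" using k(1) by simp
    have "(t ^^ k) x = t ((t ^^ (k - 1)) x)" by (subst k') simp
    then show "v x = t (c \<odot>\<^bsub>M\<^esub> (t ^^ (k - 1)) x)"
      using M.t_smult[OF c(1) M.power_closed[OF that]] by (simp add: v_def c)
    have "(t ^^ k) x = (t ^^ (k - 1)) (t x)" by (subst k') (simp add: funpow_swap1)
    then show "v x = c \<odot>\<^bsub>M\<^esub> (t ^^ (k - 1)) (t x)" by (simp add: v_def)
  qed
  interpret hM: stable_submodule R \<sigma> m M t "h ` carrier M'" using sl(2,1) he by (rule equivariant_image)
  have "separable M' t' M t h"
    unfolding separable_def
  proof (intro conjI ballI impI he)
    show "inj_on h (carrier M')"
    proof (rule inj_onI)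
      fix x y assume x: "x \<in> carrier M'" and y: "y \<in> carrier M'" and "h x = h y"
      then have "u x = u y" using h by metis
      then have "u (x \<ominus>\<^bsub>M'\<^esub> y) = \<zero>\<^bsub>M'\<^esub>"
        using M'.additive_minus[of u, OF _ uadd x y] uc x y by (simp add: M'.M.minus_eq M'.M.r_neg)
      then show "x = y" using u0[of "x \<ominus>\<^bsub>M'\<^esub> y"] x y M'.M.minus_eq_zero_iff by simp
    qed
  next
    fix x assume x: "x \<in> carrier M"
    \<comment> \<open>The torsion relation is found in \<open>M'\<close>, for \<open>f x\<close> and
      the endomorphism \<open>u\<close>, and is pulled back along the injective
      \<open>f\<close>.\<close>
    obtain a y where a: "a \<in> R - {0}" "a \<odot>\<^bsub>M'\<^esub> f x = u y" "y \<in> carrier M'"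
      using M'.injective_imp_torsion_coker[OF rk _ uadd usm u0 f(1)[OF x]] uc by blast
    then have "a \<odot>\<^bsub>M\<^esub> x = h y" using x h by (intro fI) (simp_all add: f(3) M.smult_closed)
    then show "\<exists>a\<in>R - {0}. a \<odot>\<^bsub>M\<^esub> x \<in> h ` carrier M'" using a by blast
  next
    fix x assume x: "x \<in> carrier M" and tx: "t x \<in> h ` carrier M'"
    \<comment> \<open>\<open>x\<close> is the sum of \<open>x - v x\<close>, which is
      \<open>h (f x)\<close>, and of \<open>v x\<close>, which is in the image because
      \<open>t x\<close> is.\<close>
    have "v x \<in> h ` carrier M'" using vt(2)[OF x] hM.H_smult[OF c(1) hM.H_power[OF tx]] by simp
    moreover have "x \<ominus>\<^bsub>M\<^esub> v x \<in> h ` carrier M'" using hf[OF x] f(1)[OF x] by (metis imageI)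
    ultimately have "x \<ominus>\<^bsub>M\<^esub> v x \<oplus>\<^bsub>M\<^esub> v x \<in> h ` carrier M'" by (simp add: hM.H_add)
    then show "x \<in> h ` carrier M'" using x vc[OF x] by (simp add: M.M.minus_eq M.M.a_assoc M.M.l_neg)
  next
    fix x assume x: "x \<in> carrier M"
    have "x \<ominus>\<^bsub>M\<^esub> v x \<in> h ` carrier M'" using hf[OF x] f(1)[OF x] by (metis imageI)
    then show "\<exists>y\<in>carrier M. x \<ominus>\<^bsub>M\<^esub> t y \<in> h ` carrier M'"
      using vt(1)[OF x] M.smult_closed[OF c(1) M.power_closed[OF x]] by metis
  qed
  then show ?thesis by blast
qed

end

section \<open>Cokernels and Frobenius pullbacks\<close>

lemma (in abelian_group) minus_zero_right: "x \<in> carrier G \<Longrightarrow> x \<ominus> \<zero> = x"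
  using minus_equality[of \<zero> \<zero>] by (simp add: minus_eq)

locale module_quotient = module R M for R :: "('r, 'z) ring_scheme" and M :: "('r, 'm) module" +
  fixes H
  assumes H_subset: "H \<subseteq> carrier M" and H_zero: "\<zero>\<^bsub>M\<^esub> \<in> H"
    and H_add: "x \<in> H \<Longrightarrow> y \<in> H \<Longrightarrow> x \<oplus>\<^bsub>M\<^esub> y \<in> H"
    and H_smult: "a \<in> carrier R \<Longrightarrow> x \<in> H \<Longrightarrow> a \<odot>\<^bsub>M\<^esub> x \<in> H"
begin

lemma H_uminus: "x \<in> H \<Longrightarrow> \<ominus>\<^bsub>M\<^esub> x \<in> H"
  using H_smult[of "\<ominus>\<^bsub>R\<^esub> \<one>\<^bsub>R\<^esub>" x] smult_l_minus[of "\<one>\<^bsub>R\<^esub>" x] H_subset by auto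

sublocale H: abelian_subgroup H M
proof (rule abelian_subgroupI3)
  show "additive_subgroup H M"
  proof (rule additive_subgroup.intro, rule M.add.subgroupI)
    show "\<ominus>\<^bsub>M\<^esub> x \<in> H" if "x \<in> H" for x using that by (rule H_uminus)
  qed (use H_subset H_zero H_add in auto)
qed (rule M.abelian_group_axioms)

abbreviation "Q \<equiv> quotient_module M H"
abbreviation "co x \<equiv> H +>\<^bsub>M\<^esub> x"

lemma carrier_Q: "carrier Q = co ` carrier M"
  by (auto simp: quotient_module_def A_RCOSETS_def')

lemma co_closed: "x \<in> carrier M \<Longrightarrow> co x \<in> carrier Q"
  by (simp add: carrier_Q)

lemma co_eq:
  assumes "x \<in> carrier M" "y \<in> carrier M"
  shows "co x = co y \<longleftrightarrow> x \<ominus>\<^bsub>M\<^esub> y \<in> H"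
  using r_coset_eq_iff[OF M.a_comm_group H.a_subgroup, of x y] assms
  by (simp add: a_r_coset_def M.minus_eq a_inv_def)

lemma co_add:
  assumes "x \<in> carrier M" "y \<in> carrier M"
  shows "co x \<oplus>\<^bsub>Q\<^esub> co y = co (x \<oplus>\<^bsub>M\<^esub> y)"
  using H.a_rcos_sum[OF assms] by (simp add: quotient_module_def)

lemma co_zero: "\<zero>\<^bsub>Q\<^esub> = co \<zero>\<^bsub>M\<^esub>"
  using M.a_coset_add_zero[OF H_subset] by (simp add: quotient_module_def)

lemma co_self: "x \<in> carrier M \<Longrightarrow> x \<in> co x"
  using H.a_rcos_self by simp

lemma co_mem: "x \<in> carrier M \<Longrightarrow> x' \<in> co x \<Longrightarrow> x' \<in> carrier M \<and> co x' = co x"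
  using M.a_r_coset_subset_G[OF H_subset] M.a_repr_independence[of x' H x] H.a_subgroup
  by blast

text \<open>Operations on cosets are defined as unions over all representatives; this collapses the
  union once the value is independent of the representative.\<close>

lemma co_UN:
  assumes "x \<in> carrier M" "\<And>x'. x' \<in> carrier M \<Longrightarrow> co x' = co x \<Longrightarrow> F x' = F x"
  shows "(\<Union>x'\<in>co x. F x') = F x"
  using co_self[OF assms(1)] co_mem[OF assms(1)] assms(2) by blast

lemma co_smult:
  assumes "a \<in> carrier R" "x \<in> carrier M"
  shows "a \<odot>\<^bsub>Q\<^esub> co x = co (a \<odot>\<^bsub>M\<^esub> x)"
proof -
  have "a \<odot>\<^bsub>Q\<^esub> co x = (\<Union>x'\<in>co x. co (a \<odot>\<^bsub>M\<^esub> x'))" by (simp add: quotient_module_def)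
  also have "\<dots> = co (a \<odot>\<^bsub>M\<^esub> x)"
  proof (rule co_UN[OF assms(2)])
    fix x' assume x': "x' \<in> carrier M" "co x' = co x"
    then have "a \<odot>\<^bsub>M\<^esub> (x' \<ominus>\<^bsub>M\<^esub> x) \<in> H" using co_eq assms by (simp add: H_smult)
    then show "co (a \<odot>\<^bsub>M\<^esub> x') = co (a \<odot>\<^bsub>M\<^esub> x)"
      using x' assms by (simp add: co_eq smult_diff)
  qed
  finally show ?thesis .
qed

lemma co_is_zero: "x \<in> carrier M \<Longrightarrow> co x = \<zero>\<^bsub>Q\<^esub> \<longleftrightarrow> x \<in> H"
  using co_eq[of x "\<zero>\<^bsub>M\<^esub>"] by (simp add: co_zero M.minus_zero_right)

lemma module_Q: "module R Q"
proof (rule moduleI)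
  show "abelian_group Q"
  proof (rule abelian_groupI)
    show "\<exists>y\<in>carrier Q. y \<oplus>\<^bsub>Q\<^esub> x = \<zero>\<^bsub>Q\<^esub>" if x: "x \<in> carrier Q" for x
    proof -
      obtain z where "z \<in> carrier M" "x = co z" using x by (auto simp: carrier_Q)
      then show ?thesis
        by (intro bexI[of _ "co (\<ominus>\<^bsub>M\<^esub> z)"]) (simp_all add: co_add co_zero co_closed M.l_neg)
    qed
  qed (auto simp: carrier_Q co_add co_zero M.a_ac)
qed (auto simp: carrier_Q co_add co_smult is_cring smult_l_distr smult_r_distr smult_assoc1)

end

section \<open>Pullback along a Frobenius of finite order\<close>

context finite_order_frobenius
begin

abbreviation "pb M \<equiv> base_change (ring_on R) (ring_on R) \<sigma> M"
abbreviation "pt M \<equiv> pure_tensor (ring_on R) (ring_on R) \<sigma> M"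

lemma scalar_extension_\<sigma>: "module (ring_on R) M \<Longrightarrow> scalar_extension (ring_on R) (ring_on R) M \<sigma>"
  by (intro scalar_extension.intro scalar_extension_axioms.intro R) (simp_all add: \<sigma>_closed)

definition \<sigma>_inv :: "'e \<Rightarrow> 'e" where
  "\<sigma>_inv = \<sigma> ^^ (m - 1)"

lemma \<sigma>_inv: "\<sigma> (\<sigma>_inv a) = a" "\<sigma>_inv (\<sigma> a) = a"
proof -
  have m: "m = Suc (m - 1)" using \<sigma>_order(1) by simp
  have "\<sigma> (\<sigma>_inv a) = (\<sigma> ^^ m) a" unfolding \<sigma>_inv_def by (subst (2) m) simp
  then show 1: "\<sigma> (\<sigma>_inv a) = a" by (simp add: \<sigma>_order)
  have "\<sigma>_inv (\<sigma> a) = (\<sigma> ^^ m) a" unfolding \<sigma>_inv_def by (subst (2) m) (simp add: funpow_swap1)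
  then show "\<sigma>_inv (\<sigma> a) = a" by (simp add: \<sigma>_order)
qed

lemma \<sigma>_inv_closed: "a \<in> R \<Longrightarrow> \<sigma>_inv a \<in> R"
  by (simp add: \<sigma>_inv_def funpow_\<sigma>_closed)

lemma \<sigma>_inv_hom: "\<sigma>_inv (a + b) = \<sigma>_inv a + \<sigma>_inv b" "\<sigma>_inv (a * b) = \<sigma>_inv a * \<sigma>_inv b" "\<sigma>_inv 1 = 1"
proof -
  have "(\<sigma> ^^ n) (a + b) = (\<sigma> ^^ n) a + (\<sigma> ^^ n) b" "(\<sigma> ^^ n) (a * b) = (\<sigma> ^^ n) a * (\<sigma> ^^ n) b"
    "(\<sigma> ^^ n) 1 = 1" for n
    by (induction n) (simp_all add: \<sigma>_add \<sigma>_mult \<sigma>_one)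
  then show "\<sigma>_inv (a + b) = \<sigma>_inv a + \<sigma>_inv b" "\<sigma>_inv (a * b) = \<sigma>_inv a * \<sigma>_inv b" "\<sigma>_inv 1 = 1"
    by (simp_all add: \<sigma>_inv_def)
qed

text \<open>Because \<sigma> is invertible on \<open>R\<close>, one has x \<otimes> a =
  \<open>\<sigma>_inv a\<close> x \<otimes> 1. The pullback is thus \<open>M\<close> itself with a
  twisted scalar action.\<close>

lemma pullback_bij:
  assumes "module (ring_on R) M"
  shows "bij_betw (\<lambda>x. pt M x 1) (carrier M) (carrier (pb M))"
proof -
  interpret scalar_extension "ring_on R" "ring_on R" M \<sigma> by (rule scalar_extension_\<sigma>[OF assms])
  have "inj_on (\<lambda>x. pt M x 1) (carrier M)"
    using pure_one_inj[of \<sigma>_inv] by (auto intro!: inj_onI simp: \<sigma>_inv \<sigma>_inv_closed \<sigma>_inv_hom mult.commute)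
  moreover have "carrier (pb M) \<subseteq> (\<lambda>x. pt M x 1) ` carrier M"
    using pure_one_surj[of \<sigma>_inv] by (auto simp: \<sigma>_inv \<sigma>_inv_closed)
  moreover have "(\<lambda>x. pt M x 1) ` carrier M \<subseteq> carrier (pb M)"
    using pure_closed R_closed(2) by auto
  ultimately show ?thesis by (auto simp: bij_betw_def)
qed

text \<open>In the pullback, a x \<otimes> 1 = \<sigma>(a) (x \<otimes> 1), so linearity of \<tau>
  there is semilinearity on \<open>M\<close>.\<close>

lemma semilinear_of_pullback_hom:
  assumes M: "module (ring_on R) M" and \<tau>: "\<tau> \<in> mod_homs (ring_on R) (pb M) M"
  shows "semilinear M (\<lambda>x. \<tau> (pt M x 1))"
    and "x \<in> carrier M \<Longrightarrow> a \<in> R \<Longrightarrow> \<tau> (pt M x a) = a \<odot>\<^bsub>M\<^esub> \<tau> (pt M x 1)"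
proof -
  interpret scalar_extension "ring_on R" "ring_on R" M \<sigma> by (rule scalar_extension_\<sigma>[OF M])
  have \<tau>1: "\<tau> Z \<in> carrier M" if "Z \<in> carrier (pb M)" for Z
    using \<tau> that by (auto simp: mod_homs_def)
  have \<tau>2: "\<tau> (Y \<oplus>\<^bsub>pb M\<^esub> Z) = \<tau> Y \<oplus>\<^bsub>M\<^esub> \<tau> Z" if "Y \<in> carrier (pb M)" "Z \<in> carrier (pb M)" for Y Z
    using \<tau> that by (auto simp: mod_homs_def)
  have \<tau>3: "\<tau> (a \<odot>\<^bsub>pb M\<^esub> Z) = a \<odot>\<^bsub>M\<^esub> \<tau> Z" if "a \<in> R" "Z \<in> carrier (pb M)" for a Z
    using \<tau> that by (auto simp: mod_homs_def)
  have pc: "pt M x 1 \<in> carrier (pb M)" if "x \<in> carrier M" for x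
    using pure_closed[OF that] R_closed(2) by simp
  show "semilinear M (\<lambda>x. \<tau> (pt M x 1))"
    unfolding semilinear_def
  proof (intro conjI ballI M)
    show "(\<lambda>x. \<tau> (pt M x 1)) \<in> carrier M \<rightarrow> carrier M" using \<tau>1 pc by auto
    show "\<tau> (pt M (x \<oplus>\<^bsub>M\<^esub> y) 1) = \<tau> (pt M x 1) \<oplus>\<^bsub>M\<^esub> \<tau> (pt M y 1)"
      if "x \<in> carrier M" "y \<in> carrier M" for x y
      using pure_add_left[OF that, of 1] \<tau>2[OF pc pc, OF that] R_closed(2) by simp
    show "\<tau> (pt M (a \<odot>\<^bsub>M\<^esub> x) 1) = \<sigma> a \<odot>\<^bsub>M\<^esub> \<tau> (pt M x 1)" if "a \<in> R" "x \<in> carrier M" for a x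
      using pure_smult[OF that(2), of a] \<tau>3[OF \<sigma>_closed[OF that(1)] pc[OF that(2)]] that by simp
  qed
  show "\<tau> (pt M x a) = a \<odot>\<^bsub>M\<^esub> \<tau> (pt M x 1)" if "x \<in> carrier M" "a \<in> R" for x a
    using smult_pure[of a x 1] \<tau>3[OF that(2) pc[OF that(1)]] that R_closed(2) by simp
qed

lemma pullback_map:
  assumes M: "module (ring_on R) M" "module (ring_on R) M'" and f: "f \<in> mod_homs (ring_on R) M M'"
    and x: "x \<in> carrier M"
  shows "tensor_lift (pb M') (\<lambda>(x, a). pt M' (f x) a) (pt M x 1) = pt M' (f x) 1"
proof -
  interpret scalar_extension "ring_on R" "ring_on R" M \<sigma> by (rule scalar_extension_\<sigma>[OF M(1)])
  interpret M': scalar_extension "ring_on R" "ring_on R" M' \<sigma> by (rule scalar_extension_\<sigma>[OF M(2)])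
  have "respects_tensor (pb M') (\<lambda>(x, a). pt M' (f x) a)"
    unfolding respects_tensor_def
  proof (intro conjI ballI M'.abelian_group_T)
    show "(\<lambda>(x, a). pt M' (f x) a) \<in> gens \<rightarrow> carrier (pb M')"
      using f by (auto simp: mod_homs_def intro!: M'.pure_closed)
  qed (use f in \<open>auto simp: mod_homs_def Pi_iff M'.pure_add_left M'.pure_balanced
        M'.pure_add_right[simplified]\<close>)
  then show ?thesis using tensor_lift_pure[of _ "\<lambda>(x, a). pt M' (f x) a" x 1] x R_closed(2) by simp
qed

text \<open>Composed with the bijection from the quotient to its pullback, the induced map sends the
  coset of \<open>x\<close> to that of \<open>t x\<close>. The two conditions on the right are
  injectivity and surjectivity of this map.\<close>

lemma induced_coker_bij_iff:
  assumes sl: "semilinear M t" and M: "module (ring_on R) M" and \<tau>: "\<tau> \<in> mod_homs (ring_on R) (pb M) M"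
    and t: "t = (\<lambda>x. \<tau> (pt M x 1))" and H: "stable_submodule R \<sigma> m M t H"
  shows "bij_betw (tensor_lift (quotient_module M H) (\<lambda>(Z, a). \<Union>x\<in>Z. H +>\<^bsub>M\<^esub> \<tau> (pt M x a)))
      (carrier (pb (quotient_module M H))) (carrier (quotient_module M H)) \<longleftrightarrow>
    (\<forall>y\<in>carrier M. t y \<in> H \<longrightarrow> y \<in> H) \<and> (\<forall>y\<in>carrier M. \<exists>x\<in>carrier M. y \<ominus>\<^bsub>M\<^esub> t x \<in> H)"
proof -
  interpret stable_submodule R \<sigma> m M t H by (rule H)
  interpret Q: module_quotient "ring_on R" M H
    by (intro module_quotient.intro module_quotient_axioms.intro M H_subset H_zero)
      (simp_all add: H_add H_smult)
  let ?Q = "quotient_module M H"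
  interpret E: scalar_extension "ring_on R" "ring_on R" ?Q \<sigma> by (rule scalar_extension_\<sigma>[OF Q.module_Q])
  define F where "F = (\<lambda>(Z, a). \<Union>x\<in>Z. H +>\<^bsub>M\<^esub> \<tau> (pt M x a))"
  have F: "F (Q.co x, a) = Q.co (a \<odot>\<^bsub>M\<^esub> t x)" if x: "x \<in> carrier M" and a: "a \<in> R" for x a
  proof -
    have "F (Q.co x, a) = (\<Union>x'\<in>Q.co x. Q.co (\<tau> (pt M x' a)))" by (simp add: F_def)
    also have "\<dots> = Q.co (\<tau> (pt M x a))"
    proof (rule Q.co_UN[OF x])
      fix x' assume x': "x' \<in> carrier M" "Q.co x' = Q.co x"
      \<comment> \<open>Stability of \<open>H\<close> under \<open>t\<close> and scalars makes the
        coset of \<tau>(x \<otimes> a) independent of the representative \<open>x\<close>.\<close>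
      then have "a \<odot>\<^bsub>M\<^esub> t (x' \<ominus>\<^bsub>M\<^esub> x) \<in> H" using Q.co_eq x a by (simp add: H_smult H_stable)
      then show "Q.co (\<tau> (pt M x' a)) = Q.co (\<tau> (pt M x a))"
        using semilinear_of_pullback_hom(2)[OF M \<tau> _ a] x x' t_closed a
        by (simp add: Q.co_eq smult_closed t_minus smult_minus flip: fun_cong[OF t])
    qed
    also have "\<tau> (pt M x a) = a \<odot>\<^bsub>M\<^esub> t x"
      using semilinear_of_pullback_hom(2)[OF M \<tau> x a] by (simp add: t)
    finally show ?thesis .
  qed
  have "E.respects_tensor ?Q F"
    unfolding E.respects_tensor_def
  proof (intro conjI ballI)
    show "abelian_group ?Q" using Q.module_Q by (simp add: module_def)
    show "F \<in> E.gens \<rightarrow> carrier ?Q"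
      using F by (auto simp: Q.carrier_Q smult_closed t_closed)
  next
    fix Y Z a assume "Y \<in> carrier ?Q" "Z \<in> carrier ?Q" and a: "a \<in> carrier (ring_on R)"
    then obtain y z where "y \<in> carrier M" "z \<in> carrier M" "Y = Q.co y" "Z = Q.co z"
      by (auto simp: Q.carrier_Q)
    then show "F (Y \<oplus>\<^bsub>?Q\<^esub> Z, a) = F (Y, a) \<oplus>\<^bsub>?Q\<^esub> F (Z, a)"
      using a by (simp add: Q.co_add F t_add smult_distr t_closed smult_closed)
  next
    fix Y a b assume "Y \<in> carrier ?Q" and a: "a \<in> carrier (ring_on R)" "b \<in> carrier (ring_on R)"
    then obtain y where "y \<in> carrier M" "Y = Q.co y"
      by (auto simp: Q.carrier_Q)
    then show "F (Y, a \<oplus>\<^bsub>ring_on R\<^esub> b) = F (Y, a) \<oplus>\<^bsub>?Q\<^esub> F (Y, b)"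
      using a R_closed(3) by (simp add: Q.co_add F smult_add t_closed smult_closed)
  next
    fix c Y a assume "Y \<in> carrier ?Q" and a: "c \<in> carrier (ring_on R)" "a \<in> carrier (ring_on R)"
    then obtain y where "y \<in> carrier M" "Y = Q.co y"
      by (auto simp: Q.carrier_Q)
    then show "F (c \<odot>\<^bsub>?Q\<^esub> Y, a) = F (Y, \<sigma> c \<otimes>\<^bsub>ring_on R\<^esub> a)"
      using a R_closed(4)[OF \<sigma>_closed] smult_mult[of a "\<sigma> c" "t y"] \<sigma>_closed t_closed
      by (simp add: Q.co_smult F t_smult smult_closed mult.commute)
  qed
  note lift = E.tensor_lift_pure[OF this, of _ 1]
  \<comment> \<open>Precomposing with the bijection given by Z \<otimes> 1 replaces the source, a
    pullback of a quotient, by the quotient itself.\<close>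
  define \<Phi> where "\<Phi> = tensor_lift ?Q F \<circ> (\<lambda>Z. pt ?Q Z 1)"
  have \<Phi>: "\<Phi> (Q.co x) = Q.co (t x)" if "x \<in> carrier M" for x
    using lift[OF Q.co_closed[OF that]] F[OF that R_closed(2)] R_closed(2) t_closed[OF that]
    by (simp add: \<Phi>_def smult_1)
  have "bij_betw (tensor_lift ?Q F) (carrier (pb ?Q)) (carrier ?Q) \<longleftrightarrow> bij_betw \<Phi> (carrier ?Q) (carrier ?Q)"
    unfolding \<Phi>_def by (rule bij_betw_comp_iff[OF pullback_bij[OF Q.module_Q]])
  also have "\<dots> \<longleftrightarrow> inj_on \<Phi> (carrier ?Q) \<and> carrier ?Q \<subseteq> \<Phi> ` carrier ?Q"
    using \<Phi> by (auto simp: bij_betw_def Q.carrier_Q t_closed)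
  also have "inj_on \<Phi> (carrier ?Q) \<longleftrightarrow> (\<forall>y\<in>carrier M. t y \<in> H \<longrightarrow> y \<in> H)"
  proof
    assume inj: "inj_on \<Phi> (carrier ?Q)"
    show "\<forall>y\<in>carrier M. t y \<in> H \<longrightarrow> y \<in> H"
    proof (intro ballI impI)
      fix y assume y: "y \<in> carrier M" "t y \<in> H"
      have "\<Phi> (Q.co y) = \<Phi> (Q.co \<zero>\<^bsub>M\<^esub>)"
        using y H_stable[OF H_zero] t_closed Q.co_is_zero[of "t y"] Q.co_is_zero[of "t \<zero>\<^bsub>M\<^esub>"]
        by (simp add: \<Phi>)
      then have "Q.co y = Q.co \<zero>\<^bsub>M\<^esub>" using inj y by (simp add: inj_on_def Q.co_closed)
      then show "y \<in> H" using Q.co_is_zero[OF y(1)] Q.co_zero by simp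
    qed
  next
    assume inj: "\<forall>y\<in>carrier M. t y \<in> H \<longrightarrow> y \<in> H"
    show "inj_on \<Phi> (carrier ?Q)"
    proof (rule inj_onI)
      fix Y Z assume "Y \<in> carrier ?Q" "Z \<in> carrier ?Q" and eq: "\<Phi> Y = \<Phi> Z"
      then obtain y z where yz: "y \<in> carrier M" "z \<in> carrier M" "Y = Q.co y" "Z = Q.co z"
        by (auto simp: Q.carrier_Q)
      then have "t (y \<ominus>\<^bsub>M\<^esub> z) \<in> H" using eq by (simp add: \<Phi> Q.co_eq t_closed t_minus)
      then show "Y = Z" using inj yz minus_closed[OF yz(1,2)] by (simp add: Q.co_eq)
    qed
  qed
  also have "carrier ?Q \<subseteq> \<Phi> ` carrier ?Q \<longleftrightarrow> (\<forall>y\<in>carrier M. \<exists>x\<in>carrier M. y \<ominus>\<^bsub>M\<^esub> t x \<in> H)"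
  proof -
    have "\<Phi> ` carrier ?Q = (\<lambda>x. Q.co (t x)) ` carrier M"
      unfolding Q.carrier_Q image_image by (intro image_cong refl \<Phi>)
    then have "carrier ?Q \<subseteq> \<Phi> ` carrier ?Q \<longleftrightarrow> (\<forall>y\<in>carrier M. \<exists>x\<in>carrier M. Q.co y = Q.co (t x))"
      by (simp add: Q.carrier_Q image_subset_iff) (simp add: image_iff)
    then show ?thesis by (simp add: Q.co_eq t_closed cong: ball_cong bex_cong)
  qed
  finally show ?thesis by (simp add: F_def)
qed

end

section \<open>The base ring and its Frobenius\<close>

lemma full_ring_homD:
  assumes "f \<in> ring_hom (full_ring :: 'a::field ring) (full_ring :: 'b::field ring)"
  shows "f (x + y) = f x + f y" "f (x * y) = f x * f y" "f 1 = 1" "f 0 = 0"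
    "f (- x) = - f x" "f (x - y) = f x - f y" "f (of_nat n) = of_nat n" "f (x ^ n) = f x ^ n"
    "f x = 0 \<longleftrightarrow> x = 0"
proof -
  show add: "f (x + y) = f x + f y" for x y using ring_hom_add[OF assms, of x y] by simp
  show mult: "f (x * y) = f x * f y" for x y using ring_hom_mult[OF assms, of x y] by simp
  show one: "f 1 = 1" using ring_hom_one[OF assms] by simp
  show zero: "f 0 = 0" using add[of 0 0] by (metis add_0 add_cancel_right_left)
  show neg: "f (- x) = - f x" for x using add[of x "- x"] zero by (simp add: eq_neg_iff_add_eq_0 add.commute)
  show "f (x - y) = f x - f y" using add[of x "- y"] neg by simp
  show "f (of_nat n) = of_nat n" by (induction n) (simp_all add: add one zero)
  show "f (x ^ n) = f x ^ n" by (induction n) (simp_all add: mult one)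
  show "f x = 0 \<longleftrightarrow> x = 0"
  proof
    assume "f x = 0"
    then have "x \<noteq> 0 \<Longrightarrow> f 1 = 0" using mult[of x "inverse x"] by simp
    then show "x = 0" using one by auto
  qed (simp add: zero)
qed

lemma full_ring_a_inv [simp]: "\<ominus>\<^bsub>full_ring\<^esub> x = - (x :: 'a::field)"
proof -
  interpret cring "full_ring :: 'a ring" by (rule cring_full_ring)
  have "x + \<ominus>\<^bsub>full_ring\<^esub> x = 0" using r_neg[of x] by simp
  then show ?thesis by (metis neg_eq_iff_add_eq_0)
qed

text \<open>Multiplication by a nonzero \<open>a\<close> permutes the nonzero elements; comparing
  their products gives Fermat's identity for the exponent q - 1.\<close>

lemma finite_field_power_card:
  fixes a :: "'f::{finite,field}"
  shows "a ^ card (UNIV :: 'f set) = a"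
proof (cases "a = 0")
  case False
  have "(\<Prod>y\<in>UNIV - {0 :: 'f}. a * y) = \<Prod>(UNIV - {0})"
    by (rule prod.reindex_bij_witness[of _ "\<lambda>y. y / a" "\<lambda>y. a * y"]) (use False in auto)
  then have "a ^ (card (UNIV :: 'f set) - 1) * \<Prod>(UNIV - {0}) = \<Prod>(UNIV - {0 :: 'f})"
    by (simp add: prod.distrib)
  moreover have "\<Prod>(UNIV - {0 :: 'f}) \<noteq> 0" by simp
  ultimately have "a ^ (card (UNIV :: 'f set) - 1) = 1" by simp
  then have "a ^ Suc (card (UNIV :: 'f set) - 1) = a" by simp
  then show ?thesis using finite_UNIV_card_ge_0[where 'a = 'f] by simp
qed (simp add: finite_UNIV_card_ge_0)

text \<open>The polynomial \<open>(X + 1)\<^sup>q - X\<^sup>q - 1\<close> has degree less than \<open>q\<close> and vanishes on the field.\<close>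

lemma of_nat_choose_card:
  assumes "0 < i" "i < card (UNIV :: 'f set)"
  shows "of_nat (card (UNIV :: 'f set) choose i) = (0 :: 'f::{finite,field})"
proof -
  let ?q = "card (UNIV :: 'f set)"
  define g :: "'f poly" where "g = (\<Sum>i\<in>{0<..<?q}. monom (of_nat (?q choose i)) i)"
  have coeff: "coeff g i = (if 0 < i \<and> i < ?q then of_nat (?q choose i) else 0)" for i
    by (auto simp: g_def coeff_sum sum.delta)
  have q: "?q > 0" by (simp add: finite_UNIV_card_ge_0)
  have deg: "degree g < ?q" using q by (intro degree_lessI) (auto simp: coeff)
  have zero: "poly g a = 0" for a
  proof -
    have "(a + 1) ^ ?q = (\<Sum>i\<le>?q. of_nat (?q choose i) * a ^ i)"
      using binomial_ring[of a 1 ?q] by simp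
    also have "{..?q} = insert 0 (insert ?q {0<..<?q})" using q by auto
    also have "(\<Sum>i\<in>\<dots>. of_nat (?q choose i) * a ^ i) = 1 + a ^ ?q + poly g a"
      using q by (simp add: g_def poly_sum poly_monom)
    finally show ?thesis by (simp add: finite_field_power_card add.commute)
  qed
  have "g = 0"
  proof (rule ccontr)
    assume "g \<noteq> 0"
    then have "card {a. poly g a = 0} \<le> degree g" by (rule card_poly_roots_bound)
    then show False using deg zero by simp
  qed
  then show ?thesis using coeff[of i] assms by simp
qed

text \<open>The inner binomial coefficients vanish in \<open>'f\<close>, and the homomorphism
  \<open>f\<close> carries this to \<open>'l\<close>.\<close>

lemma frobenius_add:
  fixes f :: "'f::{finite,field} \<Rightarrow> 'l::field" and x y :: 'l
  assumes "f \<in> ring_hom full_ring full_ring"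
  shows "(x + y) ^ card (UNIV :: 'f set) = x ^ card (UNIV :: 'f set) + y ^ card (UNIV :: 'f set)"
proof -
  let ?q = "card (UNIV :: 'f set)"
  have z: "of_nat (?q choose i) = (0 :: 'l)" if "0 < i" "i < ?q" for i
    using full_ring_homD(4,7)[OF assms] of_nat_choose_card[OF that] by metis
  have q: "?q > 0" by (simp add: finite_UNIV_card_ge_0)
  have "(x + y) ^ ?q = (\<Sum>i\<le>?q. of_nat (?q choose i) * x ^ i * y ^ (?q - i))" by (rule binomial_ring)
  also have "\<dots> = (\<Sum>i\<in>{0, ?q}. of_nat (?q choose i) * x ^ i * y ^ (?q - i))"
    using z by (intro sum.mono_neutral_right) auto
  finally show ?thesis using q by (simp add: add.commute)
qed

text \<open>There are finitely many self-maps of a finite type, so two powers of \<open>g\<close>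
  coincide; injectivity cancels the smaller one.\<close>

lemma funpow_eq_id_of_inj:
  fixes g :: "'l::finite \<Rightarrow> 'l"
  assumes "inj g"
  obtains m where "m > 0" "g ^^ m = id"
proof -
  have "\<not> inj (\<lambda>n::nat. g ^^ n)"
    using finite_imageD[of "\<lambda>n::nat. g ^^ n" UNIV] infinite_UNIV_nat by auto
  then obtain i j where ij: "i < j" "g ^^ i = g ^^ j"
    unfolding inj_def by (metis nat_neq_iff)
  have "inj (g ^^ i)" using assms by (induction i) (auto intro: inj_compose)
  moreover have "(g ^^ i) ((g ^^ (j - i)) x) = (g ^^ i) x" for x
  proof -
    have "(g ^^ i) ((g ^^ (j - i)) x) = (g ^^ (i + (j - i))) x" by (simp only: funpow_add comp_apply)
    then show ?thesis using ij by simp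
  qed
  ultimately have "(g ^^ (j - i)) x = x" for x by (meson injD)
  then show ?thesis using that[of "j - i"] ij by (simp add: fun_eq_iff)
qed

section \<open>Tensor products with \<open>L\<close> inside the function field, and the Frobenius on
  it\<close>

locale base_curve =
  fixes B :: "('f::{finite,field}, 'k::field, 'l::{finite,field}, 'e::field) base_data"
  assumes base: "base_setting B"
begin

lemma homs:
  "constK B \<in> ring_hom full_ring full_ring" "constL B \<in> ring_hom full_ring full_ring"
  "fromK B \<in> ring_hom full_ring full_ring" "fromL B \<in> ring_hom full_ring full_ring"
  using base by (simp_all add: base_setting_def function_field_def)

lemmas cK = full_ring_homD[OF homs(1)]
lemmas cL = full_ring_homD[OF homs(2)]
lemmas fK = full_ring_homD[OF homs(3)]
lemmas fL = full_ring_homD[OF homs(4)]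

lemma fK_fL: "fromK B (constK B a) = fromL B (constL B a)"
  using base by (simp add: base_setting_def)

text \<open>Arguing for an arbitrary subspace treats \<open>K \<otimes> L\<close> and
  \<open>A \<otimes> L\<close> at once.\<close>

definition subspace :: "'k set \<Rightarrow> bool" where
  "subspace S \<longleftrightarrow> 0 \<in> S \<and> (\<forall>x\<in>S. \<forall>y\<in>S. x + y \<in> S) \<and> (\<forall>a. \<forall>x\<in>S. constK B a * x \<in> S)"

lemma scalar_extension_L:
  assumes "subspace S"
  shows "scalar_extension full_ring full_ring (const_module B S) (constL B)"
proof -
  have neg: "- x \<in> S" if "x \<in> S" for x
    using assms that cK(5)[of 1] cK(3) unfolding subspace_def by (metis mult_minus1)
  have "abelian_group (const_module B S)"
  proof (rule abelian_groupI)
    show "\<exists>y\<in>carrier (const_module B S). y \<oplus>\<^bsub>const_module B S\<^esub> x = \<zero>\<^bsub>const_module B S\<^esub>"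
      if "x \<in> carrier (const_module B S)" for x
      using that neg[of x] by (intro bexI[of _ "- x"]) (simp_all add: const_module_def)
  qed (use assms in \<open>auto simp: const_module_def subspace_def add_ac\<close>)
  then have "module full_ring (const_module B S)"
    by (rule moduleI[OF cring_full_ring])
      (use assms in \<open>auto simp: const_module_def subspace_def cK algebra_simps\<close>)
  then show ?thesis
    by (intro scalar_extension.intro scalar_extension_axioms.intro cring_full_ring) simp_all
qed

text \<open>The function \<open>g\<close> is left open to cover two maps: \<open>fromL B\<close>
  gives the canonical map, and \<open>fromL B\<close> after the q-Frobenius gives \<sigma>.\<close>

lemma respects_bilinear:
  fixes g :: "'l \<Rightarrow> 'e"
  assumes "subspace S" "\<And>a b. g (a + b) = g a + g b" "\<And>a b. g (constL B a * b) = fromK B (constK B a) * g b"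
  shows "scalar_extension.respects_tensor full_ring full_ring (const_module B S) (constL B) full_ring
    (\<lambda>(x, b). fromK B x * g b)"
proof -
  interpret scalar_extension full_ring full_ring "const_module B S" "constL B"
    by (rule scalar_extension_L[OF assms(1)])
  show ?thesis
    unfolding respects_tensor_def
    using ring.axioms(1)[OF cring.axioms(1)[OF cring_full_ring]]
    by (auto simp: const_module_def fK assms(2,3) distrib_left distrib_right mult.assoc mult.left_commute)
qed

lemma subspace_UNIV: "subspace UNIV"
  by (simp add: subspace_def)

lemma canonical_hom:
  assumes "subspace S"
  shows "\<And>x b. x \<in> S \<Longrightarrow>
      canonical_map B (pure_tensor full_ring full_ring (constL B) (const_module B S) x b) = fromK B x * fromL B b"
    "canonical_map B \<zero>\<^bsub>tensor_L B S\<^esub> = 0"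
    "\<And>Y Z. Y \<in> carrier (tensor_L B S) \<Longrightarrow> Z \<in> carrier (tensor_L B S) \<Longrightarrow>
      canonical_map B (Y \<ominus>\<^bsub>tensor_L B S\<^esub> Z) = canonical_map B Y - canonical_map B Z"
proof -
  interpret scalar_extension full_ring full_ring "const_module B S" "constL B"
    by (rule scalar_extension_L[OF assms(1)])
  have r: "respects_tensor full_ring (\<lambda>(x, b). fromK B x * fromL B b)"
    by (rule respects_bilinear[OF assms]) (simp_all add: fL fK_fL)
  show "canonical_map B (pure x b) = fromK B x * fromL B b" if "x \<in> S" for x b
    using tensor_lift_pure[OF r, of x b] that by (simp add: canonical_map_def const_module_def)
  show "canonical_map B \<zero>\<^bsub>tensor_L B S\<^esub> = 0"
    using tensor_lift_zero[OF r] by (simp add: canonical_map_def tensor_L_def)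
  show "canonical_map B (Y \<ominus>\<^bsub>tensor_L B S\<^esub> Z) = canonical_map B Y - canonical_map B Z"
    if "Y \<in> carrier (tensor_L B S)" "Z \<in> carrier (tensor_L B S)" for Y Z
    using tensor_lift_diff[OF r, of Y Z] that
    by (simp add: canonical_map_def tensor_L_def a_minus_def)
qed

definition span_L :: "'k set \<Rightarrow> 'e set" where
  "span_L S = canonical_map B ` carrier (tensor_L B S)"

lemma span_L_induct [consumes 2, case_names zero prod diff]:
  assumes S: "subspace S" and z: "z \<in> span_L S"
    and "P 0" "\<And>x b. x \<in> S \<Longrightarrow> P (fromK B x * fromL B b)" "\<And>y z. P y \<Longrightarrow> P z \<Longrightarrow> P (y - z)"
  shows "P z"
proof -
  interpret scalar_extension full_ring full_ring "const_module B S" "constL B"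
    by (rule scalar_extension_L[OF S])
  note can = canonical_hom[OF S, unfolded tensor_L_def]
  obtain Z where Z: "Z \<in> carrier T" "z = canonical_map B Z" using z by (auto simp: span_L_def tensor_L_def)
  from Z(1) have "P (canonical_map B Z)"
  proof (induction rule: T_induct)
    case (pure x s)
    then have "x \<in> S" by (simp add: const_module_def)
    then show ?case using assms(4)[of x s] can(1)[of x s] by simp
  qed (simp_all add: can assms)
  then show ?thesis using Z by simp
qed

lemma span_L_prod:
  assumes S: "subspace S" and x: "x \<in> S"
  shows "fromK B x * fromL B b \<in> span_L S"
proof -
  interpret scalar_extension full_ring full_ring "const_module B S" "constL B"
    by (rule scalar_extension_L[OF S])
  have "pure x b \<in> carrier T" using x by (intro pure_closed) (simp_all add: const_module_def)
  then show ?thesis using canonical_hom(1)[OF S x, of b] unfolding span_L_def tensor_L_def by (metis imageI)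
qed

lemma span_L_diff:
  assumes S: "subspace S" and "y \<in> span_L S" "z \<in> span_L S"
  shows "y - z \<in> span_L S"
proof -
  interpret scalar_extension full_ring full_ring "const_module B S" "constL B"
    by (rule scalar_extension_L[OF S])
  obtain Y Z where "Y \<in> carrier T" "Z \<in> carrier T" "y = canonical_map B Y" "z = canonical_map B Z"
    using assms by (auto simp: span_L_def tensor_L_def)
  then show ?thesis
    using canonical_hom(3)[OF S, of Y Z] T.minus_closed[of Y Z] unfolding span_L_def tensor_L_def
    by (metis imageI)
qed

lemma span_L_zero: "subspace S \<Longrightarrow> 0 \<in> span_L S"
  using span_L_prod[of S 0 0] by (simp add: subspace_def fK)

lemma span_L_UNIV: "span_L UNIV = UNIV"
  using base by (simp add: base_setting_def span_L_def bij_betw_def)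

lemmas E_induct = span_L_induct[OF subspace_UNIV, unfolded span_L_UNIV, OF UNIV_I, case_names zero prod diff]

text \<open>The q-Frobenius on \<open>L\<close> is additive and fixes the image of
  \<open>'f\<close>, so it induces a map on \<open>K \<otimes> L\<close>. Bijectivity of the
  canonical map carries this over to the function field.\<close>

lemma sigma_exists: "\<exists>s. s \<in> ring_hom full_ring full_ring \<and> (\<forall>x. s (fromK B x) = fromK B x) \<and>
     (\<forall>b. s (fromL B b) = fromL B (b ^ card (UNIV :: 'f set)))"
proof -
  interpret scalar_extension full_ring full_ring "const_module B UNIV" "constL B"
    by (rule scalar_extension_L[OF subspace_UNIV])
  let ?h = "\<lambda>(x, b). fromK B x * fromL B (b ^ card (UNIV :: 'f set))"
  have r: "respects_tensor full_ring ?h"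
  proof (rule respects_bilinear[OF subspace_UNIV])
    show "fromL B ((a + b) ^ card (UNIV :: 'f set)) = fromL B (a ^ card (UNIV :: 'f set)) + fromL B (b ^ card (UNIV :: 'f set))" for a b
      by (simp add: frobenius_add[OF homs(2)] fL)
    show "fromL B ((constL B a * b) ^ card (UNIV :: 'f set)) = fromK B (constK B a) * fromL B (b ^ card (UNIV :: 'f set))" for a b
      using cL(8)[of a "card (UNIV :: 'f set)"] by (simp add: power_mult_distrib fL fK_fL finite_field_power_card)
  qed
  have bij: "bij_betw (canonical_map B) (carrier T) UNIV"
    using base by (simp add: base_setting_def tensor_L_def)
  define s where "s z = tensor_lift full_ring ?h (inv_into (carrier T) (canonical_map B) z)" for z
  have s: "s (canonical_map B Z) = tensor_lift full_ring ?h Z" if "Z \<in> carrier T" for Z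
    using bij that by (simp add: s_def bij_betw_def)
  have s_prod: "s (fromK B x * fromL B b) = fromK B x * fromL B (b ^ card (UNIV :: 'f set))" for x b
  proof -
    have "pure x b \<in> carrier T" by (intro pure_closed) (simp_all add: const_module_def)
    then show ?thesis
      using s[of "pure x b"] canonical_hom(1)[OF subspace_UNIV, of x b] tensor_lift_pure[OF r, of x b]
      by (simp add: const_module_def)
  qed
  have s_diff: "s (y - z) = s y - s z" for y z
  proof -
    have "y \<in> canonical_map B ` carrier T" "z \<in> canonical_map B ` carrier T"
      using bij by (auto simp: bij_betw_def)
    then obtain Y Z where Z: "Y \<in> carrier T" "Z \<in> carrier T" "y = canonical_map B Y" "z = canonical_map B Z"
      by blast
    have "s (canonical_map B (Y \<ominus>\<^bsub>T\<^esub> Z)) = s (canonical_map B Y) - s (canonical_map B Z)"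
      using s[OF Z(1)] s[OF Z(2)] s[OF T.minus_closed[OF Z(1,2)]] tensor_lift_diff[OF r Z(1,2)]
      by (simp add: a_minus_def)
    then show ?thesis
      using canonical_hom(3)[OF subspace_UNIV, unfolded tensor_L_def, OF Z(1,2)] Z(3,4) by simp
  qed
  have s0: "s 0 = 0" using s_diff[of 0 0] by simp
  have s_add: "s (y + z) = s y + s z" for y z
    using s_diff[of y "- z"] s_diff[of 0 z] s0 by simp
  \<comment> \<open>Both sides are additive in each factor, so the claim reduces to the generators
    \<open>fromK B x * fromL B b\<close>.\<close>
  have s_mult: "s (y * z) = s y * s z" for y z
  proof (induction y rule: E_induct)
    case (prod x b)
    show ?case
    proof (induction z rule: E_induct)
      case (prod x' b')
      have "fromK B x * fromL B b * (fromK B x' * fromL B b') = fromK B (x * x') * fromL B (b * b')"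
        by (simp add: fK fL)
      then have "s (fromK B x * fromL B b * (fromK B x' * fromL B b'))
          = fromK B (x * x') * fromL B ((b * b') ^ card (UNIV :: 'f set))" by (simp only: s_prod)
      then show ?case by (simp only: s_prod power_mult_distrib fK(2) fL(2) mult_ac)
    qed (simp_all add: s0 s_diff right_diff_distrib)
  qed (simp_all add: s0 s_diff left_diff_distrib)
  have sK: "s (fromK B x) = fromK B x" for x using s_prod[of x 1] by (simp add: fL)
  have sL: "s (fromL B b) = fromL B (b ^ card (UNIV :: 'f set))" for b using s_prod[of 1 b] by (simp add: fK)
  have "s \<in> ring_hom full_ring full_ring"
    using sK[of 1] by (intro ring_hom_memI) (simp_all add: s_add s_mult fK)
  then show ?thesis using sK sL by blast
qed

text \<open>Any two candidates for the \<open>THE\<close> in the definition agree on the generators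
  \<open>fromK B x * fromL B b\<close>, hence everywhere.\<close>

lemma sigma: "sigma B \<in> ring_hom full_ring full_ring" "sigma B (fromK B x) = fromK B x"
  "sigma B (fromL B b) = fromL B (b ^ card (UNIV :: 'f set))"
proof -
  have "\<exists>!s. s \<in> ring_hom full_ring full_ring \<and> (\<forall>x. s (fromK B x) = fromK B x) \<and>
     (\<forall>b. s (fromL B b) = fromL B (b ^ card (UNIV :: 'f set)))"
  proof (rule ex_ex1I[OF sigma_exists], elim conjE)
    fix s s' assume s: "s \<in> ring_hom full_ring full_ring" "\<forall>x. s (fromK B x) = fromK B x" "\<forall>b. s (fromL B b) = fromL B (b ^ card (UNIV :: 'f set))"
      and s': "s' \<in> ring_hom full_ring full_ring" "\<forall>x. s' (fromK B x) = fromK B x" "\<forall>b. s' (fromL B b) = fromL B (b ^ card (UNIV :: 'f set))"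
    note h = full_ring_homD[OF s(1)] and h' = full_ring_homD[OF s'(1)]
    show "s = s'"
    proof
      fix z show "s z = s' z"
        by (induction z rule: E_induct) (simp_all add: h(2,4,6) h'(2,4,6) s(2,3) s'(2,3))
    qed
  qed
  from theI'[OF this] show "sigma B \<in> ring_hom full_ring full_ring" "sigma B (fromK B x) = fromK B x"
    "sigma B (fromL B b) = fromL B (b ^ card (UNIV :: 'f set))" unfolding sigma_def by blast+
qed

lemmas sg = full_ring_homD[OF sigma(1)]

text \<open>On \<open>fromK B x * fromL B b\<close> the iterates of \<open>sigma B\<close> act
  through the iterates of the q-Frobenius on \<open>b\<close>, and the latter is an injective
  self-map of the finite \<open>'l\<close>.\<close>

lemma sigma_finite_order: "\<exists>m>0. \<forall>z. (sigma B ^^ m) z = z"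
proof -
  have "inj (\<lambda>b::'l. b ^ card (UNIV :: 'f set))"
  proof (rule injI)
    fix a b :: 'l assume "a ^ card (UNIV :: 'f set) = b ^ card (UNIV :: 'f set)"
    moreover have "a ^ card (UNIV :: 'f set) = (a - b) ^ card (UNIV :: 'f set) + b ^ card (UNIV :: 'f set)" using frobenius_add[OF homs(2), of "a - b" b] by simp
    ultimately show "a = b" by simp
  qed
  then obtain m where m: "m > 0" "(\<lambda>b::'l. b ^ card (UNIV :: 'f set)) ^^ m = id" by (rule funpow_eq_id_of_inj)
  have prod: "(sigma B ^^ n) (fromK B x * fromL B b) = fromK B x * fromL B (((\<lambda>b. b ^ card (UNIV :: 'f set)) ^^ n) b)" for n x b
    by (induction n) (simp_all add: sg sigma(2,3))
  have diff: "(sigma B ^^ n) (y - z) = (sigma B ^^ n) y - (sigma B ^^ n) z" "(sigma B ^^ n) 0 = 0" for n y z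
    by (induction n) (simp_all add: sg)
  have "(sigma B ^^ m) z = z" for z
    by (induction z rule: E_induct) (simp_all add: prod diff m)
  then show ?thesis using m(1) by blast
qed

section \<open>The coordinate rings \<open>A\<close> and \<open>A_L\<close>\<close>

lemma cring_local_ring:
  assumes "discrete_valuation v"
  shows "cring (ring_on (local_ring v))"
proof -
  have mult: "v (x * y) = v x + v y" if "x \<noteq> 0" "y \<noteq> 0" for x y
    using assms that by (simp add: discrete_valuation_def)
  have add: "min (v x) (v y) \<le> v (x + y)" if "x \<noteq> 0" "y \<noteq> 0" "x + y \<noteq> 0" for x y
    using assms that by (simp add: discrete_valuation_def)
  have one: "v 1 = 0" using mult[of 1 1] by simp
  \<comment> \<open>Twice this value is \<open>v 1 = 0\<close>, and the values are integers.\<close>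
  have "v (- 1) = 0" using mult[of "- 1" "- 1"] one by simp
  then have neg: "v (- x) = v x" for x using mult[of "- 1" x] by (cases "x = 0") simp_all
  show ?thesis
  proof (rule cring_ring_onI)
    show "1 \<in> local_ring v" by (simp add: order_ge_def one)
    show "x - y \<in> local_ring v" if "x \<in> local_ring v" "y \<in> local_ring v" for x y
      using that add[of x "- y"] neg[of y] by (cases "x = 0"; cases "y = 0"; cases "x = y") (auto simp: order_ge_def min_def split: if_splits)
    show "x * y \<in> local_ring v" if "x \<in> local_ring v" "y \<in> local_ring v" for x y
      using that mult[of x y] by (cases "x = 0"; cases "y = 0") (auto simp: order_ge_def)
  qed
qed

lemma coord_ring_closed:
  "1 \<in> coord_ring B" "x \<in> coord_ring B \<Longrightarrow> y \<in> coord_ring B \<Longrightarrow> x + y \<in> coord_ring B"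
  "x \<in> coord_ring B \<Longrightarrow> y \<in> coord_ring B \<Longrightarrow> x * y \<in> coord_ring B"
proof -
  have v: "cring (ring_on (local_ring v))" if "v \<in> closed_points (constK B) - {infty B}" for v
    using that by (intro cring_local_ring) (simp add: closed_points_def)
  show "1 \<in> coord_ring B" "x \<in> coord_ring B \<Longrightarrow> y \<in> coord_ring B \<Longrightarrow> x + y \<in> coord_ring B"
    "x \<in> coord_ring B \<Longrightarrow> y \<in> coord_ring B \<Longrightarrow> x * y \<in> coord_ring B"
    unfolding coord_ring_def regular_functions_def using ring_on_closed(2-4)[OF v] by blast+
qed

lemma subspace_coord_ring: "subspace (coord_ring B)"
proof -
  have c: "constK B a \<in> coord_ring B" for a
    by (cases "a = 0") (auto simp: cK coord_ring_def regular_functions_def closed_points_def order_ge_def)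
  then show ?thesis using coord_ring_closed c[of 0] by (simp add: subspace_def cK)
qed

lemma AL_eq: "AL B = span_L (coord_ring B)"
  by (simp add: AL_def span_L_def)

lemmas AL_induct = span_L_induct[OF subspace_coord_ring, folded AL_eq, consumes 1, case_names zero prod diff]
lemmas AL_prod = span_L_prod[OF subspace_coord_ring, folded AL_eq]
lemmas AL_diff = span_L_diff[OF subspace_coord_ring, folded AL_eq]
lemmas AL_zero = span_L_zero[OF subspace_coord_ring, folded AL_eq]

lemma cring_AL: "cring (AL_ring B)"
proof (rule cring_ring_onI)
  show "1 \<in> AL B" using AL_prod[OF coord_ring_closed(1), of 1] by (simp add: fK fL)
  show "y * z \<in> AL B" if y: "y \<in> AL B" and z: "z \<in> AL B" for y z
    using y
  proof (induction rule: AL_induct)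
    case (prod x b)
    from z show ?case
    proof (induction rule: AL_induct)
      case (prod x' b')
      have "fromK B x * fromL B b * (fromK B x' * fromL B b') = fromK B (x * x') * fromL B (b * b')"
        by (simp add: fK fL)
      then show ?case using AL_prod[OF coord_ring_closed(3)[OF \<open>x \<in> coord_ring B\<close> prod], of "b * b'"] by simp
    qed (simp_all add: AL_zero right_diff_distrib AL_diff)
  qed (simp_all add: AL_zero left_diff_distrib AL_diff)
qed (rule AL_diff)

lemma sigma_AL: "z \<in> AL B \<Longrightarrow> sigma B z \<in> AL B"
  by (induction rule: AL_induct) (simp_all add: sg sigma(2,3) AL_zero AL_diff AL_prod)

text \<open>\<open>K\<close> is finite over the rational function field generated by
  \<open>x0\<close>. Generators of \<open>K\<close> over it, multiplied by all elements of the
  finite \<open>L\<close>, generate \<open>K \<otimes> L\<close> over it. This is the input for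
  counting residues.\<close>

lemma bounded_denominators:
  obtains x es where "finite_constants (range (\<lambda>a. fromK B (constK B a)))"
    "\<And>z. finite_constants.den (range (\<lambda>a. fromK B (constK B a))) x es z"
proof -
  let ?k = "range (\<lambda>a. fromK B (constK B a))"
  have fc: "finite_constants ?k"
  proof (rule finite_constants.intro)
    show "cring (ring_on ?k)"
    proof (rule cring_ring_onI)
      show "1 \<in> ?k" by (rule range_eqI[of _ _ 1]) (simp add: fK cK)
      show "x - y \<in> ?k" if "x \<in> ?k" "y \<in> ?k" for x y
        using that by (auto simp flip: fK(6) cK(6))
      show "x * y \<in> ?k" if "x \<in> ?k" "y \<in> ?k" for x y
        using that by (auto simp flip: fK(2) cK(2))
    qed
  qed simp
  interpret F: field "full_ring :: 'k ring" by (rule field_from_type_algebra)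
  obtain x0 n where dim: "F.dimension n (generate_field full_ring (insert x0 (range (constK B)))) UNIV"
    using base unfolding base_setting_def function_field_def F.finite_dimension_def by blast
  let ?G = "generate_field full_ring (insert x0 (range (constK B)))"
  interpret finite_constants ?k "fromK B x0" by (rule fc)
  have inv: "inv\<^bsub>full_ring\<^esub> h = inverse h" if "h \<noteq> 0" for h :: 'k
    using F.comm_inv_char[of h "inverse h"] that by simp
  \<comment> \<open>Elements of the field generated by \<open>x0\<close> are quotients of polynomial
    values; numerator and denominator share one degree bound.\<close>
  have frac: "\<exists>D d. d \<in> W D \<and> d \<noteq> 0 \<and> d * fromK B g \<in> W D" if "g \<in> ?G" for g
    using that
  proof (induction rule: generate_field.induct)
    case one
    show ?case using W_one[of 0] by (intro exI[of _ 0] exI[of _ 1]) (simp add: fK)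
  next
    case (incl h)
    then have "fromK B h \<in> W 1"
      using W_x_mult[OF W_one, of 0] W_mono[of 0 1] by auto
    then show ?case using W_one[of 1] by (intro exI[of _ 1] exI[of _ 1]) simp
  next
    case (a_inv h)
    then show ?case by (auto simp: fK dest: W_uminus)
  next
    \<comment> \<open>Inversion swaps the roles: \<open>d * fromK B h\<close> becomes the
      denominator and \<open>d\<close> the numerator.\<close>
    case (m_inv h)
    then obtain D d where "d \<in> W D" "d \<noteq> 0" "d * fromK B h \<in> W D" by blast
    moreover have "h \<noteq> 0" using m_inv by simp
    moreover have "fromK B h * fromK B (inverse h) = 1"
      using \<open>h \<noteq> 0\<close> by (simp add: fK(3) flip: fK(2))
    ultimately show ?case
      by (intro exI[of _ D] exI[of _ "d * fromK B h"]) (simp add: inv fK(9) mult.assoc)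
  next
    case (eng_add h1 h2)
    then obtain D d D' d' where 1: "d \<in> W D" "d \<noteq> 0" "d * fromK B h1 \<in> W D"
      "d' \<in> W D'" "d' \<noteq> 0" "d' * fromK B h2 \<in> W D'" by blast
    have "d * fromK B h1 * d' + d * (d' * fromK B h2) \<in> W (D + D')"
      by (intro W_add W_mult 1)
    then have "d * d' * fromK B (h1 \<oplus>\<^bsub>full_ring\<^esub> h2) \<in> W (D + D')" by (simp add: fK algebra_simps)
    then show ?case using W_mult[OF 1(1,4)] 1 by (intro exI[of _ "D + D'"] exI[of _ "d * d'"]) simp
  next
    case (eng_mult h1 h2)
    then obtain D d D' d' where 1: "d \<in> W D" "d \<noteq> 0" "d * fromK B h1 \<in> W D"
      "d' \<in> W D'" "d' \<noteq> 0" "d' * fromK B h2 \<in> W D'" by blast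
    have "d * d' * fromK B (h1 \<otimes>\<^bsub>full_ring\<^esub> h2) \<in> W (D + D')"
      using W_mult[OF 1(3,6)] by (simp add: fK mult_ac)
    then show ?case using W_mult[OF 1(1,4)] 1 by (intro exI[of _ "D + D'"] exI[of _ "d * d'"]) simp
  qed
  \<comment> \<open>Quantifying over all \<open>es\<close> that contain the products lets the
    induction hypothesis for \<open>E\<close> be applied with the longer list required by the next
    vector \<open>v\<close>.\<close>
  have "\<exists>us. \<forall>es. (\<lambda>(u, b). fromK B u * fromL B b) ` (set us \<times> UNIV) \<subseteq> set es \<longrightarrow>
      (\<forall>z\<in>E. \<forall>b. den es (fromK B z * fromL B b))" if "F.dimension n ?G E" for n E
    using that
  proof (induction n "?G" E rule: F.dimension.induct)
    case zero_dim
    show ?case by (intro exI[of _ "[]"]) (simp add: fK den_zero)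
  next
    case (Suc_dim v E n)
    obtain us where us: "\<And>es z b. (\<lambda>(u, b). fromK B u * fromL B b) ` (set us \<times> UNIV) \<subseteq> set es \<Longrightarrow>
      z \<in> E \<Longrightarrow> den es (fromK B z * fromL B b)" using Suc_dim by blast
    show ?case
    proof (intro exI[of _ "v # us"] allI impI ballI)
      fix es z b assume es: "(\<lambda>(u, b). fromK B u * fromL B b) ` (set (v # us) \<times> UNIV) \<subseteq> set es"
        and z: "z \<in> F.line_extension ?G v E"
      obtain g z' where g: "g \<in> ?G" "z' \<in> E" "z = g * v + z'"
        using z by (auto simp: F.line_extension_mem_iff)
      have "den es (fromK B v * fromL B b)" using es by (intro den_basis) auto
      then have "den es (fromK B g * (fromK B v * fromL B b))" using frac[OF g(1)] den_mult by blast
      moreover have "den es (fromK B z' * fromL B b)" using es g(2) by (intro us) auto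
      ultimately have "den es (fromK B g * (fromK B v * fromL B b) + fromK B z' * fromL B b)"
        by (rule den_add)
      then show "den es (fromK B z * fromL B b)" by (simp add: g(3) fK algebra_simps)
    qed
  qed
  from this[OF dim] obtain us where us: "\<And>es z b. (\<lambda>(u, b). fromK B u * fromL B b) ` (set us \<times> UNIV) \<subseteq> set es \<Longrightarrow>
      den es (fromK B z * fromL B b)" by blast
  \<comment> \<open>The products with all elements of \<open>'l\<close> form a finite set because
    \<open>'l\<close> is finite.\<close>
  obtain es where es: "set es = (\<lambda>(u, b). fromK B u * fromL B b) ` (set us \<times> UNIV)"
    using finite_list[of "(\<lambda>(u, b). fromK B u * fromL B b) ` (set us \<times> UNIV)"] by auto
  have "den es z" for z
  proof (induction z rule: E_induct)
    case zero then show ?case by (rule den_zero)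
  next
    case (prod x b) then show ?case using us es by blast
  next
    case (diff y z)
    have "den es (- 1 * z)"
      by (rule den_mult[of 1 0, OF W_one _ _ diff(2)]) (use W_uminus[OF W_one, of 0] in simp_all)
    then show ?case using den_add[OF diff(1), of "- z"] by simp
  qed
  then show ?thesis using that fc by blast
qed

lemma AL_frobenius: "\<exists>m. finite_order_frobenius (AL B) (sigma B) m"
proof -
  obtain m where m: "m > 0" "\<forall>z. (sigma B ^^ m) z = z" using sigma_finite_order by blast
  obtain x es where "finite_constants (range (\<lambda>a. fromK B (constK B a)))"
    and den: "\<And>z. finite_constants.den (range (\<lambda>a. fromK B (constK B a))) x es z"
    using bounded_denominators by blast
  then interpret finite_constants "range (\<lambda>a. fromK B (constK B a))" x by blast
  have "\<exists>S. finite S \<and> S \<subseteq> AL B \<and> (\<forall>y\<in>AL B. \<exists>z\<in>S. \<exists>b\<in>AL B. y - z = a * b)"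
    if "a \<in> AL B" "a \<noteq> 0" for a
    using finite_residue_ring[OF den cring_AL that] by metis
  then have "finite_order_frobenius (AL B) (sigma B) m"
    by (intro finite_order_frobenius.intro cring_AL) (use m in \<open>simp_all add: sg sigma_AL\<close>)
  then show ?thesis by blast
qed

end

section \<open>Pure Anderson motives\<close>

locale frobenius_curve = base_curve B + finite_order_frobenius "AL B" "sigma B" m
  for B :: "('f::{finite,field}, 'k::field, 'l::{finite,field}, 'e::field) base_data" and m
begin

lemma motive_semilinear:
  assumes "(M, \<tau>) \<in> pure_anderson_motives B"
  shows "semilinear M (semilinear_part B M \<tau>)"
    and "module (AL_ring B) M" and "\<tau> \<in> mod_homs (AL_ring B) (pb M) M"
proof -
  show M: "module (AL_ring B) M" and \<tau>: "\<tau> \<in> mod_homs (AL_ring B) (pb M) M"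
    using assms
    by (auto simp: pure_anderson_motives_def anderson_motive_def locally_free_def sigma_pullback_def)
  show "semilinear M (semilinear_part B M \<tau>)"
    using semilinear_of_pullback_hom(1)[OF M \<tau>]
    by (simp add: semilinear_part_def[abs_def] sigma_tensor_def)
qed

lemma motive_locally_free:
  assumes "(M, \<tau>) \<in> pure_anderson_motives B"
  obtains r where "locally_free (AL B) M r"
  using assms by (auto simp: pure_anderson_motives_def anderson_motive_def)

text \<open>Every element of the pullback has the form x \<otimes> 1, so commutation with \<tau> and
  \<tau>' has to be tested on these only.\<close>

lemma motive_morphism_iff:
  assumes P: "(M, \<tau>) \<in> pure_anderson_motives B" and P': "(M', \<tau>') \<in> pure_anderson_motives B"
  shows "motive_morphism B (M, \<tau>) (M', \<tau>') f \<longleftrightarrow>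
    equivariant M (semilinear_part B M \<tau>) M' (semilinear_part B M' \<tau>') f"
proof (cases "f \<in> mod_homs (AL_ring B) M M'")
  case True
  have im: "carrier (pb M) = (\<lambda>x. pt M x 1) ` carrier M"
    using pullback_bij[OF motive_semilinear(2)[OF P]] by (simp add: bij_betw_def)
  have "motive_morphism B (M, \<tau>) (M', \<tau>') f \<longleftrightarrow>
      (\<forall>x\<in>carrier M. f (\<tau> (pt M x 1)) = \<tau>' (sigma_pullback_map B M' f (pt M x 1)))"
    using True by (simp add: motive_morphism_def sigma_pullback_def im)
  also have "\<dots> \<longleftrightarrow> (\<forall>x\<in>carrier M. f (\<tau> (pt M x 1)) = \<tau>' (pt M' (f x) 1))"
    using pullback_map[OF motive_semilinear(2)[OF P] motive_semilinear(2)[OF P'] True]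
    by (intro ball_cong refl) (simp add: sigma_pullback_map_def sigma_pullback_def sigma_tensor_def)
  finally show ?thesis
    using True by (simp add: equivariant_def semilinear_part_def sigma_tensor_def)
qed (simp add: motive_morphism_def equivariant_def)

text \<open>The bridge between motives and semilinear maps: reflexivity, symmetry and transitivity
  are proved on the right-hand side and carried over.\<close>

lemma separable_isogeny_iff:
  assumes P: "(M, \<tau>) \<in> pure_anderson_motives B" and P': "(M', \<tau>') \<in> pure_anderson_motives B"
  shows "separable_isogeny B (M, \<tau>) (M', \<tau>') f \<longleftrightarrow>
    separable M (semilinear_part B M \<tau>) M' (semilinear_part B M' \<tau>') f"
proof (cases "equivariant M (semilinear_part B M \<tau>) M' (semilinear_part B M' \<tau>') f")
  case True
  let ?H = "f ` carrier M" and ?t' = "semilinear_part B M' \<tau>'"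
  note sl = motive_semilinear(1)[OF P] motive_semilinear(1)[OF P']
  have H: "stable_submodule (AL B) (sigma B) m M' ?t' ?H"
    using sl True by (rule equivariant_image)
  interpret stable_submodule "AL B" "sigma B" m M' ?t' ?H by (rule H)
  interpret Q: module_quotient "AL_ring B" M' ?H
    by (intro module_quotient.intro module_quotient_axioms.intro motive_semilinear(2)[OF P'] H_subset H_zero)
      (simp_all add: H_add H_smult)
  have t': "?t' = (\<lambda>x. \<tau>' (pt M' x 1))"
    by (simp add: semilinear_part_def[abs_def] sigma_tensor_def)
  have "(\<forall>Z\<in>carrier Q.Q. \<exists>a\<in>AL B - {0}. a \<odot>\<^bsub>Q.Q\<^esub> Z = \<zero>\<^bsub>Q.Q\<^esub>) \<longleftrightarrow>
      (\<forall>y\<in>carrier M'. \<exists>a\<in>AL B - {0}. a \<odot>\<^bsub>M'\<^esub> y \<in> ?H)"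
    using Q.co_smult Q.co_is_zero smult_closed by (simp add: Q.carrier_Q)
  then show ?thesis
    using True motive_morphism_iff[OF P P', of f]
      induced_coker_bij_iff[OF sl(2) motive_semilinear(2,3)[OF P'] t' H]
    by (simp add: separable_isogeny_def isogeny_def separable_def coker_def Let_def
        induced_on_coker_def sigma_pullback_def sigma_tensor_def)
next
  case False
  then show ?thesis
    using motive_morphism_iff[OF P P', of f] by (simp add: separable_isogeny_def isogeny_def separable_def)
qed

lemma separable_isogeny_symmetric:
  assumes P: "(M, \<tau>) \<in> pure_anderson_motives B" and P': "(M', \<tau>') \<in> pure_anderson_motives B"
    and f: "separable_isogeny B (M, \<tau>) (M', \<tau>') f"
  shows "\<exists>h. separable_isogeny B (M', \<tau>') (M, \<tau>) h"
proof -
  \<comment> \<open>Local freeness of the target \<open>M'\<close> supplies its generators, its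
    torsion-freeness and its rank bound.\<close>
  obtain r where lf: "locally_free (AL B) M' r" using P' by (rule motive_locally_free)
  obtain ys where "set ys \<subseteq> carrier M'" "carrier M' = list_span (AL_ring B) M' ys"
    using lf by (rule locally_free_finitely_generated)
  then show ?thesis
    using separable_reverse[OF motive_semilinear(1)[OF P] motive_semilinear(1)[OF P']
        f[unfolded separable_isogeny_iff[OF P P']] locally_free_torsion_free[OF lf] locally_free_rank_le[OF lf]]
    by (simp add: separable_isogeny_iff[OF P' P])
qed

end

theorem theorem2p10:
  fixes B :: "('f::{finite,field}, 'k::field, 'l::{finite,field}, 'e::field) base_data"
  assumes "base_setting B"
  shows "equiv (pure_anderson_motives B :: ('e, 'm) motive_data set)
    {(P, Q). P \<in> pure_anderson_motives B \<and> Q \<in> pure_anderson_motives B \<and>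
       (\<exists>f. separable_isogeny B P Q f)}"
proof -
  interpret base_curve B by unfold_locales (rule assms)
  obtain m where "finite_order_frobenius (AL B) (sigma B) m" using AL_frobenius by blast
  then interpret finite_order_frobenius "AL B" "sigma B" m .
  interpret frobenius_curve B m ..
  let ?A = "pure_anderson_motives B :: ('e, 'm) motive_data set"
  show ?thesis
  proof (rule equivI)
    show "refl_on ?A {(P, Q). P \<in> ?A \<and> Q \<in> ?A \<and> (\<exists>f. separable_isogeny B P Q f)}"
    proof (rule refl_onI, clarify)
      fix M \<tau> assume P: "(M, \<tau>) \<in> ?A"
      have "separable_isogeny B (M, \<tau>) (M, \<tau>) (\<lambda>x. x)"
        using separable_refl[OF motive_semilinear(1)[OF P]] by (simp add: separable_isogeny_iff P)
      then show "\<exists>f. separable_isogeny B (M, \<tau>) (M, \<tau>) f" by blast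
    qed
    show "sym {(P, Q). P \<in> ?A \<and> Q \<in> ?A \<and> (\<exists>f. separable_isogeny B P Q f)}"
      using separable_isogeny_symmetric by (auto simp: sym_def)
    show "trans {(P, Q). P \<in> ?A \<and> Q \<in> ?A \<and> (\<exists>f. separable_isogeny B P Q f)}"
    proof (rule transI, clarify)
      fix M \<tau> M' \<tau>' M'' \<tau>'' f g
      assume P: "(M, \<tau>) \<in> ?A" "(M', \<tau>') \<in> ?A" "(M'', \<tau>'') \<in> ?A"
        and f: "separable_isogeny B (M, \<tau>) (M', \<tau>') f" and g: "separable_isogeny B (M', \<tau>') (M'', \<tau>'') g"
      have "separable_isogeny B (M, \<tau>) (M'', \<tau>'') (g \<circ> f)"
        using separable_trans[OF motive_semilinear(1)[OF P(1)] motive_semilinear(1)[OF P(2)]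
            motive_semilinear(1)[OF P(3)]] f g
        by (simp add: separable_isogeny_iff P)
      then show "\<exists>f. separable_isogeny B (M, \<tau>) (M'', \<tau>'') f" by blast
    qed
  qed auto
qed

end
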